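(* Let $\varpi=\varpi_{\beta\to\alpha}$ be an oriented geodesic on $\mathfrak h$ joining $\beta$ to $\alpha$, with geodesic continued fraction expansion $B_0^{-1}\varpi=\llbracket i_1,i_2,i_3,\dots\rrbracket_{\Delta(2,3,7)}$. For $k\ge1$ set $A_k=g_7^{i_k}g_2$ and $B_k=B_0A_1\cdots A_k$. Then for every sequence $(z_k)_{k\ge0}$ with $z_k\in B_kS_0$ for all $k$, we have $\lim_{k\to\infty}z_k=\alpha$ in the topology of $\mathbb{P}^1(\mathbb{C})$. In particular, $\lim_{k\to\infty}B_kz=\alpha$ for every $z\in S_0$.
   Context: Let $\eta=2\cos(2\pi/7)$, $F=\mathbb{Q}(\eta)$, $A=F+Fi+Fj+Fk$ ($i^2=j^2=\eta$, $ij=-ji=k$) identified with a subalgebra of $M_2(\mathbb{R})$ via $i\mapsto\begin{pmatrix}0&\eta\\1&0\end{pmatrix}$, $j\mapsto\begin{pmatrix}\sqrt\eta&0\\0&-\sqrt\eta\end{pmatrix}$; $\mathcal O=\mathbb Z[\eta][i,j,\frac12(1+\eta i+(1+\eta+\eta^2)j)]$ and $\Delta(2,3,7)=\{x\in\mathcal O^\times:\det x=1\}$, acting on $\overline{\mathfrak h}=\mathfrak h\cup\mathbb{P}^1(\mathbb{R})\subset\mathbb{P}^1(\mathbb{C})$ by linear fractional transformations. $g_2=\begin{pmatrix}0&-\sqrt\eta\\1/\sqrt\eta&0\end{pmatrix}$, $g_3=\frac12\begin{pmatrix}1+(\eta^2-2)\sqrt\eta&-(\eta^2+\eta-1)\sqrt\eta\\(3-\eta^2)\sqrt\eta&1-(\eta^2-2)\sqrt\eta\end{pmatrix}$,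 $g_7=\frac12\begin{pmatrix}\eta^2+\eta-1&\eta^2-1-\sqrt\eta\\2-\eta^2+(\eta^2+\eta-2)\sqrt\eta&\eta^2+\eta-1\end{pmatrix}$; $\tau_3,\tau_7$ the fixed points in $\mathfrak h$ of $g_3,g_7$, $\tau_3'=g_2\tau_3$. $\mathcal F$ = closed geodesic triangle with vertices $\tau_3,\tau_3',\tau_7$; $\mathcal D=\bigcup_{i=0}^6g_7^i\mathcal F$; $\mathbf e_0=[\tau_3,\tau_3')$ (half-open geodesic segment containing $\tau_3$), $\mathbf e_0'=(\tau_3,\tau_3']$, $\mathbf e_i=g_7^i\mathbf e_0$, $\mathbf e_i'=g_7^i\mathbf e_0'$ ($i\in\mathbb Z/7\mathbb Z$). $S_0=\{w\in\mathbb{C}:|w|\le\sqrt\eta,\ \operatorname{Im}w\ge0\}$. $\varpi_{\beta\to\alpha}$ = geodesic oriented from $\beta$ to $\alpha$. If $\varpi\cap\mathcal D\neq\emptyset$ it is an oriented closed segment from $P$ to $Q$; $\varpi$ enters $\mathcal D$ from $\mathbf e_i$ if $P\in\mathbf e_i$, leaves from $\mathbf e_i'$ if $Q\in\mathbf e_i'$. $\varpi_{\beta\to\alpha}$ is reduced if it enters from $\mathbf e_0$ and $|\alpha|<\sqrt\eta$. For reduced $\varpi$ there is a unique $i\in\mathbb Z/7\mathbb Z\setminus\{0\}$ with $\varpi$ leaving $\mathcal D$ from $\mathbf e_i'$, and $(g_7^ig_2)^{-1}\varpi$ is reduced. Geodesic continued fraction expansion: choose $B_0\in\Delta(2,3,7)$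 with $\varpi_0:=B_0^{-1}\varpi$ reduced; given reduced $\varpi_k$, $i_{k+1}$ is the index with $\varpi_k$ leaving $\mathcal D$ from $\mathbf e'_{i_{k+1}}$, and $\varpi_{k+1}=(g_7^{i_{k+1}}g_2)^{-1}\varpi_k$; written $B_0^{-1}\varpi=\llbracket i_1,i_2,\dots\rrbracket_{\Delta(2,3,7)}$. *)

theory Defs
  imports "HOL-Analysis.Analysis"
begin

section \<open>The group \<open>\<Delta>(2,3,7)\<close>\<close>

definition eta :: real (\<open>\<eta>\<close>) where
  "\<eta> = 2 * cos (2 * pi / 7)"

definition mat2 :: "real \<Rightarrow> real \<Rightarrow> real \<Rightarrow> real \<Rightarrow> real^2^2" where
  "mat2 a b c d = vector [vector [a, b], vector [c, d]]"

definition quat_i :: "real^2^2" where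
  "quat_i = mat2 0 \<eta> 1 0"

definition quat_j :: "real^2^2" where
  "quat_j = mat2 (sqrt \<eta>) 0 0 (- sqrt \<eta>)"

text \<open>
  The product \<open>*\<close> that the library puts on \<open>real^2^2\<close> is componentwise, so the ring structure
  of \<open>M\<^sub>2(\<real>)\<close> is the one given by \<open>**\<close>. The order \<open>\<int>[\<eta>][i, j, (1 + \<eta>i + (1 + \<eta> + \<eta>\<^sup>2)j)/2]\<close>
  is the subring of \<open>M\<^sub>2(\<real>)\<close> generated by the scalar matrix \<open>\<eta>\<close> and the three bracketed elements.
\<close>

inductive_set hurwitz_order :: "(real^2^2) set" where
  one: "mat 1 \<in> hurwitz_order"
| eta: "mat \<eta> \<in> hurwitz_order"
| i: "quat_i \<in> hurwitz_order"
| j: "quat_j \<in> hurwitz_order"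
| half: "(1/2) *\<^sub>R (mat 1 + \<eta> *\<^sub>R quat_i + (1 + \<eta> + \<eta>^2) *\<^sub>R quat_j) \<in> hurwitz_order"
| diff: "x \<in> hurwitz_order \<Longrightarrow> y \<in> hurwitz_order \<Longrightarrow> x - y \<in> hurwitz_order"
| mult: "x \<in> hurwitz_order \<Longrightarrow> y \<in> hurwitz_order \<Longrightarrow> x ** y \<in> hurwitz_order"

definition Delta237 :: "(real^2^2) set" where
  "Delta237 = {x \<in> hurwitz_order.
     (\<exists>y \<in> hurwitz_order. x ** y = mat 1 \<and> y ** x = mat 1) \<and> det x = 1}"

definition g2 :: "real^2^2" where
  "g2 = mat2 0 (- sqrt \<eta>) (1 / sqrt \<eta>) 0"

definition g3 :: "real^2^2" where
  "g3 = (1/2) *\<^sub>R mat2 (1 + (\<eta>^2 - 2) * sqrt \<eta>) (- (\<eta>^2 + \<eta> - 1) * sqrt \<eta>)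
                    ((3 - \<eta>^2) * sqrt \<eta>)     (1 - (\<eta>^2 - 2) * sqrt \<eta>)"

definition g7 :: "real^2^2" where
  "g7 = (1/2) *\<^sub>R mat2 (\<eta>^2 + \<eta> - 1)                           (\<eta>^2 - 1 - sqrt \<eta>)
                    (2 - \<eta>^2 + (\<eta>^2 + \<eta> - 2) * sqrt \<eta>)   (\<eta>^2 + \<eta> - 1)"

primrec mat_pow :: "real^2^2 \<Rightarrow> nat \<Rightarrow> real^2^2" where
  "mat_pow M 0 = mat 1"
| "mat_pow M (Suc n) = M ** mat_pow M n"


section \<open>The projective line and linear fractional transformations\<close>

text \<open>
  \<open>\<P>\<^sup>1(\<real>)\<close> and \<open>\<P>\<^sup>1(\<complex>)\<close> are \<open>real option\<close> and \<open>complex option\<close>, with \<open>None\<close> the point at infinity.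
  Points of the upper half plane are regarded as elements of \<open>\<P>\<^sup>1(\<complex>)\<close> throughout.
\<close>

definition P1C :: "complex option topology" where
  "P1C = Alexandroff_compactification euclidean"

abbreviation P1R_to_P1C :: "real option \<Rightarrow> complex option" where
  "P1R_to_P1C \<equiv> map_option complex_of_real"

fun lft :: "real^2^2 \<Rightarrow> 'a::real_field option \<Rightarrow> 'a option" where
  "lft M None = (if M$2$1 = 0 then None else Some (of_real (M$1$1 / M$2$1)))"
| "lft M (Some z) =
     (if of_real (M$2$1) * z + of_real (M$2$2) = 0 then None
      else Some (moebius (of_real (M$1$1)) (of_real (M$1$2))
                         (of_real (M$2$1)) (of_real (M$2$2)) z))"

definition upper_half_plane :: "complex option set" where
  "upper_half_plane = Some ` {z. Im z > 0}"


section \<open>Geodesics\<close>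

text \<open>
  \<open>geodesic \<beta> \<alpha>\<close> is a unit speed parametrisation of the geodesic oriented from \<open>\<beta>\<close> to \<open>\<alpha>\<close>
  (for \<open>\<beta> \<noteq> \<alpha>\<close>): \<open>t \<rightarrow> -\<infinity>\<close> leads to \<open>\<beta>\<close> and \<open>t \<rightarrow> \<infinity>\<close> leads to \<open>\<alpha>\<close>. The degenerate case
  \<open>\<beta> = \<alpha>\<close> is never used.
\<close>

fun geodesic :: "real option \<Rightarrow> real option \<Rightarrow> real \<Rightarrow> complex option" where
  "geodesic (Some b) (Some a) t =
     Some (Complex ((b + a) / 2 + (a - b) / 2 * tanh t) (\<bar>a - b\<bar> / 2 / cosh t))"
| "geodesic (Some b) None t = Some (Complex b (exp t))"
| "geodesic None (Some a) t = Some (Complex a (exp (- t)))"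
| "geodesic None None t = None"

definition geodesic_segment :: "complex option \<Rightarrow> complex option \<Rightarrow> complex option set" where
  "geodesic_segment P Q = {geodesic \<beta> \<alpha> t | \<beta> \<alpha> r s t.
     \<beta> \<noteq> \<alpha> \<and> r \<le> t \<and> t \<le> s \<and> geodesic \<beta> \<alpha> r = P \<and> geodesic \<beta> \<alpha> s = Q}"

definition geodesically_convex :: "complex option set \<Rightarrow> bool" where
  "geodesically_convex C \<longleftrightarrow>
     C \<subseteq> upper_half_plane \<and> (\<forall>P\<in>C. \<forall>Q\<in>C. geodesic_segment P Q \<subseteq> C)"

definition geodesic_triangle ::
  "complex option \<Rightarrow> complex option \<Rightarrow> complex option \<Rightarrow> complex option set" where
  "geodesic_triangle P Q R = geodesically_convex hull {P, Q, R}"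


section \<open>The fundamental domain and its edges\<close>

definition tau3 :: "complex option" where
  "tau3 = (THE \<tau>. \<tau> \<in> upper_half_plane \<and> lft g3 \<tau> = \<tau>)"

definition tau7 :: "complex option" where
  "tau7 = (THE \<tau>. \<tau> \<in> upper_half_plane \<and> lft g7 \<tau> = \<tau>)"

definition tau3' :: "complex option" where
  "tau3' = lft g2 tau3"

definition tile_F :: "complex option set" where
  "tile_F = geodesic_triangle tau3 tau3' tau7"

definition heptagon_D :: "complex option set" where
  "heptagon_D = (\<Union>i\<in>{0..6}. lft (mat_pow g7 i) ` tile_F)"

text \<open>
  Since \<open>g\<^sub>7\<^sup>7 = -1\<close> acts trivially, edges indexed by \<open>\<int>/7\<int>\<close> may be indexed by representatives.
\<close>

definition edge :: "nat \<Rightarrow> complex option set" where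
  "edge i = lft (mat_pow g7 i) ` (geodesic_segment tau3 tau3' - {tau3'})"

definition edge' :: "nat \<Rightarrow> complex option set" where
  "edge' i = lft (mat_pow g7 i) ` (geodesic_segment tau3 tau3' - {tau3})"

definition S0 :: "complex option set" where
  "S0 = Some ` {w. cmod w \<le> sqrt \<eta> \<and> Im w \<ge> 0}"


section \<open>Geodesic continued fractions\<close>

text \<open>
  The end points \<open>P\<close> and \<open>Q\<close> of the oriented segment in which a geodesic meets the heptagon are
  its first and its last point there.
\<close>

definition enters_at :: "real option \<Rightarrow> real option \<Rightarrow> complex option \<Rightarrow> bool" where
  "enters_at \<beta> \<alpha> P \<longleftrightarrow>
     (\<exists>t. P = geodesic \<beta> \<alpha> t \<and> P \<in> heptagon_D \<and> (\<forall>s<t. geodesic \<beta> \<alpha> s \<notin> heptagon_D))"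

definition leaves_at :: "real option \<Rightarrow> real option \<Rightarrow> complex option \<Rightarrow> bool" where
  "leaves_at \<beta> \<alpha> Q \<longleftrightarrow>
     (\<exists>t. Q = geodesic \<beta> \<alpha> t \<and> Q \<in> heptagon_D \<and> (\<forall>s>t. geodesic \<beta> \<alpha> s \<notin> heptagon_D))"

definition enters_from :: "real option \<Rightarrow> real option \<Rightarrow> nat \<Rightarrow> bool" where
  "enters_from \<beta> \<alpha> i \<longleftrightarrow> (\<exists>P. enters_at \<beta> \<alpha> P \<and> P \<in> edge i)"

definition leaves_from :: "real option \<Rightarrow> real option \<Rightarrow> nat \<Rightarrow> bool" where
  "leaves_from \<beta> \<alpha> i \<longleftrightarrow> (\<exists>Q. leaves_at \<beta> \<alpha> Q \<and> Q \<in> edge' i)"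

definition reduced :: "real option \<Rightarrow> real option \<Rightarrow> bool" where
  "reduced \<beta> \<alpha> \<longleftrightarrow> enters_from \<beta> \<alpha> 0 \<and> (\<exists>a. \<alpha> = Some a \<and> \<bar>a\<bar> < sqrt \<eta>)"

definition step_matrix :: "nat \<Rightarrow> real^2^2" where
  "step_matrix i = mat_pow g7 i ** g2"

text \<open>
  \<open>gcf_end B\<^sub>0 i \<xi> k\<close> is the end point of the geodesic \<open>\<varpi>\<^sub>k\<close> that corresponds to the end point \<open>\<xi>\<close>
  of the original geodesic \<open>\<varpi>\<close>, so \<open>\<varpi>\<^sub>k\<close> runs from \<open>gcf_end B\<^sub>0 i \<beta> k\<close> to \<open>gcf_end B\<^sub>0 i \<alpha> k\<close>.
  The value \<open>i 0\<close> of the index sequence is irrelevant.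
\<close>

primrec gcf_end :: "real^2^2 \<Rightarrow> (nat \<Rightarrow> nat) \<Rightarrow> real option \<Rightarrow> nat \<Rightarrow> real option" where
  "gcf_end B\<^sub>0 i \<xi> 0 = lft (matrix_inv B\<^sub>0) \<xi>"
| "gcf_end B\<^sub>0 i \<xi> (Suc k) = lft (matrix_inv (step_matrix (i (Suc k)))) (gcf_end B\<^sub>0 i \<xi> k)"

definition gcf_expansion ::
  "real^2^2 \<Rightarrow> real option \<Rightarrow> real option \<Rightarrow> (nat \<Rightarrow> nat) \<Rightarrow> bool" where
  "gcf_expansion B\<^sub>0 \<beta> \<alpha> i \<longleftrightarrow>
     B\<^sub>0 \<in> Delta237 \<and>
     reduced (gcf_end B\<^sub>0 i \<beta> 0) (gcf_end B\<^sub>0 i \<alpha> 0) \<and>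
     (\<forall>k. i (Suc k) \<in> {1..6} \<and>
          leaves_from (gcf_end B\<^sub>0 i \<beta> k) (gcf_end B\<^sub>0 i \<alpha> k) (i (Suc k)))"

primrec gcf_matrix :: "real^2^2 \<Rightarrow> (nat \<Rightarrow> nat) \<Rightarrow> nat \<Rightarrow> real^2^2" where
  "gcf_matrix B\<^sub>0 i 0 = B\<^sub>0"
| "gcf_matrix B\<^sub>0 i (Suc k) = gcf_matrix B\<^sub>0 i k ** step_matrix (i (Suc k))"

end

theory Submission
  imports Defs
begin

text \<open>
  Points of the closed upper half plane are tested against real binary quadratic forms: the form
  \<open>\<ell>(x, y) = x\<^sup>2 - \<eta>y\<^sup>2\<close> is nonpositive on \<open>S\<^sub>0\<close>, hence \<open>\<ell>\<^sub>k = \<ell> \<circ> B\<^sub>k\<^sup>-\<^sup>1\<close> is nonpositive on \<open>B\<^sub>kS\<^sub>0\<close>. Let \<open>a\<close>, \<open>b\<close>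
  be lifts of \<open>\<alpha>\<close>, \<open>\<beta>\<close> to \<open>\<real>\<^sup>2\<close>. Then \<open>\<ell>\<^sub>k(a) < 0 < \<ell>\<^sub>k(b)\<close>, and the ratio \<open>r\<^sub>k = - \<ell>\<^sub>k(b) / \<ell>\<^sub>k(a)\<close> is the
  position on \<open>\<varpi>\<close> of its crossing point with the edge \<open>B\<^sub>ke\<^sub>0\<close>. The position never decreases, and it
  stays the same only when \<open>\<varpi>\<close> passes through a vertex and the index is 6. The index 6 cannot
  occur twice in a row, because \<open>g\<^sub>7\<^sup>6g\<^sub>2\<close> is a rotation of order 3, around a vertex, and the three
  rotated forms add up to 0. So a form occurs at most twice among the \<open>\<ell>\<^sub>k\<close>.

  The \<open>\<ell>\<^sub>k\<close> have coefficients in a lattice over \<open>\<int>[\<eta>]\<close> whose conjugates are bounded, as the quaternion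
  algebra is definite at the other two real places. Hence only finitely many \<open>\<ell>\<^sub>k\<close> are bounded by a given
  constant and \<open>\<ell>\<^sub>k(b) \<rightarrow> \<infinity>\<close>; as all \<open>\<ell>\<^sub>k\<close> have the same discriminant, \<open>\<ell>\<^sub>k(a) \<rightarrow> 0\<close>, and the region
  where \<open>\<ell>\<^sub>k \<le> 0\<close> shrinks to \<open>\<alpha>\<close>.
\<close>

section \<open>The number \<open>\<eta>\<close>\<close>

lemma eta_gt_1: "\<eta> > 1"
proof -
  have "cos (2 * pi / 7) > cos (pi / 3)"
    by (subst cos_mono_less_eq) (auto simp: field_simps)
  thus ?thesis by (simp add: eta_def cos_60)
qed

text \<open>For \<theta> = 2\<pi>/7 the angles 3\<theta> and 4\<theta> add up to 2\<pi>, so they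
  have the same cosine. The resulting quartic in cos \<theta> has the extra root 1, which is divided
  out.\<close>

lemma eta_minpoly: "\<eta>^3 = 1 + 2 * \<eta> - \<eta>^2"
proof -
  define c where "c = cos (2 * pi / 7)"
  have "cos (3 * (2 * pi / 7)) = cos (2 * pi - 3 * (2 * pi / 7))"
    by (simp only: cos_diff) simp
  also have "2 * pi - 3 * (2 * pi / 7) = 2 * (2 * (2 * pi / 7))" by simp
  finally have "4 * c^3 - 3 * c = 2 * (2 * c^2 - 1)^2 - 1"
    unfolding cos_treble_cos cos_double_cos c_def by simp
  hence "(c - 1) * (8 * c^3 + 4 * c^2 - 4 * c - 1) = 0" by algebra
  moreover have "c \<noteq> 1"
    using cos_monotone_0_pi[of 0 "2 * pi / 7"] by (simp add: c_def)
  ultimately have "8 * c^3 + 4 * c^2 - 4 * c - 1 = 0" by simp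
  moreover have "\<eta> = 2 * c" by (simp add: eta_def c_def)
  ultimately show ?thesis by algebra
qed

text \<open>By the minimal polynomial the factors \<open>\<eta> - 1\<close> and
  \<open>\<eta>^2 + 2 * \<eta>\<close> have product 1. Both increase with \<eta>, so values outside
  the interval are refuted.\<close>

lemma eta_bounds: "1.24 < \<eta>" "\<eta> < 1.25"
proof -
  have *: "(\<eta> - 1) * (\<eta>^2 + 2 * \<eta>) = 1" using eta_minpoly by algebra
  show "1.24 < \<eta>"
  proof (rule ccontr)
    assume "\<not> ?thesis"
    hence "(\<eta> - 1) * (\<eta>^2 + 2 * \<eta>) \<le> 0.24 * (1.24^2 + 2 * 1.24)"
      using eta_gt_1 by (intro mult_mono add_mono power_mono) auto
    with * show False by (simp add: power2_eq_square)
  qed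
  show "\<eta> < 1.25"
  proof (rule ccontr)
    assume "\<not> ?thesis"
    hence "0.25 * (1.25^2 + 2 * 1.25) \<le> (\<eta> - 1) * (\<eta>^2 + 2 * \<eta>)"
      by (intro mult_mono add_mono power_mono) auto
    with * have "(0.25 * (1.25^2 + 2 * 1.25) :: real) \<le> 1" by simp
    thus False by (simp add: power2_eq_square)
  qed
qed

lemma eta_sq_bounds: "1.53 < \<eta>^2" "\<eta>^2 < 1.57"
proof -
  have "1.24^2 < \<eta>^2" "\<eta>^2 < 1.25^2"
    using eta_bounds by (auto intro!: power_strict_mono)
  thus "1.53 < \<eta>^2" "\<eta>^2 < 1.57" by (auto simp: power2_eq_square)
qed

abbreviation sqrt_eta :: real (\<open>\<sigma>\<close>) where "\<sigma> \<equiv> sqrt \<eta>"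

lemma sqrt_eta_sq: "\<sigma>^2 = \<eta>" and sqrt_eta_pos: "\<sigma> > 0"
  using eta_gt_1 by auto

section \<open>The ring \<open>\<int>[\<eta>]\<close> and its conjugates\<close>

definition minpoly_root :: "real \<Rightarrow> bool" where
  "minpoly_root x \<longleftrightarrow> x^3 = 1 + 2 * x - x^2"

definition zquad :: "int \<Rightarrow> int \<Rightarrow> int \<Rightarrow> real \<Rightarrow> real" where
  "zquad p q r x = of_int p + of_int q * x + of_int r * x^2"

text \<open>One function carries an element of \<int>[\<eta>] together with its conjugates: the same
  integers must serve at every real root of the minimal polynomial.\<close>

definition zpoly :: "(real \<Rightarrow> real) \<Rightarrow> bool" where
  "zpoly F \<longleftrightarrow> (\<exists>p q r. \<forall>x. minpoly_root x \<longrightarrow> F x = zquad p q r x)"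

lemma zpoly_const: "zpoly (\<lambda>x. of_int n)"
  unfolding zpoly_def zquad_def by (intro exI[of _ n] exI[of _ 0]) auto

lemma zpoly_numeral: "zpoly (\<lambda>x. numeral n)"
  using zpoly_const[of "numeral n"] by simp

lemma zpoly_ident: "zpoly (\<lambda>x. x)"
  unfolding zpoly_def zquad_def by (rule exI[of _ 0], rule exI[of _ 1], rule exI[of _ 0]) auto

lemma zpoly_zquad: "zpoly (zquad p q r)"
  unfolding zpoly_def by blast

lemma zpoly_diff:
  assumes "zpoly F" "zpoly G" shows "zpoly (\<lambda>x. F x - G x)"
proof -
  obtain p q r p' q' r' where
    "\<forall>x. minpoly_root x \<longrightarrow> F x = zquad p q r x" "\<forall>x. minpoly_root x \<longrightarrow> G x = zquad p' q' r' x"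
    using assms unfolding zpoly_def by blast
  hence "\<forall>x. minpoly_root x \<longrightarrow> F x - G x = zquad (p - p') (q - q') (r - r') x"
    by (simp add: zquad_def algebra_simps)
  thus ?thesis unfolding zpoly_def by blast
qed

lemma zpoly_add:
  assumes "zpoly F" "zpoly G" shows "zpoly (\<lambda>x. F x + G x)"
  using zpoly_diff[OF assms(1) zpoly_diff[OF zpoly_const[of 0] assms(2)]] by simp

lemma zpoly_mult:
  assumes "zpoly F" "zpoly G" shows "zpoly (\<lambda>x. F x * G x)"
proof -
  obtain p q r p' q' r' where
    *: "\<forall>x. minpoly_root x \<longrightarrow> F x = zquad p q r x" "\<forall>x. minpoly_root x \<longrightarrow> G x = zquad p' q' r' x"
    using assms unfolding zpoly_def by blast
  \<comment> \<open>The coefficients come from reducing the product by x^3 = 1 + 2x - x^2 and x^4 =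
    -1 - x + 3x^2.\<close>
  have "F x * G x = zquad (p*p' + (q*r' + r*q') - r*r')
      (p*q' + q*p' + 2*(q*r' + r*q') - r*r') (p*r' + q*q' + r*p' - (q*r' + r*q') + 3*r*r') x"
    if "minpoly_root x" for x
    using that unfolding minpoly_root_def *(1)[rule_format, OF that] *(2)[rule_format, OF that] zquad_def
      of_int_add of_int_diff of_int_mult of_int_numeral
    by algebra
  thus ?thesis unfolding zpoly_def by blast
qed

lemma zpoly_power: "zpoly F \<Longrightarrow> zpoly (\<lambda>x. F x ^ n)"
  using zpoly_const[of 1] by (induction n) (auto intro: zpoly_mult)

text \<open>The norm form of \<open>\<int>[\<eta>]\<close> is anisotropic modulo 2, since the minimal polynomial is irreducible
  there; hence an infinite descent.\<close>

lemma norm_form_eq_0: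
  fixes p q r :: int
  assumes "p^3 + q^3 + r^3 - p^2*q + 5*p^2*r - 2*p*q^2 + 6*p*r^2 - q^2*r - 2*q*r^2 - p*q*r = 0"
  shows "p = 0 \<and> q = 0 \<and> r = 0"
  using assms
proof (induction "nat (\<bar>p\<bar> + \<bar>q\<bar> + \<bar>r\<bar>)" arbitrary: p q r rule: less_induct)
  case less
  have "even (p^3 + q^3 + r^3 - p^2*q + 5*p^2*r - 2*p*q^2 + 6*p*r^2 - q^2*r - 2*q*r^2 - p*q*r)"
    using less.prems by simp
  hence "even p \<and> even q \<and> even r" by auto
  then obtain p' q' r' where e: "p = 2*p'" "q = 2*q'" "r = 2*r'" by (auto elim!: evenE)
  show ?case
  proof (rule ccontr)
    assume "\<not> ?thesis"
    hence "nat (\<bar>p'\<bar> + \<bar>q'\<bar> + \<bar>r'\<bar>) < nat (\<bar>p\<bar> + \<bar>q\<bar> + \<bar>r\<bar>)" using e by auto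
    moreover have "p'^3 + q'^3 + r'^3 - p'^2*q' + 5*p'^2*r' - 2*p'*q'^2 + 6*p'*r'^2
        - q'^2*r' - 2*q'*r'^2 - p'*q'*r' = 0"
      using less.prems unfolding e by (simp add: power2_eq_square power3_eq_cube)
    ultimately have "p' = 0 \<and> q' = 0 \<and> r' = 0" using less.hyps by blast
    with \<open>\<not> ?thesis\<close> e show False by simp
  qed
qed

text \<open>The other two roots of the minimal polynomial, 2cos(4\<pi>/7) and 2cos(6\<pi>/7),
  expressed through \<eta>.\<close>

definition eta' :: real where "eta' = \<eta>^2 - 2"
definition eta'' :: real where "eta'' = 1 - \<eta> - \<eta>^2"

lemma minpoly_roots: "minpoly_root \<eta>" "minpoly_root eta'" "minpoly_root eta''"
  using eta_minpoly unfolding minpoly_root_def eta'_def eta''_def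
  by (assumption, algebra, algebra)

lemma eta_conj_bounds: "eta' < -2/5" "eta'' < -2/5" "eta' - eta'' > 1" "\<eta> - eta' > 1" "\<eta> - eta'' > 1"
  using eta_sq_bounds eta_bounds unfolding eta'_def eta''_def by auto

text \<open>The product of the three conjugates is the norm form in the integer coefficients, which
  is anisotropic.\<close>

lemma zquad_eta_eq_0:
  assumes "zquad p q r \<eta> = 0" shows "p = 0 \<and> q = 0 \<and> r = 0"
proof -
  define P Q R where "P = real_of_int p" "Q = real_of_int q" "R = real_of_int r"
  have "P^3 + Q^3 + R^3 - P^2*Q + 5*P^2*R - 2*P*Q^2 + 6*P*R^2 - Q^2*R - 2*Q*R^2 - P*Q*R
      = (P + Q*\<eta> + R*\<eta>^2) * (P + Q*eta' + R*eta'^2) * (P + Q*eta'' + R*eta''^2)"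
    using eta_minpoly unfolding eta'_def eta''_def by algebra
  also have "\<dots> = 0" using assms by (simp add: zquad_def P_Q_R_def)
  finally have "real_of_int (p^3 + q^3 + r^3 - p^2*q + 5*p^2*r - 2*p*q^2 + 6*p*r^2 - q^2*r - 2*q*r^2 - p*q*r) = 0"
    by (simp add: P_Q_R_def)
  hence "p^3 + q^3 + r^3 - p^2*q + 5*p^2*r - 2*p*q^2 + 6*p*r^2 - q^2*r - 2*q*r^2 - p*q*r = 0"
    by (simp only: of_int_eq_0_iff)
  thus ?thesis by (rule norm_form_eq_0)
qed

text \<open>This replaces Galois conjugation: an identity over \<int>[\<eta>] passes from \<eta> to
  its conjugates, since only the zero triple of coefficients gives 0 at \<eta>.\<close>

lemma zpoly_conj_eq_0:
  assumes "zpoly F" "F \<eta> = 0" "minpoly_root x" shows "F x = 0"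
proof -
  obtain p q r where *: "\<forall>x. minpoly_root x \<longrightarrow> F x = zquad p q r x"
    using assms(1) unfolding zpoly_def by blast
  hence "p = 0 \<and> q = 0 \<and> r = 0" using zquad_eta_eq_0 assms(2) minpoly_roots(1) by auto
  thus ?thesis using * assms(3) by (simp add: zquad_def)
qed

text \<open>Divided differences at pairs of conjugates bound q + r(\<eta> + \<open>eta'\<close>) and
  q + r(\<eta> + \<open>eta''\<close>), and their difference bounds r, because the conjugates are
  more than 1 apart. Substituting back bounds q and p.\<close>

lemma finite_zquad_bounded:
  "finite {(p, q, r). \<bar>zquad p q r \<eta>\<bar> \<le> C \<and> \<bar>zquad p q r eta'\<bar> \<le> C \<and> \<bar>zquad p q r eta''\<bar> \<le> C}"
    (is "finite ?S")
proof -
  \<comment> \<open>The estimates below give 4C for r, 10C for q and 29C for p, so 50 leaves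
    room.\<close>
  define n where "n = \<lceil>50 * C\<rceil>"
  have "?S \<subseteq> {-n..n} \<times> {-n..n} \<times> {-n..n}"
  proof
    fix t assume "t \<in> ?S"
    then obtain p q r where t: "t = (p, q, r)" and b: "\<bar>zquad p q r \<eta>\<bar> \<le> C" "\<bar>zquad p q r eta'\<bar> \<le> C" "\<bar>zquad p q r eta''\<bar> \<le> C"
      by auto
    have d: "\<bar>y\<bar> \<le> c" if "\<bar>t * y\<bar> \<le> c" "t > 1" for t y c :: real
    proof -
      have "1 * \<bar>y\<bar> \<le> \<bar>t\<bar> * \<bar>y\<bar>" using that(2) by (intro mult_right_mono) auto
      thus ?thesis using that(1) by (simp add: abs_mult)
    qed
    have "\<bar>real_of_int q + r * (\<eta> + eta')\<bar> \<le> 2 * C"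
      by (rule d[OF _ eta_conj_bounds(4)]) (use b in \<open>auto simp: zquad_def algebra_simps power2_eq_square\<close>)
    moreover have q: "\<bar>real_of_int q + r * (\<eta> + eta'')\<bar> \<le> 2 * C"
      by (rule d[OF _ eta_conj_bounds(5)]) (use b in \<open>auto simp: zquad_def algebra_simps power2_eq_square\<close>)
    moreover have "(eta' - eta'') * real_of_int r
        = (real_of_int q + r * (\<eta> + eta')) - (real_of_int q + r * (\<eta> + eta''))"
      by (simp add: algebra_simps)
    ultimately have "\<bar>(eta' - eta'') * real_of_int r\<bar> \<le> 4 * C" by linarith
    hence r: "\<bar>real_of_int r\<bar> \<le> 4 * C" by (rule d) (rule eta_conj_bounds(3))
    have m: "\<bar>real_of_int y * t\<bar> \<le> c * 2" if "\<bar>real_of_int y\<bar> \<le> c" "\<bar>t\<bar> \<le> 2" for y t c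
      unfolding abs_mult using that by (intro mult_mono) auto
    have "\<bar>real_of_int r * (\<eta> + eta'')\<bar> \<le> 4 * C * 2"
      using r eta_sq_bounds eta_bounds by (intro m; simp add: eta''_def)
    hence q: "\<bar>real_of_int q\<bar> \<le> 10 * C" using q by simp
    have "\<bar>real_of_int q * \<eta>\<bar> \<le> 10 * C * 2" "\<bar>real_of_int r * \<eta>^2\<bar> \<le> 4 * C * 2"
      using q r eta_sq_bounds eta_bounds by (intro m; auto)+
    hence p: "\<bar>real_of_int p\<bar> \<le> 29 * C" using b(1) unfolding zquad_def by linarith
    have "C \<ge> 0" using b(1) by linarith
    have "50 * C \<le> of_int n" by (simp add: n_def)
    hence "\<bar>real_of_int p\<bar> \<le> of_int n" "\<bar>real_of_int q\<bar> \<le> of_int n" "\<bar>real_of_int r\<bar> \<le> of_int n"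
      using p q r \<open>C \<ge> 0\<close> by linarith+
    thus "t \<in> {-n..n} \<times> {-n..n} \<times> {-n..n}"
      unfolding t of_int_abs[symmetric] of_int_le_iff by auto
  qed
  thus ?thesis by (rule finite_subset) auto
qed

definition zeta :: "real set" where
  "zeta = {zquad p q r \<eta> | p q r. True}"

lemma zeta_iff: "x \<in> zeta \<longleftrightarrow> (\<exists>F. zpoly F \<and> x = F \<eta>)"
  unfolding zeta_def zpoly_def using minpoly_roots(1) by auto

lemma zeta_diff [intro]: "x \<in> zeta \<Longrightarrow> y \<in> zeta \<Longrightarrow> x - y \<in> zeta"
  unfolding zeta_iff using zpoly_diff by blast

lemma zeta_add [intro]: "x \<in> zeta \<Longrightarrow> y \<in> zeta \<Longrightarrow> x + y \<in> zeta"
  unfolding zeta_iff using zpoly_add by blast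

lemma zeta_mult [intro]: "x \<in> zeta \<Longrightarrow> y \<in> zeta \<Longrightarrow> x * y \<in> zeta"
  unfolding zeta_iff using zpoly_mult by blast

lemma zeta_numeral [intro]: "numeral n \<in> zeta"
  unfolding zeta_iff using zpoly_numeral by blast

lemma zeta_0 [intro]: "0 \<in> zeta" and zeta_1 [intro]: "1 \<in> zeta"
  unfolding zeta_iff using zpoly_const[of 0] zpoly_const[of 1] by auto

lemma zeta_uminus [intro]: "x \<in> zeta \<Longrightarrow> - x \<in> zeta"
  using zeta_diff[OF zeta_0] by fastforce

lemma zeta_power [intro]: "x \<in> zeta \<Longrightarrow> x ^ n \<in> zeta"
  by (induction n) auto

lemma zeta_eta [intro]: "\<eta> \<in> zeta"
  unfolding zeta_iff using zpoly_ident by blast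

text \<open>At the two other real places the form \<open>U\<^sup>2 - \<eta>V\<^sup>2 + \<eta>\<^sup>2W\<^sup>2\<close> is positive definite, because the
  conjugates of \<open>\<eta>\<close> are negative; so all conjugates of \<open>U\<close>, \<open>V\<close>, \<open>W\<close> are bounded.\<close>

lemma finite_bounded_solutions:
  "finite {(U, V, W). U \<in> zeta \<and> V \<in> zeta \<and> W \<in> zeta \<and> U^2 - \<eta> * V^2 + \<eta>^2 * W^2 = 16
     \<and> \<bar>U\<bar> \<le> C \<and> \<bar>V\<bar> \<le> C \<and> \<bar>W\<bar> \<le> C}" (is "finite ?S")
proof -
  \<comment> \<open>At a conjugate below -2/5 the equation bounds the three squares by 16, 40 and
    100, hence the 10. The values at \<eta> itself are bounded by C.\<close>
  define D where "D = max C 10"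
  define T where "T = {(p, q, r). \<bar>zquad p q r \<eta>\<bar> \<le> D \<and> \<bar>zquad p q r eta'\<bar> \<le> D \<and> \<bar>zquad p q r eta''\<bar> \<le> D}"
  define X where "X = (\<lambda>(p, q, r). zquad p q r \<eta>) ` T"
  have conj: "\<bar>F x\<bar> \<le> 10 \<and> \<bar>G x\<bar> \<le> 10 \<and> \<bar>H x\<bar> \<le> 10"
    if "zpoly F" "zpoly G" "zpoly H" "F \<eta>^2 - \<eta> * G \<eta>^2 + \<eta>^2 * H \<eta>^2 = 16"
       "minpoly_root x" "x < -2/5" for F G H x
  proof -
    have "zpoly (\<lambda>x. F x^2 - x * G x^2 + x^2 * H x^2 - 16)" by (intro zpoly_diff zpoly_add zpoly_mult zpoly_power zpoly_numeral zpoly_ident that)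
    from zpoly_conj_eq_0[OF this _ that(5)] that(4)
    have eq: "F x^2 + (-x) * G x^2 + x^2 * H x^2 = 16" by simp
    have "2/5 * G x^2 \<le> (-x) * G x^2" using that(6) by (intro mult_right_mono) auto
    moreover have "4/25 * H x^2 \<le> x^2 * H x^2"
    proof (intro mult_right_mono)
      have "(2/5)^2 \<le> (-x)^2" using that(6) by (intro power_mono) auto
      thus "4/25 \<le> x^2" by (simp add: power2_eq_square)
    qed auto
    moreover have "0 \<le> 2/5 * G x^2" "0 \<le> 4/25 * H x^2" "0 \<le> F x^2" by auto
    ultimately have "F x^2 \<le> 100" "G x^2 \<le> 100" "H x^2 \<le> 100" using eq by linarith+
    hence "F x^2 \<le> 10^2" "G x^2 \<le> 10^2" "H x^2 \<le> 10^2" by simp_all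
    thus ?thesis by (simp only: abs_le_square_iff[symmetric]) auto
  qed
  have "?S \<subseteq> X \<times> X \<times> X"
  proof
    fix t assume "t \<in> ?S"
    then obtain U V W where t: "t = (U, V, W)" and a: "U \<in> zeta" "V \<in> zeta" "W \<in> zeta"
      "U^2 - \<eta> * V^2 + \<eta>^2 * W^2 = 16" "\<bar>U\<bar> \<le> C" "\<bar>V\<bar> \<le> C" "\<bar>W\<bar> \<le> C"
      by auto
    obtain p q r where u: "U = zquad p q r \<eta>" using a(1) unfolding zeta_def by blast
    obtain p' q' r' where v: "V = zquad p' q' r' \<eta>" using a(2) unfolding zeta_def by blast
    obtain p'' q'' r'' where w: "W = zquad p'' q'' r'' \<eta>" using a(3) unfolding zeta_def by blast
    note c = conj[OF zpoly_zquad[of p q r] zpoly_zquad[of p' q' r'] zpoly_zquad[of p'' q'' r'']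
        a(4)[unfolded u v w]]
    have D: "y \<le> 10 \<Longrightarrow> y \<le> D" "y \<le> C \<Longrightarrow> y \<le> D" for y unfolding D_def by linarith+
    have "(p, q, r) \<in> T" "(p', q', r') \<in> T" "(p'', q'', r'') \<in> T"
      using c[OF minpoly_roots(2) eta_conj_bounds(1)] c[OF minpoly_roots(3) eta_conj_bounds(2)]
        a(5-7)[unfolded u v w]
      unfolding T_def by (simp_all add: D)
    hence "U \<in> X" "V \<in> X" "W \<in> X" unfolding X_def u v w by (auto intro: rev_image_eqI)
    thus "t \<in> X \<times> X \<times> X" unfolding t by simp
  qed
  moreover have "finite X" using finite_zquad_bounded[of D] unfolding X_def T_def by simp
  ultimately show ?thesis by (meson finite_SigmaI finite_subset)
qed

section \<open>The order and its quadratic forms\<close>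

lemma mat2_nth [simp]:
  "mat2 a b c d $ 1 $ 1 = a" "mat2 a b c d $ 1 $ 2 = b"
  "mat2 a b c d $ 2 $ 1 = c" "mat2 a b c d $ 2 $ 2 = d"
  by (simp_all add: mat2_def)

lemma mat2_eqI:
  "M $ 1 $ 1 = a \<Longrightarrow> M $ 1 $ 2 = b \<Longrightarrow> M $ 2 $ 1 = c \<Longrightarrow> M $ 2 $ 2 = d \<Longrightarrow> M = mat2 a b c d"
  by (simp add: vec_eq_iff forall_2)

lemma mat_eq_mat2: "mat x = mat2 x 0 0 x"
  by (rule mat2_eqI) (simp_all add: mat_def)

lemma mat2_mult:
  "mat2 a b c d ** mat2 a' b' c' d' = mat2 (a*a' + b*c') (a*b' + b*d') (c*a' + d*c') (c*b' + d*d')"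
  by (rule mat2_eqI) (simp_all add: matrix_matrix_mult_def sum_2)

lemma mat2_diff: "mat2 a b c d - mat2 a' b' c' d' = mat2 (a - a') (b - b') (c - c') (d - d')"
  by (rule mat2_eqI) simp_all

lemma mat2_add: "mat2 a b c d + mat2 a' b' c' d' = mat2 (a + a') (b + b') (c + c') (d + d')"
  by (rule mat2_eqI) simp_all

lemma mat2_scaleR: "x *\<^sub>R mat2 a b c d = mat2 (x*a) (x*b) (x*c) (x*d)"
  by (rule mat2_eqI) simp_all

lemma det_mat2: "det (mat2 a b c d) = a * d - b * c"
  by (simp add: det_2)

lemma mat2_eq_iff: "mat2 a b c d = mat2 a' b' c' d' \<longleftrightarrow> a = a' \<and> b = b' \<and> c = c' \<and> d = d'"
  by (metis mat2_nth)

text \<open>The image of a + bi + cj + dk in the matrix algebra, where k = ij has the off-diagonal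
  entries \<open>- \<eta> * \<sigma>\<close> and \<open>\<sigma>\<close>.\<close>

definition quat :: "real \<Rightarrow> real \<Rightarrow> real \<Rightarrow> real \<Rightarrow> real^2^2" where
  "quat a b c d = mat2 (a + c * \<sigma>) (\<eta> * (b - d * \<sigma>)) (b + d * \<sigma>) (a - c * \<sigma>)"

lemma quat_diff: "quat a b c d - quat a' b' c' d' = quat (a - a') (b - b') (c - c') (d - d')"
  by (simp add: quat_def mat2_diff mat2_eq_iff algebra_simps)

lemma quat_mult:
  "quat a b c d ** quat a' b' c' d' =
    quat (a*a' + \<eta>*b*b' + \<eta>*c*c' - \<eta>^2*d*d') (a*b' + b*a' - \<eta>*c*d' + \<eta>*d*c')
      (a*c' + c*a' + \<eta>*b*d' - \<eta>*d*b') (a*d' + d*a' + b*c' - c*b')"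
proof -
  define s where "s = \<sigma>"
  have e: "\<eta> = s * s" using sqrt_eta_sq by (simp add: s_def power2_eq_square)
  show ?thesis
    unfolding quat_def mat2_mult mat2_eq_iff s_def[symmetric] unfolding e by (intro conjI; algebra)
qed

lemma quat_cong: "a = a' \<Longrightarrow> b = b' \<Longrightarrow> c = c' \<Longrightarrow> d = d' \<Longrightarrow> quat a b c d = quat a' b' c' d'"
  by simp

definition mu :: real where "mu = \<eta>^2 + 1"

text \<open>The elements \<open>r + q u\<close> with \<open>r = e + f i\<close>, \<open>q = c + d i\<close> and \<open>u = (\<mu> + \<eta>\<mu> i + j)/2\<close>. Here
  \<open>\<mu>\<close> inverts \<open>1 + \<eta> + \<eta>\<^sup>2\<close> modulo 2, which makes \<open>1, i, u, iu\<close> a \<open>\<int>[\<eta>]\<close>-basis of the order.\<close>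

definition ord_elt :: "real \<Rightarrow> real \<Rightarrow> real \<Rightarrow> real \<Rightarrow> real^2^2" where
  "ord_elt e f c d = quat (e + (mu * c + \<eta>^2 * mu * d) / 2) (f + (\<eta> * mu * c + mu * d) / 2) (c / 2) (d / 2)"

definition ord_lattice :: "(real^2^2) set" where
  "ord_lattice = {ord_elt e f c d | e f c d. e \<in> zeta \<and> f \<in> zeta \<and> c \<in> zeta \<and> d \<in> zeta}"

lemma ord_latticeI:
  "e \<in> zeta \<Longrightarrow> f \<in> zeta \<Longrightarrow> c \<in> zeta \<Longrightarrow> d \<in> zeta \<Longrightarrow> M = ord_elt e f c d \<Longrightarrow> M \<in> ord_lattice"
  unfolding ord_lattice_def by blast

lemma ord_latticeE:
  assumes "M \<in> ord_lattice"
  obtains e f c d where "e \<in> zeta" "f \<in> zeta" "c \<in> zeta" "d \<in> zeta" "M = ord_elt e f c d"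
  using assms unfolding ord_lattice_def by blast

lemma zeta_mu [intro]: "mu \<in> zeta" unfolding mu_def by blast

lemma ord_lattice_diff:
  assumes "x \<in> ord_lattice" "y \<in> ord_lattice" shows "x - y \<in> ord_lattice"
proof -
  obtain e f c d where z: "e \<in> zeta" "f \<in> zeta" "c \<in> zeta" "d \<in> zeta"
    and x: "x = ord_elt e f c d"
    using assms(1) by (rule ord_latticeE)
  obtain e' f' c' d' where z': "e' \<in> zeta" "f' \<in> zeta" "c' \<in> zeta" "d' \<in> zeta"
    and y: "y = ord_elt e' f' c' d'"
    using assms(2) by (rule ord_latticeE)
  have "x - y = ord_elt (e - e') (f - f') (c - c') (d - d')"
    unfolding x y ord_elt_def quat_diff by (intro quat_cong; (simp; fail | algebra))
  thus ?thesis by (rule ord_latticeI[rotated 4]; intro zeta_diff z z')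
qed

text \<open>The coefficients are those of \<open>(r + q u)(r' + q' u)\<close> with \<open>u i = - i u + \<mu> (i + \<eta>\<^sup>2)\<close> and \<open>u\<^sup>2 = \<mu> u - \<nu>\<close>,
  where \<open>\<nu> = 7 \<eta>\<^sup>2 - 7 \<eta> - 4\<close> is the norm of \<open>u\<close>.\<close>

lemma ord_elt_mult:
  "ord_elt e f c d ** ord_elt e' f' c' d' =
    ord_elt
      (e*e' + \<eta>*f*f' + f'*mu*(\<eta>^2*c + \<eta>*d) - (7*\<eta>^2 - 7*\<eta> - 4)*(c*c' - \<eta>*d*d'))
      (e*f' + f*e' + f'*mu*(c + \<eta>^2*d) - (7*\<eta>^2 - 7*\<eta> - 4)*(d*c' - c*d'))
      (e*c' + \<eta>*f*d' + c*e' - \<eta>*d*f' + mu*(c*c' - \<eta>*d*d') + mu*d'*(\<eta>^2*c + \<eta>*d))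
      (e*d' + f*c' + d*e' - c*f' + mu*(d*c' - c*d') + mu*d'*(c + \<eta>^2*d))"
proof -
  \<comment> \<open>The norm of u has the denominator 4 on its face; rewriting it as an element of
    \<int>[\<eta>] makes the coefficients of the product integral.\<close>
  have nu: "7*\<eta>^2 - 7*\<eta> - 4 = (mu^2 * (1 - \<eta>^3) - \<eta>) / 4"
    using eta_minpoly unfolding mu_def by algebra
  \<comment> \<open>Doubling c and d clears the halves, so that the product can be compared
    coefficient by coefficient.\<close>
  have double: "ord_elt e f (2*c) (2*d) = quat (e + (mu*c + \<eta>^2*mu*d)) (f + (\<eta>*mu*c + mu*d)) c d"
    for e f c d unfolding ord_elt_def by (intro quat_cong) (simp_all add: field_simps)
  have *: "ord_elt e f (2*c) (2*d) ** ord_elt e' f' (2*c') (2*d') = ord_elt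
      (e*e' + \<eta>*f*f' + 2*f'*mu*(\<eta>^2*c + \<eta>*d) - (mu^2*(1-\<eta>^3)-\<eta>)*(c*c' - \<eta>*d*d'))
      (e*f' + f*e' + 2*f'*mu*(c + \<eta>^2*d) - (mu^2*(1-\<eta>^3)-\<eta>)*(d*c' - c*d'))
      (2*(e*c' + \<eta>*f*d' + c*e' - \<eta>*d*f' + 2*mu*(c*c' - \<eta>*d*d') + 2*mu*d'*(\<eta>^2*c + \<eta>*d)))
      (2*(e*d' + f*c' + d*e' - c*f' + 2*mu*(d*c' - c*d') + 2*mu*d'*(c + \<eta>^2*d)))"
    for c d c' d'
    unfolding double quat_mult
    by (intro quat_cong; simp add: algebra_simps power2_eq_square power3_eq_cube)
  have cong: "M = ord_elt e f c d \<Longrightarrow> e = e' \<Longrightarrow> f = f' \<Longrightarrow> c = c' \<Longrightarrow> d = d' \<Longrightarrow> M = ord_elt e' f' c' d'"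
    for M e f c d e' f' c' d' by simp
  show ?thesis unfolding nu
    by (rule cong, rule *[of "c/2" "d/2" "c'/2" "d'/2", simplified]) (simp_all add: field_simps)
qed

lemma ord_lattice_mult:
  assumes "x \<in> ord_lattice" "y \<in> ord_lattice" shows "x ** y \<in> ord_lattice"
proof -
  obtain e f c d where z: "e \<in> zeta" "f \<in> zeta" "c \<in> zeta" "d \<in> zeta"
    and x: "x = ord_elt e f c d"
    using assms(1) by (rule ord_latticeE)
  obtain e' f' c' d' where z': "e' \<in> zeta" "f' \<in> zeta" "c' \<in> zeta" "d' \<in> zeta"
    and y: "y = ord_elt e' f' c' d'"
    using assms(2) by (rule ord_latticeE)
  show ?thesis unfolding x y
    by (rule ord_latticeI[OF _ _ _ _ ord_elt_mult];
        intro zeta_add zeta_diff zeta_mult zeta_power zeta_numeral zeta_eta zeta_mu z z')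
qed

lemma quat_units:
  "mat 1 = ord_elt 1 0 0 0" "mat \<eta> = ord_elt \<eta> 0 0 0" "quat_i = ord_elt 0 1 0 0"
  "quat_j = ord_elt (- mu) (- \<eta> * mu) 2 0"
  unfolding ord_elt_def mat_eq_mat2 quat_def quat_i_def quat_j_def mat2_eq_iff
  by (simp_all add: field_simps)

text \<open>The coordinates are integral because \<open>mu * (1 + \<eta> + \<eta>^2)\<close> equals
  1 + 2\<eta> + 4\<eta>^2, which is 1 modulo 2.\<close>

lemma order_half:
  "(1/2) *\<^sub>R (mat 1 + \<eta> *\<^sub>R quat_i + (1 + \<eta> + \<eta>^2) *\<^sub>R quat_j) =
    ord_elt (- 2 * \<eta>^2 - \<eta>) (- 2 * \<eta>^3 - \<eta>^2) (1 + \<eta> + \<eta>^2) 0"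
  unfolding ord_elt_def mat_eq_mat2 quat_def quat_i_def quat_j_def mat2_eq_iff mat2_scaleR mat2_add mu_def
  by (intro conjI; (simp; fail | (insert eta_minpoly sqrt_eta_sq, algebra)))

lemma hurwitz_order_subset: "x \<in> hurwitz_order \<Longrightarrow> x \<in> ord_lattice"
proof (induction rule: hurwitz_order.induct)
  case half
  show ?case unfolding order_half
    by (rule ord_latticeI[OF _ _ _ _ refl]) blast+
next
  case one show ?case unfolding quat_units by (rule ord_latticeI[OF _ _ _ _ refl]) blast+
next
  case eta show ?case unfolding quat_units by (rule ord_latticeI[OF _ _ _ _ refl]) blast+
next
  case i show ?case unfolding quat_units by (rule ord_latticeI[OF _ _ _ _ refl]) blast+
next
  case j show ?case unfolding quat_units by (rule ord_latticeI[OF _ _ _ _ refl]) blast+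
qed (blast intro: ord_lattice_diff ord_lattice_mult)+

section \<open>The generators \<open>g2\<close> and \<open>g7\<close> as elements of the
  lattice\<close>

lemma eta_inverse: "1 / \<eta> = \<eta>^2 + \<eta> - 2"
proof -
  have "\<eta> * (\<eta>^2 + \<eta> - 2) = 1" using eta_minpoly by algebra
  thus ?thesis using eta_gt_1 by (simp add: field_simps)
qed

lemma g2_quat: "g2 = quat 0 0 0 (\<eta>^2 + \<eta> - 2)"
proof -
  have "\<sigma> * (\<sigma> * (\<eta>^2 + \<eta> - 2)) = 1" using eta_minpoly sqrt_eta_sq by algebra
  hence "1 / \<sigma> = \<sigma> * (\<eta>^2 + \<eta> - 2)" using sqrt_eta_pos by (simp add: field_simps)
  thus ?thesis unfolding g2_def quat_def mat2_eq_iff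
    by (intro conjI; (simp; fail | (insert eta_minpoly sqrt_eta_sq, algebra)))
qed

lemma g7_quat: "g7 = quat ((\<eta>^2 + \<eta> - 1) / 2) ((2 - \<eta>^2) / 2) 0 ((\<eta>^2 + \<eta> - 2) / 2)"
  unfolding g7_def mat2_scaleR quat_def mat2_eq_iff
  by (intro conjI; (simp; fail | (insert eta_minpoly sqrt_eta_sq, algebra)))

lemma g2_in_lattice: "g2 \<in> ord_lattice"
proof (rule ord_latticeI)
  show "g2 = ord_elt (- (\<eta>^2 * mu * (\<eta>^2 + \<eta> - 2))) (- mu * (\<eta>^2 + \<eta> - 2)) 0 (2 * (\<eta>^2 + \<eta> - 2))"
    unfolding g2_quat ord_elt_def by (intro quat_cong; (simp; fail | algebra))
qed blast+

lemma g7_in_lattice: "g7 \<in> ord_lattice"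
proof (rule ord_latticeI)
  show "g7 = ord_elt (\<eta>^2 - \<eta> - 1) (2 - \<eta> - \<eta>^2) 0 (\<eta>^2 + \<eta> - 2)"
    unfolding g7_quat ord_elt_def mu_def
    by (intro quat_cong; (simp; fail | (insert eta_minpoly, algebra)))
qed blast+

lemma mat_pow_in_lattice: "mat_pow g7 n \<in> ord_lattice"
  by (induction n) (auto intro: ord_lattice_mult g7_in_lattice hurwitz_order_subset hurwitz_order.one)

section \<open>Binary quadratic forms on the real plane and their transport\<close>

definition vec2 :: "real \<Rightarrow> real \<Rightarrow> real^2" where "vec2 x y = vector [x, y]"

lemma vec2_nth [simp]: "vec2 x y $ 1 = x" "vec2 x y $ 2 = y"
  by (simp_all add: vec2_def)

lemma vec2_cases: obtains x y where "v = vec2 x y"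
  by (rule that[of "v $ 1" "v $ 2"]) (simp add: vec_eq_iff forall_2)

lemma vec2_eq_iff: "vec2 x y = vec2 x' y' \<longleftrightarrow> x = x' \<and> y = y'"
  by (metis vec2_nth)

lemma vec2_scaleR: "c *\<^sub>R vec2 x y = vec2 (c * x) (c * y)"
  by (simp add: vec_eq_iff forall_2)

lemma mat2_vec2: "mat2 a b c d *v vec2 x y = vec2 (a * x + b * y) (c * x + d * y)"
  by (simp add: vec_eq_iff forall_2 matrix_vector_mult_def sum_2)

lemma mat2_cases: obtains a b c d where "M = mat2 a b c d"
  by (rule that[OF mat2_eqI[OF refl refl refl refl]])

definition qform :: "real \<Rightarrow> real \<Rightarrow> real \<Rightarrow> real^2 \<Rightarrow> real" where
  "qform A B D v = A * (v$1)^2 + 2 * B * (v$1) * (v$2) + D * (v$2)^2"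

lemma qform_eq_iff: "qform A B D = qform A' B' D' \<longleftrightarrow> A = A' \<and> B = B' \<and> D = D'"
proof
  assume "qform A B D = qform A' B' D'"
  hence "qform A B D (vec2 x y) = qform A' B' D' (vec2 x y)" for x y by simp
  from this[of 1 0] this[of 0 1] this[of 1 1] show "A = A' \<and> B = B' \<and> D = D'"
    by (simp add: qform_def)
qed auto

definition is_qform :: "(real^2 \<Rightarrow> real) \<Rightarrow> bool" where
  "is_qform f \<longleftrightarrow> (\<exists>A B D. f = qform A B D)"

lemma is_qform_qform [intro, simp]: "is_qform (qform A B D)"
  unfolding is_qform_def by blast

lemma is_qform_scaleR: "is_qform f \<Longrightarrow> f (c *\<^sub>R v) = c^2 * f v"
  unfolding is_qform_def qform_def by (auto simp: algebra_simps power2_eq_square)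

lemma qform_comp: "qform A B D (mat2 a b c d *v v) =
    qform (A*a^2 + 2*B*a*c + D*c^2) (A*a*b + B*(a*d + b*c) + D*c*d) (A*b^2 + 2*B*b*d + D*d^2) v"
  by (rule vec2_cases[of v]) (simp add: mat2_vec2 qform_def algebra_simps power2_eq_square)

lemma is_qform_comp: "is_qform f \<Longrightarrow> is_qform (\<lambda>v. f (M *v v))"
proof -
  obtain a b c d where M: "M = mat2 a b c d" by (rule mat2_cases)
  assume "is_qform f"
  then obtain A B D where "f = qform A B D" unfolding is_qform_def by blast
  hence "(\<lambda>v. f (M *v v)) = qform (A*a^2 + 2*B*a*c + D*c^2) (A*a*b + B*(a*d + b*c) + D*c*d)
      (A*b^2 + 2*B*b*d + D*d^2)"
    unfolding M by (intro ext) (simp only: qform_comp)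
  thus ?thesis unfolding is_qform_def by blast
qed

text \<open>The form \<open>f\<close> as a Hermitian form at \<open>(z, 1)\<close>, which determines the side of \<open>z\<close> with respect to
  the geodesic belonging to \<open>f\<close>.\<close>

fun ev :: "(real^2 \<Rightarrow> real) \<Rightarrow> complex option \<Rightarrow> real" where
  "ev f (Some z) = f (vec2 (Re z) 1) + f (vec2 (Im z) 0)"
| "ev f None = f (vec2 1 0)"

lemma ev_qform: "ev (qform A B D) (Some z) = A * (cmod z)^2 + 2 * B * Re z + D"
  by (simp add: qform_def cmod_power2 algebra_simps)

fun rep :: "real option \<Rightarrow> real^2" where
  "rep (Some x) = vec2 x 1"
| "rep None = vec2 1 0"

definition rep_of :: "real^2 \<Rightarrow> real option \<Rightarrow> bool" where
  "rep_of v \<xi> \<longleftrightarrow> (\<exists>c. c \<noteq> 0 \<and> v = c *\<^sub>R rep \<xi>)"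

lemma rep_of_rep: "rep_of (rep \<xi>) \<xi>"
  unfolding rep_of_def by (rule exI[of _ 1]) simp

text \<open>The factor \<kappa> is |cz + d|^2, or its analogue when infinity is involved. It is
  positive and common to all forms, so signs and ratios of form values are transported
  together.\<close>

lemma ev_lft:
  assumes "det M \<noteq> 0"
  shows "\<exists>\<kappa>>0. \<forall>f. is_qform f \<longrightarrow> ev (\<lambda>v. f (M *v v)) z = \<kappa> * ev f (lft M z)"
proof -
  obtain a b c d where M: "M = mat2 a b c d" by (rule mat2_cases)
  have det: "a * d - b * c \<noteq> 0" using assms by (simp add: M det_mat2)
  show ?thesis
  proof (cases z)
    case None
    show ?thesis
    proof (cases "c = 0")
      case True
      show ?thesis using True det
        by (intro exI[of _ "a^2"]) (auto simp: None M mat2_vec2 is_qform_def qform_def)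
    next
      case False
      thus ?thesis
        by (intro exI[of _ "c^2"] conjI)
          (simp, auto simp: None M mat2_vec2 is_qform_def qform_def field_simps power2_eq_square)
    qed
  next
    case (Some w)
    define n m where "n = of_real a * w + of_real b" and "m = of_real c * w + of_real d"
    have e: "ev (\<lambda>v. qform A B D (M *v v)) z = A * (cmod n)^2 + 2 * B * Re (n * cnj m) + D * (cmod m)^2"
      for A B D
    proof -
      have "(cmod n)^2 = (a * Re w + b)^2 + (a * Im w)^2" "(cmod m)^2 = (c * Re w + d)^2 + (c * Im w)^2"
        "Re (n * cnj m) = (a * Re w + b) * (c * Re w + d) + a * Im w * (c * Im w)"
        by (simp_all add: cmod_power2 n_def m_def)
      thus ?thesis by (simp add: Some M mat2_vec2 qform_def algebra_simps)
    qed
    show ?thesis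
    proof (cases "m = 0")
      case True
      have "n \<noteq> 0"
      proof
        assume "n = 0"
        hence "of_real (a * d - b * c) = (0::complex)"
          using True unfolding n_def m_def of_real_diff of_real_mult by algebra
        thus False using det by (simp only: of_real_eq_0_iff)
      qed
      moreover have "lft M z = None" using True by (simp add: Some M m_def)
      ultimately show ?thesis using True
        by (intro exI[of _ "(cmod n)^2"]) (auto simp: is_qform_def e, simp add: qform_def)
    next
      case False
      have l: "lft M z = Some (n / m)" using False by (simp add: Some M m_def n_def moebius_def)
      have "n / m = n * cnj m / of_real ((cmod m)^2)"
        using False complex_norm_square[of m] by (simp add: field_simps)
      hence "Re (n / m) = Re (n * cnj m) / (cmod m)^2"
        by (metis Re_divide_of_real)
      thus ?thesis using False unfolding l
        by (intro exI[of _ "(cmod m)^2"])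
          (auto simp: is_qform_def e ev_qform norm_divide field_simps simp del: ev.simps)
    qed
  qed
qed

lemma rep_of_lft:
  assumes "det M \<noteq> 0" "rep_of v \<xi>"
  shows "rep_of (M *v v) (lft M \<xi>)"
proof -
  obtain a b c d where M: "M = mat2 a b c d" by (rule mat2_cases)
  have det: "a * d - b * c \<noteq> 0" using assms by (simp add: M det_mat2)
  obtain k where k: "k \<noteq> 0" "v = k *\<^sub>R rep \<xi>" using assms(2) unfolding rep_of_def by blast
  have "rep_of (M *v rep \<xi>) (lft M \<xi>)"
  proof (cases \<xi>)
    case None
    thus ?thesis using det unfolding rep_of_def
      by (intro exI[of _ "if c = 0 then a else c"])
         (auto simp: M mat2_vec2 vec2_scaleR vec2_eq_iff)
  next
    case (Some x)
    have "a * x + b \<noteq> 0" if "c * x + d = 0" using det that by algebra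
    thus ?thesis using det Some unfolding rep_of_def
      by (intro exI[of _ "if c * x + d = 0 then a * x + b else c * x + d"])
         (auto simp: M mat2_vec2 vec2_scaleR vec2_eq_iff moebius_def)
  qed
  then obtain c where "c \<noteq> 0" "M *v rep \<xi> = c *\<^sub>R rep (lft M \<xi>)" unfolding rep_of_def by blast
  thus ?thesis unfolding rep_of_def using k
    by (intro exI[of _ "k * c"]) (simp add: matrix_vector_mult_scaleR)
qed

text \<open>In the coordinates \<open>(|z|\<^sup>2, Re z)\<close> a geodesic is a chord, and forms are affine functions.\<close>

lemma ev_geodesic_rep:
  assumes "\<beta> \<noteq> \<alpha>"
  shows "\<exists>w>0. \<forall>f. is_qform f \<longrightarrow>
     ev f (geodesic \<beta> \<alpha> t) = w * (f (rep \<beta>) + exp (2 * t) * f (rep \<alpha>))"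
proof -
  have exp2: "exp (2 * t) = exp t * exp t" by (simp add: mult_exp_exp)
  show ?thesis
  proof (cases \<beta>; cases \<alpha>)
    fix b a assume ba: "\<beta> = Some b" "\<alpha> = Some a"
    define r where "r = exp t"
    have r: "r > 0" "exp (-t) = 1 / r" by (auto simp: r_def exp_minus field_simps)
    have c: "cosh t = (1 + r^2) / (2 * r)"
      and th: "tanh t = (r^2 - 1) / (1 + r^2)"
    proof -
      show "cosh t = (1 + r^2) / (2 * r)"
        using r unfolding cosh_def by (auto simp: r_def[symmetric] field_simps power2_eq_square)
      have "tanh t = (r - 1 / r) / (r + 1 / r)"
        using r(2) unfolding tanh_altdef by (simp add: r_def[symmetric])
      also have "\<dots> = (r^2 - 1) / (1 + r^2)"
        using r(1) by (simp add: divide_simps) (simp add: field_simps power2_eq_square)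
      finally show "tanh t = (r^2 - 1) / (1 + r^2)" .
    qed
    have pos: "1 + r^2 > 0" by (smt (verit) zero_le_power2)
    \<comment> \<open>In the coordinates (|z|^2, Re z) the point is the mean of (b^2, b) and (a^2,
      a) with weights 1 and r^2.\<close>
    define x y where "x = (b + a) / 2 + (a - b) / 2 * tanh t" and "y = \<bar>a - b\<bar> / 2 / cosh t"
    have x: "x = (b + r^2 * a) / (1 + r^2)"
      unfolding x_def th using pos by (simp add: field_simps)
    have y: "y^2 = (a - b)^2 * r^2 / (1 + r^2)^2"
      unfolding y_def c using pos r by (simp add: power_divide power_mult_distrib field_simps)
    have "x^2 + y^2 = ((b + r^2 * a)^2 + (a - b)^2 * r^2) / (1 + r^2)^2"
      unfolding x y power_divide by (simp add: add_divide_distrib)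
    also have "(b + r^2 * a)^2 + (a - b)^2 * r^2 = (b^2 + r^2 * a^2) * (1 + r^2)" by algebra
    finally have n: "x^2 + y^2 = (b^2 + r^2 * a^2) / (1 + r^2)"
      using pos by (simp add: power2_eq_square)
    have g: "geodesic \<beta> \<alpha> t = Some (Complex x y)" by (simp add: ba x_def y_def)
    have "ev (qform A B D) (geodesic \<beta> \<alpha> t) = 1 / (1 + r^2) *
        (qform A B D (rep \<beta>) + exp (2 * t) * qform A B D (rep \<alpha>))" for A B D
    proof -
      have "ev (qform A B D) (geodesic \<beta> \<alpha> t) = A * (x^2 + y^2) + 2 * B * x + D"
        unfolding g ev_qform by (simp add: cmod_power2)
      also have "\<dots> = 1 / (1 + r^2) * (A * ((1 + r^2) * (x^2 + y^2)) + 2 * B * ((1 + r^2) * x) + D * (1 + r^2))"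
        using pos by (simp add: field_simps)
      also have "(1 + r^2) * (x^2 + y^2) = b^2 + r^2 * a^2" using n pos by simp
      also have "(1 + r^2) * x = b + r^2 * a" using x pos by simp
      also have "A * (b^2 + r^2 * a^2) + 2 * B * (b + r^2 * a) + D * (1 + r^2)
          = qform A B D (rep \<beta>) + exp (2 * t) * qform A B D (rep \<alpha>)"
        unfolding exp2 r_def[symmetric] by (simp add: qform_def ba algebra_simps power2_eq_square)
      finally show ?thesis .
    qed
    thus ?thesis using pos by (intro exI[of _ "1 / (1 + r^2)"]) (auto simp: is_qform_def)
  next
    fix b assume "\<beta> = Some b" "\<alpha> = None"
    thus ?thesis
      by (intro exI[of _ 1]) (auto simp: is_qform_def qform_def exp2 power2_eq_square)
  next
    fix a assume ba: "\<beta> = None" "\<alpha> = Some a"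
    have "exp (-t) * exp (-t) * exp (2 * t) = 1" by (simp add: mult_exp_exp)
    hence *: "exp (-t) * exp (-t) * (x + exp (2 * t) * y) = exp (-t) * exp (-t) * x + y" for x y
      by algebra
    show ?thesis unfolding ba *
      by (intro exI[of _ "exp (-t) * exp (-t)"])
        (auto simp: * is_qform_def qform_def power2_eq_square)
  qed (use assms in auto)
qed

text \<open>Other lifts of the end points only rescale the parameter exp(2t), by the constant
  quotient of the squared scaling factors.\<close>

lemma ev_geodesic:
  assumes "\<beta> \<noteq> \<alpha>" "rep_of b \<beta>" "rep_of a \<alpha>"
  shows "\<exists>C>0. \<forall>t. \<exists>w>0. \<forall>f. is_qform f \<longrightarrow>
     ev f (geodesic \<beta> \<alpha> t) = w * (f b + C * exp (2 * t) * f a)"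
proof -
  obtain k l where k: "k \<noteq> 0" "b = k *\<^sub>R rep \<beta>" and l: "l \<noteq> 0" "a = l *\<^sub>R rep \<alpha>"
    using assms unfolding rep_of_def by blast
  show ?thesis
  proof (rule exI[of _ "k^2 / l^2"], rule conjI, rule_tac [2] allI)
    show "k^2 / l^2 > 0" using k l by simp
    fix t
    obtain w where w: "w > 0" "\<And>f. is_qform f \<Longrightarrow>
      ev f (geodesic \<beta> \<alpha> t) = w * (f (rep \<beta>) + exp (2 * t) * f (rep \<alpha>))"
      using ev_geodesic_rep[OF assms(1)] by blast
    show "\<exists>w>0. \<forall>f. is_qform f \<longrightarrow>
      ev f (geodesic \<beta> \<alpha> t) = w * (f b + k^2 / l^2 * exp (2 * t) * f a)"
      using k l w by (intro exI[of _ "w / k^2"]) (auto simp: is_qform_scaleR field_simps)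
  qed
qed

section \<open>Geodesics in the orbit of the edge line\<close>

lemma det_quat: "det (quat a b c d) = a^2 - \<eta> * b^2 - \<eta> * c^2 + \<eta>^2 * d^2"
proof -
  have "det (quat a b c d) = a^2 - \<eta> * b^2 - \<sigma>^2 * c^2 + \<eta> * \<sigma>^2 * d^2"
    unfolding quat_def det_mat2 by algebra
  thus ?thesis unfolding sqrt_eta_sq by (simp add: power2_eq_square)
qed

section \<open>Inverses of matrices of determinant 1\<close>

lemma matrix_inv_eqI:
  fixes M N :: "real^'n^'n"
  assumes "M ** N = mat 1" shows "matrix_inv M = N"
proof -
  have N: "N ** M = mat 1" using assms matrix_left_right_inverse by blast
  have "M ** matrix_inv M = mat 1"
    unfolding matrix_inv_def by (rule someI2[of _ N]) (use assms N in auto)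
  thus ?thesis by (metis N matrix_mul_assoc matrix_mul_lid matrix_mul_rid)
qed

lemma matrix_inv_mat2: "a * d - b * c = 1 \<Longrightarrow> matrix_inv (mat2 a b c d) = mat2 d (-b) (-c) a"
  by (intro matrix_inv_eqI) (simp add: mat2_mult mat_eq_mat2 mat2_eq_iff algebra_simps)

lemma det_matrix_inv:
  fixes M :: "real^2^2"
  assumes "det M = 1" shows "det (matrix_inv M) = 1"
proof -
  obtain a b c d where M: "M = mat2 a b c d" by (rule mat2_cases)
  show ?thesis using assms by (simp add: M det_mat2 matrix_inv_mat2 algebra_simps)
qed

lemma matrix_inv_cancel:
  fixes M :: "real^2^2"
  assumes "det M = 1" shows "M *v (matrix_inv M *v v) = v" "matrix_inv M *v (M *v v) = v"
proof -
  obtain a b c d where M: "M = mat2 a b c d" by (rule mat2_cases)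
  have "M ** matrix_inv M = mat 1" "matrix_inv M ** M = mat 1"
    using assms unfolding M det_mat2
    by (simp_all add: matrix_inv_mat2 mat2_mult mat_eq_mat2 mat2_eq_iff algebra_simps)
  thus "M *v (matrix_inv M *v v) = v" "matrix_inv M *v (M *v v) = v"
    by (simp_all add: matrix_vector_mul_assoc)
qed

lemma matrix_inv_mult:
  fixes M N :: "real^2^2"
  assumes "det M = 1" "det N = 1" shows "matrix_inv (M ** N) *v v = matrix_inv N *v (matrix_inv M *v v)"
proof -
  have "det (M ** N) = 1" using assms by (simp add: det_mul)
  have "(M ** N) *v (matrix_inv N *v (matrix_inv M *v v)) = v"
    using assms by (simp add: matrix_inv_cancel flip: matrix_vector_mul_assoc)
  thus ?thesis using matrix_inv_cancel(2)[OF \<open>det (M ** N) = 1\<close>] by metis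
qed

text \<open>The line carrying the edge \<open>e\<^sub>0\<close>; the form is nonpositive exactly on \<open>S\<^sub>0\<close>.\<close>

definition edge_form :: "real^2 \<Rightarrow> real" where
  "edge_form = qform 1 0 (- \<eta>)"

lemma is_qform_edge_form [simp, intro]: "is_qform edge_form"
  by (simp add: edge_form_def)

text \<open>The edge form belongs to i, which fixes plus and minus \<sigma>. Conjugating i by a + bi
  + cj + dk gives Ui - \<eta>Wj - Vk, from which the coefficients are read off; the second identity
  says that conjugation preserves the norm.\<close>

lemma edge_form_quat:
  assumes "det (quat a b c d) = 1"
  defines "U \<equiv> a^2 + \<eta> * c^2 - \<eta> * b^2 - \<eta>^2 * d^2" and "V \<equiv> 2 * (a * c + \<eta> * b * d)"
    and "W \<equiv> 2 * (a * d + b * c)"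
  shows "edge_form (matrix_inv (quat a b c d) *v v)
      = qform (U - \<sigma> * V) (\<eta> * \<sigma> * W) (- \<eta> * (U + \<sigma> * V)) v"
    and "U^2 - \<eta> * V^2 + \<eta>^2 * W^2 = 1"
proof -
  show "U^2 - \<eta> * V^2 + \<eta>^2 * W^2 = 1"
  proof -
    have "U^2 - \<eta> * V^2 + \<eta>^2 * W^2 = (a^2 - \<eta> * b^2 - \<eta> * c^2 + \<eta>^2 * d^2)^2"
      unfolding U_def V_def W_def by algebra
    thus ?thesis using assms(1) by (simp add: det_quat)
  qed
  obtain x y where v: "v = vec2 x y" by (rule vec2_cases)
  define s where "s = \<sigma>"
  have e: "\<eta> = s * s" using sqrt_eta_sq by (simp add: s_def power2_eq_square)
  have "edge_form (matrix_inv (quat a b c d) *v v) =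
      ((a - c * s) * x - \<eta> * (b - d * s) * y)^2 - \<eta> * ((- b - d * s) * x + (a + c * s) * y)^2"
    using assms(1) unfolding quat_def det_mat2 matrix_inv_mat2[OF assms(1)[unfolded quat_def det_mat2]]
    by (simp add: v mat2_vec2 edge_form_def qform_def s_def)
  also have "\<dots> = qform (U - s * V) (\<eta> * s * W) (- \<eta> * (U + s * V)) v"
    unfolding U_def V_def W_def v qform_def vec2_nth unfolding e by algebra
  finally show "edge_form (matrix_inv (quat a b c d) *v v)
      = qform (U - \<sigma> * V) (\<eta> * \<sigma> * W) (- \<eta> * (U + \<sigma> * V)) v"
    by (simp add: s_def)
qed

text \<open>Bounds on the coefficients bound U, V, W at the place of \<eta>; the norm equation does
  so at the other places. Lattice elements have half-integral coordinates over \<int>[\<eta>], so U,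
  V, W are scaled by 4 and the equation gets the right side 16.\<close>

lemma finite_bounded_edge_forms:
  "finite {f. (\<exists>A B D. f = qform A B D \<and> \<bar>A\<bar> \<le> C \<and> \<bar>B\<bar> \<le> C \<and> \<bar>D\<bar> \<le> C) \<and>
     (\<exists>M\<in>ord_lattice. det M = 1 \<and> f = (\<lambda>v. edge_form (matrix_inv M *v v)))}" (is "finite ?S")
proof -
  define T where "T = {(U, V, W). U \<in> zeta \<and> V \<in> zeta \<and> W \<in> zeta
     \<and> U^2 - \<eta> * V^2 + \<eta>^2 * W^2 = 16 \<and> \<bar>U\<bar> \<le> 4*C \<and> \<bar>V\<bar> \<le> 4*C \<and> \<bar>W\<bar> \<le> 4*C}"
  define F where "F = (\<lambda>(U, V, W). qform ((U - \<sigma> * V) / 4) (\<eta> * \<sigma> * W / 4) (- \<eta> * (U + \<sigma> * V) / 4))"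
  have "?S \<subseteq> F ` T"
  proof
    fix f assume "f \<in> ?S"
    then obtain A B D M where f: "f = qform A B D" and bd: "\<bar>A\<bar> \<le> C" "\<bar>B\<bar> \<le> C" "\<bar>D\<bar> \<le> C"
      and M: "M \<in> ord_lattice" "det M = 1" "f = (\<lambda>v. edge_form (matrix_inv M *v v))"
      by auto
    from M(1) obtain e f' c d where z: "e \<in> zeta" "f' \<in> zeta" "c \<in> zeta" "d \<in> zeta" "M = ord_elt e f' c d"
      by (rule ord_latticeE)
    define a b where "a = 2 * e + (mu * c + \<eta>^2 * mu * d)" and "b = 2 * f' + (\<eta> * mu * c + mu * d)"
    have ab: "a \<in> zeta" "b \<in> zeta" unfolding a_def b_def using z(1-4) by blast+
    have Mq: "M = quat (a/2) (b/2) (c/2) (d/2)"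
      unfolding z(5) ord_elt_def a_def b_def by (simp add: add_divide_distrib)
    define U V W where "U = a^2 + \<eta> * c^2 - \<eta> * b^2 - \<eta>^2 * d^2"
      and "V = 2 * (a * c + \<eta> * b * d)" and "W = 2 * (a * d + b * c)"
    have UVW: "U \<in> zeta" "V \<in> zeta" "W \<in> zeta" unfolding U_def V_def W_def
      by (intro zeta_add zeta_diff zeta_mult zeta_power zeta_numeral zeta_eta ab z(3,4))+
    have e4: "(a/2)^2 + \<eta> * (c/2)^2 - \<eta> * (b/2)^2 - \<eta>^2 * (d/2)^2 = U / 4"
        "2 * (a/2 * (c/2) + \<eta> * (b/2) * (d/2)) = V / 4" "2 * (a/2 * (d/2) + b/2 * (c/2)) = W / 4"
      unfolding U_def V_def W_def by (simp_all add: power_divide field_simps)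
    note q = edge_form_quat[OF M(2)[unfolded Mq], unfolded e4]
    have f2: "f = qform (U/4 - \<sigma> * (V/4)) (\<eta> * \<sigma> * (W/4)) (- \<eta> * (U/4 + \<sigma> * (V/4)))"
      unfolding M(3) Mq by (rule ext) (rule q(1))
    hence ABD: "A = U/4 - \<sigma> * (V/4)" "B = \<eta> * \<sigma> * (W/4)" "D = - \<eta> * (U/4 + \<sigma> * (V/4))"
      unfolding f qform_eq_iff by auto
    have big: "\<bar>x\<bar> \<le> C" if "\<bar>k * x\<bar> \<le> C" "k \<ge> 1" for k x
    proof -
      have "1 * \<bar>x\<bar> \<le> \<bar>k\<bar> * \<bar>x\<bar>" using that(2) by (intro mult_right_mono) auto
      thus ?thesis using that(1) by (simp add: abs_mult)
    qed
    have s1: "\<sigma> \<ge> 1" using eta_gt_1 by simp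
    have e1: "\<eta> \<ge> 1" using eta_gt_1 by simp
    have D': "\<bar>U/4 + \<sigma> * (V/4)\<bar> \<le> C"
      by (rule big[of \<eta>, OF _ e1]) (use bd(3) in \<open>simp add: ABD(3) abs_mult\<close>)
    have A': "\<bar>U/4 - \<sigma> * (V/4)\<bar> \<le> C" using bd(1) ABD(1) by simp
    have "\<bar>U/4\<bar> \<le> C" "\<bar>\<sigma> * (V/4)\<bar> \<le> C" using D' A' by linarith+
    moreover have "\<bar>V/4\<bar> \<le> C" using calculation(2) s1 by (rule big)
    moreover have "\<bar>W/4\<bar> \<le> C"
      using bd(2) unfolding ABD(2) by (rule big) (use mult_mono[OF e1 s1] e1 in linarith)
    moreover have "U^2 - \<eta> * V^2 + \<eta>^2 * W^2 = 16" using q(2) by (simp add: power_divide field_simps)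
    ultimately have "(U, V, W) \<in> T" unfolding T_def using UVW by auto
    moreover have "f = F (U, V, W)" unfolding f2 F_def by (simp add: qform_eq_iff field_simps)
    ultimately show "f \<in> F ` T" by blast
  qed
  moreover have "finite (F ` T)" unfolding T_def by (intro finite_imageI finite_bounded_solutions)
  ultimately show ?thesis by (rule finite_subset)
qed

section \<open>The vertices and the edges of the heptagon\<close>

text \<open>The ends \<open>tau3\<close> and \<open>tau3'\<close> of the edge have real parts
  \<open>- vx\<close> and \<open>vx\<close> and the common imaginary part \<open>vy\<close>.\<close>

definition vx :: real where "vx = \<eta>^2 - \<eta>"
definition vy :: real where "vy = sqrt (\<eta> - vx^2)"

lemma vx_bounds: "0.2 < vx" "vx < 0.4"
proof -
  have "vx = \<eta> * (\<eta> - 1)" by (simp add: vx_def power2_eq_square algebra_simps)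
  moreover have "1 * 0.24 \<le> \<eta> * (\<eta> - 1)" "\<eta> * (\<eta> - 1) \<le> 1.25 * 0.25"
    using eta_bounds by (intro mult_mono; simp)+
  ultimately show "0.2 < vx" "vx < 0.4" by simp_all
qed

lemma vx_sq_less: "vx^2 < \<eta>"
proof -
  have "vx^2 \<le> 0.4^2" using vx_bounds by (intro power_mono) auto
  thus ?thesis using eta_gt_1 by (simp add: power2_eq_square)
qed

lemma vy_pos: "vy > 0" and vy_sq: "vy^2 = \<eta> - vx^2"
  using vx_sq_less by (auto simp: vy_def)

text \<open>A non-real fixed point and its conjugate are the roots of rz^2 + (s - p)z - q, so the
  two conditions are Vieta's formulas.\<close>

lemma lft_fixed_iff:
  assumes "Im z > 0" "r \<noteq> 0"
  shows "lft (mat2 p q r s) (Some z) = Some z \<longleftrightarrow> 2 * r * Re z = p - s \<and> r * (cmod z)^2 = - q"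
proof -
  have nz: "of_real r * z + of_real s \<noteq> 0"
  proof
    assume "of_real r * z + of_real s = 0"
    hence "Im (of_real r * z + of_real s) = 0" by simp
    with assms show False by simp
  qed
  have "lft (mat2 p q r s) (Some z) = Some z \<longleftrightarrow> of_real p * z + of_real q = z * (of_real r * z + of_real s)"
    using nz by (simp add: moebius_def field_simps)
  also have "\<dots> \<longleftrightarrow> p * Re z + q = r * ((Re z)^2 - (Im z)^2) + s * Re z \<and> Im z * (2 * r * Re z - (p - s)) = 0"
    by (auto simp: complex_eq_iff power2_eq_square algebra_simps)
  also have "\<dots> \<longleftrightarrow> 2 * r * Re z = p - s \<and> p * Re z + q = r * ((Re z)^2 - (Im z)^2) + s * Re z"
    using assms by auto
  also have "\<dots> \<longleftrightarrow> 2 * r * Re z = p - s \<and> r * (cmod z)^2 = - q"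
  proof (rule conj_cong[OF refl])
    assume "2 * r * Re z = p - s"
    hence p: "p = s + 2 * r * Re z" by simp
    show "p * Re z + q = r * ((Re z)^2 - (Im z)^2) + s * Re z \<longleftrightarrow> r * (cmod z)^2 = - q"
      unfolding p cmod_power2 by (auto simp: algebra_simps power2_eq_square)
  qed
  finally show ?thesis .
qed

lemma upper_half_plane_iff: "Some z \<in> upper_half_plane \<longleftrightarrow> Im z > 0"
  by (auto simp: upper_half_plane_def)

lemma upper_half_planeE:
  assumes "\<tau> \<in> upper_half_plane" obtains z where "\<tau> = Some z" "Im z > 0"
  using assms by (auto simp: upper_half_plane_def)

lemma upper_half_plane_eqI:
  assumes "Im z > 0" "Im w > 0" "Re z = Re w" "(cmod z)^2 = (cmod w)^2" shows "z = w"
proof -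
  have "(Im z)^2 = (Im w)^2" using assms by (simp add: cmod_power2)
  hence "Im z = Im w" using assms by (simp add: power2_eq_iff_nonneg)
  thus ?thesis using assms by (simp add: complex_eq_iff)
qed

lemma the_fixed_point:
  assumes "r \<noteq> 0" "Im w > 0" "2 * r * Re w = p - s" "r * (cmod w)^2 = - q"
  shows "(THE \<tau>. \<tau> \<in> upper_half_plane \<and> lft (mat2 p q r s) \<tau> = \<tau>) = Some w"
proof (rule the_equality)
  show "Some w \<in> upper_half_plane \<and> lft (mat2 p q r s) (Some w) = Some w"
    using assms lft_fixed_iff upper_half_plane_iff by blast
  fix \<tau> assume t: "\<tau> \<in> upper_half_plane \<and> lft (mat2 p q r s) \<tau> = \<tau>"
  then obtain z where z: "\<tau> = Some z" "Im z > 0" by (auto elim: upper_half_planeE)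
  hence "2 * r * Re z = p - s \<and> r * (cmod z)^2 = - q" using t lft_fixed_iff[OF z(2) assms(1)] by simp
  hence "r * Re z = r * Re w" "r * (cmod z)^2 = r * (cmod w)^2" using assms by linarith+
  hence "Re z = Re w" "(cmod z)^2 = (cmod w)^2" using assms(1) by simp_all
  thus "\<tau> = Some w" using upper_half_plane_eqI[OF z(2) assms(2)] z(1) by simp
qed

lemma tau3_eq: "tau3 = Some (Complex (- vx) vy)"
proof -
  have g: "g3 = mat2 (1/2 * (1 + (\<eta>^2 - 2) * \<sigma>)) (1/2 * (- (\<eta>^2 + \<eta> - 1) * \<sigma>))
      (1/2 * ((3 - \<eta>^2) * \<sigma>)) (1/2 * (1 - (\<eta>^2 - 2) * \<sigma>))"
    unfolding g3_def mat2_scaleR ..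
  have 1: "(3 - \<eta>^2) * vx = 2 - \<eta>^2" "(3 - \<eta>^2) * \<eta> = \<eta>^2 + \<eta> - 1"
    unfolding vx_def using eta_minpoly by algebra+
  show ?thesis unfolding tau3_def g
  proof (rule the_fixed_point)
    show "1/2 * ((3 - \<eta>^2) * \<sigma>) \<noteq> 0" using eta_sq_bounds sqrt_eta_pos by simp
    show "Im (Complex (- vx) vy) > 0" using vy_pos by simp
    have "2 * (1/2 * ((3 - \<eta>^2) * \<sigma>)) * (- vx) = - ((3 - \<eta>^2) * vx) * \<sigma>" by simp
    also have "\<dots> = (\<eta>^2 - 2) * \<sigma>" unfolding 1 by simp
    finally show "2 * (1/2 * ((3 - \<eta>^2) * \<sigma>)) * Re (Complex (- vx) vy) =
        1/2 * (1 + (\<eta>^2 - 2) * \<sigma>) - 1/2 * (1 - (\<eta>^2 - 2) * \<sigma>)" by (simp add: field_simps)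
    have "1/2 * ((3 - \<eta>^2) * \<sigma>) * (cmod (Complex (- vx) vy))^2 = 1/2 * ((3 - \<eta>^2) * \<eta>) * \<sigma>"
      by (simp add: cmod_power2 vy_sq)
    also have "\<dots> = - (1/2 * (- (\<eta>^2 + \<eta> - 1) * \<sigma>))" unfolding 1 by (simp add: algebra_simps)
    finally show "1/2 * ((3 - \<eta>^2) * \<sigma>) * (cmod (Complex (- vx) vy))^2 = - (1/2 * (- (\<eta>^2 + \<eta> - 1) * \<sigma>))" .
  qed
qed

lemma lft_g2:
  assumes "(cmod z)^2 = \<eta>" shows "lft g2 (Some z) = Some (- cnj z)"
proof -
  have "z \<noteq> 0" using assms eta_gt_1 by auto
  have "z * cnj z = of_real \<eta>" using complex_norm_square[of z] assms by simp
  moreover have "of_real \<sigma> * of_real \<sigma> = (of_real \<eta> :: complex)"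
    using sqrt_eta_sq by (simp flip: of_real_mult add: power2_eq_square)
  ultimately show ?thesis using \<open>z \<noteq> 0\<close> sqrt_eta_pos
    by (simp add: g2_def moebius_def field_simps)
qed

lemma tau3'_eq: "tau3' = Some (Complex vx vy)"
  unfolding tau3'_def tau3_eq by (subst lft_g2) (simp_all add: cmod_power2 vy_sq complex_eq_iff)

text \<open>The i and k coordinates of \<open>g7\<close>. Its j coordinate is 0, which puts the
  fixed point on the imaginary axis.\<close>

definition qb :: real where "qb = (2 - \<eta>^2) / 2"
definition qd :: real where "qd = (\<eta>^2 + \<eta> - 2) / 2"

lemma qb_pos: "qb > 0" and qb_less: "qb < qd * \<sigma>" and qd_pos: "qd > 0"
proof -
  show "qb > 0" "qd > 0" using eta_bounds eta_sq_bounds by (auto simp: qb_def qd_def)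
  have "qb < qd * 1" using eta_bounds eta_sq_bounds by (auto simp: qb_def qd_def)
  also have "qd * 1 \<le> qd * \<sigma>" using \<open>qd > 0\<close> eta_gt_1 by (intro mult_left_mono) auto
  finally show "qb < qd * \<sigma>" .
qed

lemma g7_quat': "g7 = quat ((\<eta>^2 + \<eta> - 1) / 2) qb 0 qd"
  by (simp add: g7_quat qb_def qd_def)

definition t7 :: real where "t7 = \<eta> * (qd * \<sigma> - qb) / (qb + qd * \<sigma>)"

lemma t7_pos: "t7 > 0" and t7_mult: "(qb + qd * \<sigma>) * t7 = \<eta> * (qd * \<sigma> - qb)"
  using qb_less qb_pos eta_gt_1 by (auto simp: t7_def)

lemma tau7_eq: "tau7 = Some (Complex 0 (sqrt t7))"
  unfolding tau7_def g7_quat' quat_def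
proof (rule the_fixed_point)
  have "(cmod (Complex 0 (sqrt t7)))^2 = t7" using t7_pos by (simp add: cmod_power2)
  thus "(qb + qd * \<sigma>) * (cmod (Complex 0 (sqrt t7)))^2 = - (\<eta> * (qb - qd * \<sigma>))"
    using t7_mult by (simp add: algebra_simps)
qed (use qb_less qb_pos t7_pos in auto)

text \<open>The powers of \<open>g\<^sub>7 = cos(\<pi>/7) + sin(\<pi>/7) \<omega>\<close> with \<open>\<omega>\<^sup>2 = -1\<close> are
  \<open>cos(n\<pi>/7) + sin(n\<pi>/7) \<omega>\<close>; here \<open>S = sin(n\<pi>/7)/sin(\<pi>/7)\<close>.\<close>

lemma g7_mult_power:
  "g7 ** quat a (S * qb) 0 (S * qd) = quat (((\<eta>^2 + \<eta> - 1) * (2 * a) + (\<eta> - 2) * S) / 4)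
     (((\<eta>^2 + \<eta> - 1) * S + 2 * a) / 2 * qb) 0 (((\<eta>^2 + \<eta> - 1) * S + 2 * a) / 2 * qd)"
proof -
  have "4 * (\<eta> * qb^2 - \<eta>^2 * qd^2) = \<eta> * (2 - \<eta>^2)^2 - \<eta>^2 * (\<eta>^2 + \<eta> - 2)^2"
    by (simp add: qb_def qd_def power_divide)
  also have "\<dots> = \<eta> - 2" using eta_minpoly by algebra
  finally have n: "\<eta> * qb * qb - \<eta>^2 * qd * qd = (\<eta> - 2) / 4" by (simp add: power2_eq_square)
  have "(\<eta>^2 + \<eta> - 1) / 2 * a + \<eta> * qb * (S * qb) + \<eta> * 0 * 0 - \<eta>^2 * qd * (S * qd) =
      (\<eta>^2 + \<eta> - 1) / 2 * a + S * (\<eta> * qb * qb - \<eta>^2 * qd * qd)" by (simp add: algebra_simps)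
  also have "\<dots> = ((\<eta>^2 + \<eta> - 1) * (2 * a) + (\<eta> - 2) * S) / 4" unfolding n by (simp add: field_simps)
  finally show ?thesis unfolding g7_quat' quat_mult by (intro quat_cong) (auto simp: field_simps)
qed

lemma g7_power_Suc:
  assumes "mat_pow g7 m = quat (p / 2) (S * qb) 0 (S * qd)" "n = Suc m"
    "(\<eta>^2 + \<eta> - 1) * p + (\<eta> - 2) * S = 2 * p'" "(\<eta>^2 + \<eta> - 1) * S + p = 2 * S'"
  shows "mat_pow g7 n = quat (p' / 2) (S' * qb) 0 (S' * qd)"
proof -
  have "mat_pow g7 n = g7 ** quat (p / 2) (S * qb) 0 (S * qd)" by (simp add: assms(1,2))
  thus ?thesis unfolding g7_mult_power by (simp add: assms(3,4))
qed

lemma g7_powers: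
  "mat_pow g7 1 = quat ((\<eta>^2 + \<eta> - 1) / 2) (1 * qb) 0 (1 * qd)"
  "mat_pow g7 2 = quat (\<eta> / 2) ((\<eta>^2 + \<eta> - 1) * qb) 0 ((\<eta>^2 + \<eta> - 1) * qd)"
  "mat_pow g7 3 = quat ((2 - \<eta>^2) / 2) ((\<eta> + 1) * qb) 0 ((\<eta> + 1) * qd)"
  "mat_pow g7 4 = quat (- (2 - \<eta>^2) / 2) ((\<eta> + 1) * qb) 0 ((\<eta> + 1) * qd)"
  "mat_pow g7 5 = quat (- \<eta> / 2) ((\<eta>^2 + \<eta> - 1) * qb) 0 ((\<eta>^2 + \<eta> - 1) * qd)"
  "mat_pow g7 6 = quat (- (\<eta>^2 + \<eta> - 1) / 2) (1 * qb) 0 (1 * qd)"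
proof -
  show 1: "mat_pow g7 1 = quat ((\<eta>^2 + \<eta> - 1) / 2) (1 * qb) 0 (1 * qd)"
    by (simp add: g7_quat')
  show 2: "mat_pow g7 2 = quat (\<eta> / 2) ((\<eta>^2 + \<eta> - 1) * qb) 0 ((\<eta>^2 + \<eta> - 1) * qd)"
    by (rule g7_power_Suc[OF 1]; (simp; fail | (insert eta_minpoly, algebra)))
  show 3: "mat_pow g7 3 = quat ((2 - \<eta>^2) / 2) ((\<eta> + 1) * qb) 0 ((\<eta> + 1) * qd)"
    by (rule g7_power_Suc[OF 2]; (simp; fail | (insert eta_minpoly, algebra)))
  show 4: "mat_pow g7 4 = quat (- (2 - \<eta>^2) / 2) ((\<eta> + 1) * qb) 0 ((\<eta> + 1) * qd)"
    by (rule g7_power_Suc[OF 3]; (simp; fail | (insert eta_minpoly, algebra)))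
  show 5: "mat_pow g7 5 = quat (- \<eta> / 2) ((\<eta>^2 + \<eta> - 1) * qb) 0 ((\<eta>^2 + \<eta> - 1) * qd)"
    by (rule g7_power_Suc[OF 4]; (simp; fail | (insert eta_minpoly, algebra)))
  show 6: "mat_pow g7 6 = quat (- (\<eta>^2 + \<eta> - 1) / 2) (1 * qb) 0 (1 * qd)"
    by (rule g7_power_Suc[OF 5]; (simp add: algebra_simps; fail | (insert eta_minpoly, algebra)))
qed

lemma det_g2: "det g2 = 1" and det_g7: "det g7 = 1"
proof -
  show "det g2 = 1" using sqrt_eta_pos by (simp add: g2_def det_mat2)
  have "4 * (((\<eta>^2 + \<eta> - 1) / 2)^2 - \<eta> * qb^2 + \<eta>^2 * qd^2) =
      (\<eta>^2 + \<eta> - 1)^2 - \<eta> * (2 - \<eta>^2)^2 + \<eta>^2 * (\<eta>^2 + \<eta> - 2)^2"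
    by (simp add: qb_def qd_def power_divide)
  also have "\<dots> = 4" using eta_minpoly by algebra
  finally have "((\<eta>^2 + \<eta> - 1) / 2)^2 - \<eta> * qb^2 + \<eta>^2 * qd^2 = 1" by simp
  thus "det g7 = 1" by (simp add: g7_quat' det_quat)
qed

lemma det_mat_pow: "det M = 1 \<Longrightarrow> det (mat_pow M n) = 1"
  by (induction n) (simp_all add: det_mul)

lemma det_step_matrix: "det (step_matrix n) = 1"
  by (simp add: step_matrix_def det_mul det_g2 det_mat_pow det_g7)

text \<open>Combined with \<open>ev_rotated_edge_form\<close>, the inequality puts the edge with
  index 0 on the nonpositive side of the line of every other edge. Equality is possible only for its
  two neighbours, which share a vertex with it.\<close>

lemma g7_power_cases:
  assumes "n \<in> {1..6}"
  obtains a S where "mat_pow g7 n = quat a (S * qb) 0 (S * qd)" "S > 0"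
    "\<bar>a\<bar> * vx \<le> \<eta> * S * qb" "\<bar>a\<bar> * vx = \<eta> * S * qb \<Longrightarrow> n = 1 \<and> a > 0 \<or> n = 6 \<and> a < 0"
proof -
  have t: "1.77 < \<eta>^2 + \<eta> - 1" using eta_bounds eta_sq_bounds by simp
  have eq: "(\<eta>^2 + \<eta> - 1) / 2 * vx = \<eta> * 1 * qb"
    unfolding vx_def qb_def using eta_minpoly by algebra
  have lt2: "\<eta> / 2 * vx < \<eta> * (\<eta>^2 + \<eta> - 1) * qb"
  proof -
    have "0.4 < (\<eta>^2 + \<eta> - 1) * (2 - \<eta>^2)"
      using mult_strict_mono[of "1.77" "\<eta>^2 + \<eta> - 1" "0.43" "2 - \<eta>^2"] t eta_sq_bounds by simp
    hence "\<eta> / 2 * vx < \<eta> / 2 * ((\<eta>^2 + \<eta> - 1) * (2 - \<eta>^2))"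
      using vx_bounds eta_gt_1 by (intro mult_strict_left_mono) auto
    thus ?thesis by (simp add: qb_def)
  qed
  have lt3: "(2 - \<eta>^2) / 2 * vx < \<eta> * (\<eta> + 1) * qb"
  proof -
    have "vx < \<eta> * (\<eta> + 1)" using eta_gt_1 by (simp add: vx_def power2_eq_square algebra_simps)
    hence "qb * vx < qb * (\<eta> * (\<eta> + 1))" using qb_pos by (intro mult_strict_left_mono)
    thus ?thesis by (simp add: qb_def algebra_simps)
  qed
  have abs: "\<bar>(\<eta>^2 + \<eta> - 1) / 2\<bar> = (\<eta>^2 + \<eta> - 1) / 2" "\<bar>- (\<eta>^2 + \<eta> - 1) / 2\<bar> = (\<eta>^2 + \<eta> - 1) / 2"
    "\<bar>\<eta> / 2\<bar> = \<eta> / 2" "\<bar>- \<eta> / 2\<bar> = \<eta> / 2"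
    "\<bar>(2 - \<eta>^2) / 2\<bar> = (2 - \<eta>^2) / 2" "\<bar>- (2 - \<eta>^2) / 2\<bar> = (2 - \<eta>^2) / 2"
    using t eta_sq_bounds eta_bounds by simp_all
  consider "n = 1" | "n = 2" | "n = 3" | "n = 4" | "n = 5" | "n = 6" using assms by force
  thus ?thesis
  proof cases
    case 1
    show ?thesis
      by (rule that[OF g7_powers(1)[folded 1]], unfold abs) (use eq t eta_gt_1 1 in simp_all)
  next
    case 2
    show ?thesis
      by (rule that[OF g7_powers(2)[folded 2]], unfold abs) (use lt2 t eta_gt_1 2 in simp_all)
  next
    case 3
    show ?thesis
      by (rule that[OF g7_powers(3)[folded 3]], unfold abs) (use lt3 t eta_gt_1 3 in simp_all)
  next
    case 4
    show ?thesis
      by (rule that[OF g7_powers(4)[folded 4]], unfold abs) (use lt3 t eta_gt_1 4 in simp_all)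
  next
    case 5
    show ?thesis
      by (rule that[OF g7_powers(5)[folded 5]], unfold abs) (use lt2 t eta_gt_1 5 in simp_all)
  next
    case 6
    show ?thesis
      by (rule that[OF g7_powers(6)[folded 6]], unfold abs) (use eq t eta_gt_1 6 in simp_all)
  qed
qed

section \<open>Edges and tiles\<close>

text \<open>Along a geodesic a form is a positive factor times p + q exp(2t), and the second factor
  is monotone in t.\<close>

lemma geodesic_segment_forms:
  assumes "geodesic \<beta> \<alpha> r = P" "geodesic \<beta> \<alpha> s = Q" "r \<le> t" "t \<le> s" "\<beta> \<noteq> \<alpha>" "is_qform f"
    and "ev f P \<ge> 0" "ev f Q \<ge> 0"
  shows "ev f (geodesic \<beta> \<alpha> t) \<ge> 0"
proof -
  have "\<exists>w>0. ev f (geodesic \<beta> \<alpha> t) = w * (f (rep \<beta>) + exp (2 * t) * f (rep \<alpha>))" for t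
    using ev_geodesic_rep[OF assms(5)] assms(6) by blast
  then obtain w where w: "\<And>t. w t > 0"
    "\<And>t. ev f (geodesic \<beta> \<alpha> t) = w t * (f (rep \<beta>) + exp (2 * t) * f (rep \<alpha>))" by metis
  define F where "F = (\<lambda>t. f (rep \<beta>) + exp (2 * t) * f (rep \<alpha>))"
  have sgn: "ev f (geodesic \<beta> \<alpha> t) \<ge> 0 \<longleftrightarrow> F t \<ge> 0" for t
    using w(1)[of t] by (simp add: w(2) F_def zero_le_mult_iff)
  have "F r \<ge> 0" "F s \<ge> 0" using assms sgn by auto
  have "F t \<ge> 0"
  proof (cases "f (rep \<alpha>) \<ge> 0")
    case True
    hence "F r \<le> F t" unfolding F_def using assms(3) by (intro add_left_mono mult_right_mono) auto
    thus ?thesis using \<open>F r \<ge> 0\<close> by simp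
  next
    case False
    hence "F s \<le> F t" unfolding F_def using assms(4) by (intro add_left_mono mult_right_mono_neg) auto
    thus ?thesis using \<open>F s \<ge> 0\<close> by simp
  qed
  thus ?thesis using sgn by simp
qed

lemma geodesic_cases:
  assumes "\<beta> \<noteq> \<alpha>" obtains z where "geodesic \<beta> \<alpha> t = Some z" "Im z > 0"
  by (cases \<beta>; cases \<alpha>) (use assms in \<open>auto simp: that cosh_real_pos\<close>)

text \<open>Four forms are nonnegative at both vertices, hence on the segment: plus and minus (|z|^2
  - \<eta>), and \<open>vx\<close> plus and minus Re z.\<close>

lemma edge_segment:
  assumes "q \<in> geodesic_segment tau3 tau3'"
  obtains u where "q = Some u" "Im u > 0" "(cmod u)^2 = \<eta>" "- vx \<le> Re u" "Re u \<le> vx"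
proof -
  obtain \<beta> \<alpha> r s t where *: "\<beta> \<noteq> \<alpha>" "r \<le> t" "t \<le> s" "geodesic \<beta> \<alpha> r = tau3" "geodesic \<beta> \<alpha> s = tau3'"
    "q = geodesic \<beta> \<alpha> t" using assms unfolding geodesic_segment_def by blast
  obtain u where u: "q = Some u" "Im u > 0" using geodesic_cases[OF *(1)] *(6) by metis
  have m: "(cmod (Complex (- vx) vy))^2 = \<eta>" "(cmod (Complex vx vy))^2 = \<eta>"
    by (simp_all add: cmod_power2 vy_sq)
  have f: "ev (qform A B D) q \<ge> 0"
    if "ev (qform A B D) tau3 \<ge> 0" "ev (qform A B D) tau3' \<ge> 0" for A B D
    unfolding *(6) by (rule geodesic_segment_forms[OF *(4,5,2,3,1)]) (use that in auto)
  have "(cmod u)^2 \<ge> \<eta>" using f[of 1 0 "- \<eta>"] unfolding u tau3_eq tau3'_eq ev_qform m by simp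
  moreover have "(cmod u)^2 \<le> \<eta>" using f[of "-1" 0 "\<eta>"] unfolding u tau3_eq tau3'_eq ev_qform m by simp
  moreover have "- vx \<le> Re u" "Re u \<le> vx"
    using f[of 0 "1/2" vx] f[of 0 "-1/2" vx] vx_bounds unfolding u tau3_eq tau3'_eq ev_qform by simp_all
  ultimately show ?thesis using that u by simp
qed

lemma edge'E:
  assumes "Q \<in> edge' n"
  obtains u where "Q = lft (mat_pow g7 n) (Some u)" "Im u > 0" "(cmod u)^2 = \<eta>" "- vx < Re u" "Re u \<le> vx"
proof -
  obtain q where q: "Q = lft (mat_pow g7 n) q" "q \<in> geodesic_segment tau3 tau3'" "q \<noteq> tau3"
    using assms unfolding edge'_def by blast
  obtain u where u: "q = Some u" "Im u > 0" "(cmod u)^2 = \<eta>" "- vx \<le> Re u" "Re u \<le> vx"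
    using edge_segment[OF q(2)] .
  have "Re u \<noteq> - vx"
  proof
    assume "Re u = - vx"
    hence "u = Complex (- vx) vy" using u vy_pos by (intro upper_half_plane_eqI) (auto simp: cmod_power2 vy_sq)
    thus False using q(3) u(1) tau3_eq by simp
  qed
  thus ?thesis using that[of u] u q by simp
qed

lemma edge_0E:
  assumes "Q \<in> edge 0"
  obtains u where "Q = Some u" "Im u > 0" "(cmod u)^2 = \<eta>" "- vx \<le> Re u" "Re u < vx"
proof -
  have one: "lft (mat 1) z = z" for z :: "complex option"
    by (cases z) (simp_all add: mat_def moebius_def)
  have Q: "Q \<in> geodesic_segment tau3 tau3'" "Q \<noteq> tau3'"
    using assms unfolding edge_def by (auto simp: one)
  obtain u where u: "Q = Some u" "Im u > 0" "(cmod u)^2 = \<eta>" "- vx \<le> Re u" "Re u \<le> vx"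
    using edge_segment[OF Q(1)] .
  have "Re u \<noteq> vx"
  proof
    assume "Re u = vx"
    hence "u = Complex vx vy" using u vy_pos by (intro upper_half_plane_eqI) (auto simp: cmod_power2 vy_sq)
    thus False using Q(2) u(1) tau3'_eq by simp
  qed
  thus ?thesis using that[of u] u by simp
qed

lemma tanh_artanh:
  fixes x :: real
  assumes "\<bar>x\<bar> < 1" shows "tanh (artanh x) = x"
proof -
  have "(1 + x) / (1 - x) > 0" using assms by simp
  hence "exp (- (2 * artanh x)) = (1 - x) / (1 + x)"
    using assms by (simp add: artanh_def exp_minus)
  hence "tanh (artanh x) = (1 - (1 - x) / (1 + x)) / (1 + (1 - x) / (1 + x))"
    unfolding tanh_real_altdef by simp
  also have "1 - (1 - x) / (1 + x) = 2 * x / (1 + x)" using assms by (simp add: field_simps)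
  also have "1 + (1 - x) / (1 + x) = 2 / (1 + x)" using assms by (simp add: field_simps)
  finally show ?thesis using assms by simp
qed

text \<open>A point of the chord in the coordinates (|z|^2, Re z) lies on the geodesic. Its
  parameter is recovered by \<open>ln\<close> on a vertical line and by \<open>artanh\<close> on a
  semicircle, and monotonicity puts it between those of the ends.\<close>

lemma geodesic_segmentI:
  assumes "Im p > 0" "Im q > 0" "Im w > 0" "p \<noteq> q" "0 \<le> l" "l \<le> 1"
    "(cmod w)^2 = (1 - l) * (cmod p)^2 + l * (cmod q)^2" "Re w = (1 - l) * Re p + l * Re q"
  shows "Some w \<in> geodesic_segment (Some p) (Some q)"
proof (cases "Re p = Re q")
  case True
  hence Re: "Re w = Re p" using assms(8) by (simp add: algebra_simps)
  have Im: "(Im w)^2 = (1 - l) * (Im p)^2 + l * (Im q)^2"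
    using assms(7) True unfolding cmod_power2 Re by (simp add: algebra_simps)
  have ln: "Some z = Some (Complex (Re p) (exp (ln (Im z))))" if "Re z = Re p" "Im z > 0" for z
    using that by (simp add: complex_eq_iff)
  have conv: "min x y \<le> (1 - l) * x + l * y" "(1 - l) * x + l * y \<le> max x y" for x y
    using assms(5,6) convex_bound_le[of x "max x y" y "1 - l" l]
      convex_bound_le[of "-x" "- min x y" "-y" "1 - l" l] by auto
  have "Im p \<noteq> Im q" using True assms(4) by (simp add: complex_eq_iff)
  then consider "Im p < Im q" | "Im q < Im p" by linarith
  thus ?thesis
  proof cases
    case 1
    hence "(Im p)^2 \<le> (Im q)^2" using assms by (intro power_mono) auto
    hence "(Im p)^2 \<le> (Im w)^2" "(Im w)^2 \<le> (Im q)^2" using conv[of "(Im p)^2" "(Im q)^2"] Im by auto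
    hence "Im p \<le> Im w" "Im w \<le> Im q" using assms by (auto simp: power2_le_iff_abs_le)
    thus ?thesis unfolding geodesic_segment_def using assms True Re
      by (intro CollectI exI[of _ "Some (Re p)"] exI[of _ None] exI[of _ "ln (Im p)"]
          exI[of _ "ln (Im q)"] exI[of _ "ln (Im w)"]) (auto simp: complex_eq_iff)
  next
    case 2
    hence "(Im q)^2 \<le> (Im p)^2" using assms by (intro power_mono) auto
    hence "(Im q)^2 \<le> (Im w)^2" "(Im w)^2 \<le> (Im p)^2" using conv[of "(Im p)^2" "(Im q)^2"] Im by auto
    hence "Im q \<le> Im w" "Im w \<le> Im p" using assms by (auto simp: power2_le_iff_abs_le)
    thus ?thesis unfolding geodesic_segment_def using assms True Re
      by (intro CollectI exI[of _ None] exI[of _ "Some (Re p)"] exI[of _ "- ln (Im p)"]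
          exI[of _ "- ln (Im q)"] exI[of _ "- ln (Im w)"]) (auto simp: complex_eq_iff)
  qed
next
  case False
  \<comment> \<open>\<open>c\<close> and \<open>R\<close> are the centre and radius of the
    semicircle through p and q; the sign \<open>e\<close> orients it from p to q.\<close>
  define c where "c = ((cmod q)^2 - (cmod p)^2) / (2 * (Re q - Re p))"
  define R where "R = sqrt ((cmod p)^2 - 2 * c * Re p + c^2)"
  define e where "e = sgn (Re q - Re p)"
  have e: "e^2 = 1" "e \<noteq> 0" "e * (Re q - Re p) > 0" using False by (auto simp: e_def sgn_if)
  have R2: "(cmod p)^2 - 2 * c * Re p + c^2 = (Re p - c)^2 + (Im p)^2"
    unfolding cmod_power2 by (simp add: power2_eq_square algebra_simps)
  have Rpos: "R > 0" unfolding R_def R2 using assms(1) by (simp add: add_nonneg_pos)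
  have p: "(Re p - c)^2 + (Im p)^2 = R^2"
    unfolding R_def R2 by simp
  have "2 * (Re q - Re p) \<noteq> 0" using False by simp
  hence "c * (2 * (Re q - Re p)) = (cmod q)^2 - (cmod p)^2"
    unfolding c_def by (rule nonzero_eq_divide_eq[THEN iffD1, OF _ refl])
  hence cq: "(cmod q)^2 - 2 * c * Re q = (cmod p)^2 - 2 * c * Re p" by (simp add: algebra_simps)
  hence q: "(Re q - c)^2 + (Im q)^2 = R^2"
    unfolding p[symmetric] cmod_power2 by (simp add: power2_eq_square algebra_simps)
  have "(cmod w)^2 - 2 * c * Re w
      = (1 - l) * ((cmod p)^2 - 2 * c * Re p) + l * ((cmod q)^2 - 2 * c * Re q)"
    unfolding assms(7,8) by (simp add: algebra_simps)
  also have "\<dots> = (cmod p)^2 - 2 * c * Re p" unfolding cq by (simp add: algebra_simps)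
  finally have w: "(Re w - c)^2 + (Im w)^2 = R^2"
    unfolding p[symmetric] cmod_power2 by (simp add: power2_eq_square algebra_simps)
  define T where "T = (\<lambda>z. artanh (e * (Re z - c) / R))"
  have tanhT: "tanh (T z) = e * (Re z - c) / R"
    and geo: "geodesic (Some (c - e * R)) (Some (c + e * R)) (T z) = Some z"
    if z: "(Re z - c)^2 + (Im z)^2 = R^2" "Im z > 0" for z
  proof -
    have "(e * (Re z - c))^2 < R^2" using z e(1) by (simp add: power_mult_distrib flip: z(1))
    hence "\<bar>e * (Re z - c)\<bar>^2 < R^2" by simp
    hence "\<bar>e * (Re z - c)\<bar> < R" by (rule power2_less_imp_less) (use Rpos in simp)
    hence "\<bar>e * (Re z - c)\<bar> / \<bar>R\<bar> < 1" using Rpos by simp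
    hence "\<bar>e * (Re z - c) / R\<bar> < 1" by (simp only: abs_divide)
    thus th: "tanh (T z) = e * (Re z - c) / R" unfolding T_def by (rule tanh_artanh)
    have re: "(c - e * R + (c + e * R)) / 2 + (c + e * R - (c - e * R)) / 2 * tanh (T z) = Re z"
      unfolding th using Rpos e(1) by (simp add: field_simps power2_eq_square)
    have "cosh (T z) \<noteq> 0" using cosh_real_pos[of "T z"] by linarith
    hence "(cosh (T z))^2 * ((sinh (T z))^2 / (cosh (T z))^2) = (sinh (T z))^2" by simp
    hence "(cosh (T z))^2 * (1 - (tanh (T z))^2) = 1"
      unfolding tanh_def power_divide right_diff_distrib using cosh_square_eq[of "T z"] by linarith
    hence "R^2 * (1 - (tanh (T z))^2) * (cosh (T z))^2 = R^2" by algebra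
    hence "(R / cosh (T z))^2 = R^2 * (1 - (tanh (T z))^2)"
      using cosh_real_pos[of "T z"] by (simp add: power_divide field_simps)
    also have "R^2 * (e * (Re z - c) / R)^2 = (Re z - c)^2"
      using Rpos e(1) by (simp add: power_divide power_mult_distrib)
    hence "R^2 * (1 - (tanh (T z))^2) = (Im z)^2"
      unfolding th right_diff_distrib using z(1) by linarith
    finally have im: "R / cosh (T z) = Im z" using Rpos z(2) cosh_real_pos[of "T z"]
      by (simp add: power2_eq_iff_nonneg)
    have "\<bar>c + e * R - (c - e * R)\<bar> / 2 = R" using Rpos e(1) by (auto simp: abs_mult power2_eq_1_iff)
    thus "geodesic (Some (c - e * R)) (Some (c + e * R)) (T z) = Some z"
      using re im by (simp add: complex_eq_iff)
  qed
  have le: "T x \<le> T y" if "(Re x - c)^2 + (Im x)^2 = R^2" "Im x > 0" "(Re y - c)^2 + (Im y)^2 = R^2" "Im y > 0"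
    "e * (Re y - Re x) \<ge> 0" for x y
  proof -
    have "e * (Re x - c) \<le> e * (Re y - c)" using that(5) by (simp add: algebra_simps)
    hence "tanh (T x) \<le> tanh (T y)" using tanhT[OF that(1,2)] tanhT[OF that(3,4)] Rpos
      by (simp add: divide_right_mono)
    thus ?thesis by simp
  qed
  have "0 \<le> l * (e * (Re q - Re p))" "0 \<le> (1 - l) * (e * (Re q - Re p))" using assms(5,6) e(3) by simp_all
  moreover have "e * (Re w - Re p) = l * (e * (Re q - Re p))" "e * (Re q - Re w) = (1 - l) * (e * (Re q - Re p))"
    unfolding assms(8) by (simp_all add: algebra_simps)
  ultimately have "e * (Re w - Re p) \<ge> 0" "e * (Re q - Re w) \<ge> 0" by linarith+
  hence "T p \<le> T w" "T w \<le> T q"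
    using le[OF p assms(1) w assms(3)] le[OF w assms(3) q assms(2)] by simp_all
  thus ?thesis unfolding geodesic_segment_def using Rpos e assms p q w
    by (intro CollectI exI[of _ "Some (c - e * R)"] exI[of _ "Some (c + e * R)"] exI[of _ "T p"]
          exI[of _ "T q"] exI[of _ "T w"]) (auto simp del: geodesic.simps simp: geo)
qed

section \<open>The heptagon near the vertex \<open>\<tau>\<^sub>3\<close>\<close>

lemma geodesically_convex_combination:
  assumes "geodesically_convex C" "Some p \<in> C" "Some q \<in> C" "0 \<le> l" "l \<le> 1" "Im w > 0"
    "(cmod w)^2 = (1 - l) * (cmod p)^2 + l * (cmod q)^2" "Re w = (1 - l) * Re p + l * Re q"
  shows "Some w \<in> C"
proof -
  have im: "Im p > 0" "Im q > 0" using assms unfolding geodesically_convex_def by (auto simp: upper_half_plane_def)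
  show ?thesis
  proof (cases "p = q")
    case True
    hence "w = p" using assms im by (intro upper_half_plane_eqI) (auto simp: algebra_simps)
    thus ?thesis using assms by simp
  next
    case False
    hence "Some w \<in> geodesic_segment (Some p) (Some q)" using assms im by (intro geodesic_segmentI) auto
    thus ?thesis using assms unfolding geodesically_convex_def by blast
  qed
qed

text \<open>Up to a scalar, these are the forms of the lines through \<open>\<tau>\<^sub>3\<close>, \<open>\<tau>\<^sub>7\<close> and through \<open>\<tau>\<^sub>3'\<close>, \<open>\<tau>\<^sub>7\<close>.\<close>

definition left_form :: "real^2 \<Rightarrow> real" where
  "left_form = qform (vx * (qb + qd * \<sigma>)) (\<eta> * qb) (- vx * (\<eta> * (qd * \<sigma> - qb)))"

definition right_form :: "real^2 \<Rightarrow> real" where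
  "right_form = qform (vx * (qb + qd * \<sigma>)) (- \<eta> * qb) (- vx * (\<eta> * (qd * \<sigma> - qb)))"

lemma t7_less: "t7 < \<eta>" and eta_minus_t7: "(qb + qd * \<sigma>) * (\<eta> - t7) = 2 * \<eta> * qb"
proof -
  show *: "(qb + qd * \<sigma>) * (\<eta> - t7) = 2 * \<eta> * qb" using t7_mult by (simp add: algebra_simps)
  have "(qb + qd * \<sigma>) * (\<eta> - t7) > 0" unfolding * using qb_pos eta_gt_1 by simp
  thus "t7 < \<eta>" using qb_pos qb_less by (simp add: zero_less_mult_iff)
qed

lemma ev_side_forms:
  "ev left_form (Some w) = (qb + qd * \<sigma>) * (vx * ((cmod w)^2 - t7) + (\<eta> - t7) * Re w)"
  "ev right_form (Some w) = (qb + qd * \<sigma>) * (vx * ((cmod w)^2 - t7) - (\<eta> - t7) * Re w)"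
  unfolding left_form_def right_form_def ev_qform t7_mult[symmetric]
  using eta_minus_t7 by algebra+

text \<open>In the coordinates (|z|^2, Re z) the tile is a Euclidean triangle, and the three forms
  are multiples of barycentric coordinates.\<close>

lemma tile_F_contains:
  assumes "Im w > 0" "ev edge_form (Some w) \<le> 0" "ev left_form (Some w) \<ge> 0" "ev right_form (Some w) \<ge> 0"
  shows "Some w \<in> tile_F"
  unfolding tile_F_def geodesic_triangle_def hull_def
proof (intro InterI, clarify)
  fix C assume C: "geodesically_convex C" "{tau3, tau3', tau7} \<subseteq> C"
  have H: "qb + qd * \<sigma> > 0" using qb_pos qb_less by simp
  define v x k e where "v = (cmod w)^2" "x = Re w" "k = vx" "e = \<eta> - t7"
  have ke: "k > 0" "e > 0" using vx_bounds t7_less by (auto simp: v_x_k_e_def)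
  have ine: "v \<le> \<eta>" "k * (v - t7) + e * x \<ge> 0" "k * (v - t7) - e * x \<ge> 0"
    using assms(2-4) H unfolding ev_side_forms edge_form_def ev_qform v_x_k_e_def
    by (simp_all add: zero_le_mult_iff)
  \<comment> \<open>\<open>a\<close>, \<open>b\<close>, \<open>c\<close> are the weights of
    \<open>tau3\<close>, \<open>tau3'\<close>, \<open>tau7\<close>.\<close>
  define c where "c = (\<eta> - v) / e"
  define a b where "a = (k * (v - t7) - e * x) / (2 * k * e)" and "b = (k * (v - t7) + e * x) / (2 * k * e)"
  have nn: "a \<ge> 0" "b \<ge> 0" "c \<ge> 0" using ine ke by (simp_all add: a_def b_def c_def)
  have abe: "2 * k * e * a = k * (v - t7) - e * x" "2 * k * e * b = k * (v - t7) + e * x" "e * c = \<eta> - v"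
    using ke by (simp_all add: a_def b_def c_def)
  have "2 * k * e * (a + b + c) = 2 * k * e"
    using abe v_x_k_e_def(4) by algebra
  hence sum: "a + b + c = 1" using ke by simp
  have "2 * k * e * (k * (b - a)) = 2 * k * e * x" using abe by algebra
  hence x: "x = k * (b - a)" using ke by simp
  have "e * (1 - c) = v - t7" using abe(3) v_x_k_e_def(4) by algebra
  hence v: "v = (a + b) * \<eta> + c * t7" using sum v_x_k_e_def(4) by algebra
  have mods: "(cmod (Complex (- vx) vy))^2 = \<eta>" "(cmod (Complex vx vy))^2 = \<eta>"
    "(cmod (Complex 0 (sqrt t7)))^2 = t7"
    using t7_pos by (simp_all add: cmod_power2 vy_sq)
  have mem: "Some (Complex (- vx) vy) \<in> C" "Some (Complex vx vy) \<in> C" "Some (Complex 0 (sqrt t7)) \<in> C"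
    using C(2) by (simp_all add: tau3_eq tau3'_eq tau7_eq)
  show "Some w \<in> C"
  proof (cases "b + c = 0")
    case True
    hence "b = 0" "c = 0" using nn by linarith+
    hence "w = Complex (- vx) vy" using sum x v assms(1) vy_pos mods(1)
      by (intro upper_half_plane_eqI) (auto simp: v_x_k_e_def)
    thus ?thesis using mem by simp
  next
    case False
    hence bc: "b + c > 0" using nn by linarith
    define l where "l = c / (b + c)"
    define v' x' where "v' = (1 - l) * \<eta> + l * t7" and "x' = (1 - l) * vx"
    have l: "0 \<le> l" "l \<le> 1" "1 - l = b / (b + c)" using nn bc by (auto simp: l_def field_simps)
    have "(1 - l) * (1 - l) \<le> 1 * (1 - l)" using l(1,2) by (intro mult_right_mono) auto
    hence x'_le: "x'^2 \<le> (1 - l) * vx^2"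
      unfolding x'_def power_mult_distrib by (intro mult_right_mono) (auto simp: power2_eq_square)
    also have "(1 - l) * vx^2 \<le> (1 - l) * \<eta>" using vx_sq_less l by (intro mult_left_mono) auto
    also have "(1 - l) * \<eta> \<le> v'" unfolding v'_def using t7_pos l by simp
    finally have le: "x'^2 \<le> v'" .
    have "x'^2 \<noteq> v'"
    proof
      assume eq: "x'^2 = v'"
      have "(1 - l) * \<eta> \<le> v'" unfolding v'_def using t7_pos l by simp
      hence "(1 - l) * (\<eta> - vx^2) \<le> 0" using eq x'_le unfolding right_diff_distrib by linarith
      hence "1 - l \<le> 0" using vx_sq_less by (simp add: mult_le_0_iff)
      hence "l = 1" using l by linarith
      thus False using eq t7_pos by (simp add: v'_def x'_def)
    qed
    with le have lt: "x'^2 < v'" by simp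
    \<comment> \<open>\<open>u\<close> divides the side from \<open>tau3'\<close> to
      \<open>tau7\<close>, and \<open>w\<close> lies between \<open>tau3\<close> and
      \<open>u\<close>, so convexity is applied twice. The strict inequality above makes
      \<open>u\<close> a point of the upper half plane.\<close>
    define u where "u = Complex x' (sqrt (v' - x'^2))"
    have u: "Im u > 0" "Re u = x'" "(cmod u)^2 = v'" using lt by (simp_all add: u_def cmod_power2)
    have uC: "Some u \<in> C"
      by (rule geodesically_convex_combination[OF C(1) mem(2,3) l(1,2) u(1)])
        (simp_all only: u mods v'_def x'_def, simp)
    have a: "1 - (b + c) = a" using sum by simp
    have bcl: "(b + c) * l = c" "(b + c) * (1 - l) = b" using bc unfolding l(3) by (simp_all add: l_def)
    have "(b + c) * v' = ((b + c) * (1 - l)) * \<eta> + ((b + c) * l) * t7" "(b + c) * x' = ((b + c) * (1 - l)) * vx"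
      unfolding v'_def x'_def by (simp_all only: distrib_left mult.assoc)
    hence bv: "(b + c) * v' = b * \<eta> + c * t7" "(b + c) * x' = b * vx" unfolding bcl by simp_all
    show ?thesis
    proof (rule geodesically_convex_combination[OF C(1) mem(1) uC _ _ assms(1)])
      show "0 \<le> b + c" "b + c \<le> 1" using nn sum by linarith+
      show "(cmod w)^2 = (1 - (b + c)) * (cmod (Complex (- vx) vy))^2 + (b + c) * (cmod u)^2"
        unfolding a mods u bv using v unfolding v_x_k_e_def(1) by (simp add: algebra_simps)
      show "Re w = (1 - (b + c)) * Re (Complex (- vx) vy) + (b + c) * Re u"
        unfolding a u bv using x unfolding v_x_k_e_def(2,3) by (simp add: algebra_simps)
    qed
  qed
qed

section \<open>Transport of points and tiles by the group\<close>

lemma lft_upper_half_plane: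
  assumes "det M = 1" "Im w > 0" obtains w' where "lft M (Some w) = Some w'" "Im w' > 0"
proof -
  obtain a b c d where M: "M = mat2 a b c d" by (rule mat2_cases)
  have det: "a * d - b * c = 1" using assms by (simp add: M det_mat2)
  define m n where "m = of_real c * w + of_real d" and "n = of_real a * w + of_real b"
  have nz: "m \<noteq> 0"
  proof
    assume m: "m = 0"
    hence "Im m = 0" by simp
    hence "c = 0" using assms(2) by (simp add: m_def)
    thus False using m det by (simp add: m_def)
  qed
  have "Im (n / m) = Im (n * cnj m) / (cmod m)^2"
    by (metis Im_divide_of_real complex_div_cnj)
  also have "Im (n * cnj m) = (a * d - b * c) * Im w"
    by (simp add: n_def m_def algebra_simps)
  finally have "Im (n / m) > 0" using assms(2) nz det by simp
  moreover have "lft M (Some w) = Some (n / m)" using nz by (simp add: M m_def n_def moebius_def)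
  ultimately show ?thesis using that by blast
qed

lemma ev_inject:
  assumes "Im w > 0" "Im w' > 0" "\<And>f. is_qform f \<Longrightarrow> ev f (Some w) = \<kappa> * ev f (Some w')"
  shows "w = w'"
proof -
  have "\<kappa> = 1" using assms(3)[of "qform 0 0 1"] by (simp add: ev_qform del: ev.simps)
  moreover have "Re w = \<kappa> * Re w'" using assms(3)[of "qform 0 (1/2) 0"] by (simp add: ev_qform del: ev.simps)
  moreover have "(cmod w)^2 = \<kappa> * (cmod w')^2"
    using assms(3)[of "qform 1 0 0"] by (simp add: ev_qform del: ev.simps)
  ultimately show ?thesis using assms(1,2) by (intro upper_half_plane_eqI) auto
qed

lemma lft_matrix_inv:
  assumes "det M = 1" "Im w > 0"
  shows "lft M (lft (matrix_inv M) (Some w)) = Some w"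
proof -
  obtain w1 where w1: "lft (matrix_inv M) (Some w) = Some w1" "Im w1 > 0"
    using lft_upper_half_plane[OF det_matrix_inv[OF assms(1)] assms(2)] by blast
  obtain w2 where w2: "lft M (Some w1) = Some w2" "Im w2 > 0"
    using lft_upper_half_plane[OF assms(1) w1(2)] by blast
  obtain k where k: "k > 0"
    "\<And>f. is_qform f \<Longrightarrow> ev (\<lambda>v. f (matrix_inv M *v v)) (Some w) = k * ev f (Some w1)"
    using ev_lft[of "matrix_inv M" "Some w"] det_matrix_inv[OF assms(1)] w1(1) by auto
  obtain l where l: "l > 0" "\<And>f. is_qform f \<Longrightarrow> ev (\<lambda>v. f (M *v v)) (Some w1) = l * ev f (Some w2)"
    using ev_lft[of M "Some w1"] assms(1) w2(1) by auto
  have "ev f (Some w) = (k * l) * ev f (Some w2)" if "is_qform f" for f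
    using k(2)[OF is_qform_comp[OF that, of M]] l(2)[OF that]
    by (simp only: matrix_inv_cancel(1)[OF assms(1)] mult.assoc)
  hence "w = w2" by (intro ev_inject assms w2) auto
  thus ?thesis using w1 w2 by simp
qed

lemma tile_F_subset: "tile_F \<subseteq> heptagon_D"
proof
  fix z assume z: "z \<in> tile_F"
  have "lft (mat_pow g7 0) z = z" by (cases z) (simp_all add: mat_def moebius_def)
  thus "z \<in> heptagon_D" unfolding heptagon_D_def using z by (intro UN_I[of 0] image_eqI[of _ _ z]) auto
qed

lemma heptagon_D_contains:
  fixes n
  defines "G \<equiv> mat_pow g7 n"
  assumes "n \<le> 6" "Im w > 0" "ev (\<lambda>v. edge_form (matrix_inv G *v v)) (Some w) \<le> 0"
    "ev (\<lambda>v. left_form (matrix_inv G *v v)) (Some w) \<ge> 0" "ev (\<lambda>v. right_form (matrix_inv G *v v)) (Some w) \<ge> 0"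
  shows "Some w \<in> heptagon_D"
proof -
  have det: "det G = 1" unfolding G_def by (rule det_mat_pow[OF det_g7])
  obtain w1 where w1: "lft (matrix_inv G) (Some w) = Some w1" "Im w1 > 0"
    using lft_upper_half_plane[OF det_matrix_inv[OF det] assms(3)] by blast
  obtain k where k: "k > 0"
    "\<And>f. is_qform f \<Longrightarrow> ev (\<lambda>v. f (matrix_inv G *v v)) (Some w) = k * ev f (Some w1)"
    using ev_lft[of "matrix_inv G" "Some w"] det_matrix_inv[OF det] w1(1) by auto
  have q: "is_qform left_form" "is_qform right_form" by (simp_all add: left_form_def right_form_def)
  have "Some w1 \<in> tile_F"
    using assms(4-6) k(1) unfolding k(2)[OF is_qform_edge_form] k(2)[OF q(1)] k(2)[OF q(2)]
    by (intro tile_F_contains w1) (simp_all add: zero_le_mult_iff mult_le_0_iff del: ev.simps)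
  moreover have "lft G (Some w1) = Some w" using lft_matrix_inv[OF det assms(3)] w1(1) by simp
  ultimately show ?thesis unfolding heptagon_D_def G_def using assms(2) by force
qed

lemma matrix_inv_quat:
  assumes "det (quat a b c d) = 1" shows "matrix_inv (quat a b c d) = quat a (-b) (-c) (-d)"
  using assms unfolding quat_def det_mat2 by (subst matrix_inv_mat2) (auto simp: mat2_eq_iff algebra_simps)

text \<open>The tile and its image under the sixth power of \<open>g7\<close> share the side from
  \<open>tau3\<close> to \<open>tau7\<close> and lie on opposite sides of it, hence the
  sign.\<close>

lemma right_form_g7: "right_form (matrix_inv (mat_pow g7 6) *v v) = - left_form v"
proof -
  define a where "a = - (\<eta>^2 + \<eta> - 1) / 2"
  have G: "mat_pow g7 6 = quat a qb 0 qd" using g7_powers(6) by (simp add: a_def)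
  have det: "det (quat a qb 0 qd) = 1" using det_mat_pow[OF det_g7, of 6] by (simp add: G)
  define H K where "H = qb + qd * \<sigma>" "K = qd * \<sigma> - qb"
  have M: "matrix_inv (mat_pow g7 6) = mat2 a (\<eta> * K) (- H) a"
    unfolding G matrix_inv_quat[OF det] unfolding quat_def H_K_def mat2_eq_iff by (simp add: algebra_simps)
  have "det (mat2 a (\<eta> * K) (- H) a) = 1"
    using det_matrix_inv[OF det_mat_pow[OF det_g7, of 6]] unfolding M .
  hence 1: "a^2 + \<eta> * K * H = 1" by (simp add: det_mat2 power2_eq_square)
  \<comment> \<open>This turns the middle coefficients into multiples of \<open>vx * a\<close>; the
    rest follows from determinant 1 alone.\<close>
  have "(\<eta>^2 + \<eta> - 1) / 2 * vx = \<eta> * qb"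
    unfolding vx_def qb_def using eta_minpoly by algebra
  hence 2: "\<eta> * qb = - (vx * a)" by (simp add: a_def field_simps)
  have comp: "k * H * a^2 + 2 * (- (- (k * a))) * a * - H + - (k * e) * (- H)^2 = - (k * H)"
    "k * H * a * e + - (- (k * a)) * (a * a + e * - H) + - (k * e) * - H * a = k * a"
    "k * H * e^2 + 2 * (- (- (k * a))) * e * a + - (k * e) * a^2 = k * e"
    if "a^2 + e * H = 1" for k e a H :: real
    using that by algebra+
  have r: "right_form = qform (vx * H) (- (- (vx * a))) (- (vx * (\<eta> * K)))"
    "left_form = qform (vx * H) (- (vx * a)) (- (vx * (\<eta> * K)))"
    unfolding right_form_def left_form_def H_K_def[symmetric] 2[symmetric] by simp_all
  show ?thesis
    unfolding M r qform_comp comp[OF 1] by (simp add: qform_def algebra_simps)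
qed

text \<open>The point of the geodesic from \<open>b\<close> to \<open>a\<close> with parameter \<open>r\<close>; as lifts of the end points
  are kept, \<open>r\<close> is preserved by the action of the group.\<close>

definition geo_point :: "real^2 \<Rightarrow> real^2 \<Rightarrow> real \<Rightarrow> complex option \<Rightarrow> bool" where
  "geo_point b a r z \<longleftrightarrow> (\<exists>\<kappa>>0. \<forall>f. is_qform f \<longrightarrow> f b + r * f a = \<kappa> * ev f z)"

lemma geo_pointD:
  assumes "geo_point b a r z" "is_qform f"
  shows "f b + r * f a \<ge> 0 \<longleftrightarrow> ev f z \<ge> 0" "f b + r * f a > 0 \<longleftrightarrow> ev f z > 0"
    "f b + r * f a \<le> 0 \<longleftrightarrow> ev f z \<le> 0" "f b + r * f a < 0 \<longleftrightarrow> ev f z < 0"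
    "f b + r * f a = 0 \<longleftrightarrow> ev f z = 0"
proof -
  obtain k where "k > 0" "f b + r * f a = k * ev f z" using assms unfolding geo_point_def by blast
  thus "f b + r * f a \<ge> 0 \<longleftrightarrow> ev f z \<ge> 0" "f b + r * f a > 0 \<longleftrightarrow> ev f z > 0"
    "f b + r * f a \<le> 0 \<longleftrightarrow> ev f z \<le> 0" "f b + r * f a < 0 \<longleftrightarrow> ev f z < 0"
    "f b + r * f a = 0 \<longleftrightarrow> ev f z = 0"
    by (simp_all add: zero_le_mult_iff zero_less_mult_iff mult_le_0_iff mult_less_0_iff)
qed

lemma geo_point_lft_inv:
  assumes "geo_point b a r (lft M z)" "det M = 1"
  shows "geo_point (matrix_inv M *v b) (matrix_inv M *v a) r z"
proof -
  obtain k where k: "k > 0" "\<And>f. is_qform f \<Longrightarrow> f b + r * f a = k * ev f (lft M z)"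
    using assms unfolding geo_point_def by blast
  obtain l where l: "l > 0" "\<And>f. is_qform f \<Longrightarrow> ev (\<lambda>v. f (M *v v)) z = l * ev f (lft M z)"
    using ev_lft[of M z] assms(2) by auto
  have "f (matrix_inv M *v b) + r * f (matrix_inv M *v a) = (k / l) * ev f z" if "is_qform f" for f
  proof -
    have q: "is_qform (\<lambda>v. f (matrix_inv M *v v))" using that by (rule is_qform_comp)
    have "ev f z = l * ev (\<lambda>v. f (matrix_inv M *v v)) (lft M z)"
      using l(2)[OF q] by (simp only: matrix_inv_cancel(2)[OF assms(2)])
    thus ?thesis using k(2)[OF q] l(1) by simp
  qed
  thus ?thesis unfolding geo_point_def using k(1) l(1) by (intro exI[of _ "k / l"]) auto
qed

lemma positive_beyond:
  fixes p q p' q' r :: real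
  assumes "p + r * q > 0" "p' + r * q' > 0"
  obtains s where "s > r" "p + s * q > 0" "p' + s * q' > 0"
proof -
  have "\<forall>\<^sub>F s in at_right r. p + s * q > 0" "\<forall>\<^sub>F s in at_right r. p' + s * q' > 0"
    by (rule order_tendstoD(1)[OF _ assms(1)], intro tendsto_intros,
        rule order_tendstoD(1)[OF _ assms(2)], intro tendsto_intros)
  moreover have "\<forall>\<^sub>F s in at_right r. s > r" by (rule eventually_at_right_less)
  ultimately have "\<forall>\<^sub>F s in at_right r. s > r \<and> p + s * q > 0 \<and> p' + s * q' > 0"
    by (simp add: eventually_conj_iff)
  thus ?thesis using that eventually_happens[of _ "at_right r"] by fastforce
qed

text \<open>A geodesic which passes through the vertex \<open>\<tau>\<^sub>3\<close>, and then or later through \<open>e\<^sub>6'\<close>, without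
  crossing the line of \<open>e\<^sub>6\<close>, continues inside one of the two tiles \<open>\<F>\<close>, \<open>g\<^sub>7\<^sup>6\<F>\<close> that meet at
  \<open>\<tau>\<^sub>3\<close>.\<close>

lemma continues_in_heptagon:
  fixes a b :: "real^2"
  defines "f6 \<equiv> \<lambda>v. edge_form (matrix_inv (mat_pow g7 6) *v v)"
  assumes P: "geo_point b a r tau3" and Q: "geo_point b a s (lft (mat_pow g7 6) (Some u))"
    and u: "(cmod u)^2 = \<eta>" "- vx < Re u" "Re u \<le> vx"
    and rs: "0 < r" "r \<le> s" and a: "edge_form a < 0" "f6 a \<le> 0"
  obtains t where "t > s" "\<And>w. geo_point b a t (Some w) \<Longrightarrow> Im w > 0 \<Longrightarrow> Some w \<in> heptagon_D"
proof -
  define G where "G = mat_pow g7 6"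
  have det: "det G = 1" unfolding G_def by (rule det_mat_pow[OF det_g7])
  define R where "R = (\<lambda>v. right_form (matrix_inv G *v v))"
  define L where "L = (\<lambda>v. left_form (matrix_inv G *v v))"
  have R: "R v = - left_form v" for v unfolding R_def G_def by (rule right_form_g7)
  have q: "is_qform left_form" "is_qform right_form" by (simp_all add: left_form_def right_form_def)
  have qs: "is_qform f6" "is_qform L" "is_qform R" unfolding f6_def L_def R_def using q
    by (auto intro: is_qform_comp)
  have H: "qb + qd * \<sigma> > 0" using qb_pos qb_less by simp
  have Q': "geo_point (matrix_inv G *v b) (matrix_inv G *v a) s (Some u)"
    using Q[folded G_def] det by (rule geo_point_lft_inv)
  have Lu: "ev left_form (Some u) > 0"
  proof -
    have "ev left_form (Some u) = (qb + qd * \<sigma>) * ((\<eta> - t7) * (vx + Re u))"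
      unfolding ev_side_forms u(1) by (simp add: algebra_simps)
    thus ?thesis using H t7_less u(2) by simp
  qed
  have m3: "(cmod (Complex (- vx) vy))^2 = \<eta>" by (simp add: cmod_power2 vy_sq)
  have Ls: "L b + s * L a > 0"
    using geo_pointD(2)[OF Q' q(1)] Lu unfolding L_def by simp
  have Rs: "R b + s * R a \<ge> 0"
  proof -
    have "ev right_form (Some u) = (qb + qd * \<sigma>) * ((\<eta> - t7) * (vx - Re u))"
      unfolding ev_side_forms u(1) by (simp add: algebra_simps)
    hence "ev right_form (Some u) \<ge> 0" using H t7_less u(3) by simp
    thus ?thesis using geo_pointD(1)[OF Q' q(2)] unfolding R_def by simp
  qed
  have f6s: "f6 b + s * f6 a = 0"
    using geo_pointD(5)[OF Q' is_qform_edge_form] u(1)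
    unfolding f6_def G_def edge_form_def ev_qform by simp
  have f6t: "f6 b + t * f6 a \<le> 0" if "t > s" for t
    using f6s a(2) mult_right_mono_neg[of s t "f6 a"] that by simp
  have e0: "edge_form b + r * edge_form a = 0"
    using geo_pointD(5)[OF P is_qform_edge_form] m3
    unfolding tau3_eq edge_form_def ev_qform by simp
  have et: "edge_form b + t * edge_form a \<le> 0" if "t > s" for t
  proof -
    have "t * edge_form a \<le> r * edge_form a" using a(1) that rs by (intro mult_right_mono_neg) auto
    thus ?thesis using e0 by simp
  qed
  have Lr: "left_form b + r * left_form a = 0" and Rr: "right_form b + r * right_form a > 0"
  proof -
    have "ev left_form tau3 = 0" "ev right_form tau3 = (qb + qd * \<sigma>) * (2 * vx * (\<eta> - t7))"
      unfolding tau3_eq ev_side_forms m3 by (simp_all add: algebra_simps)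
    moreover from this(2) have "ev right_form tau3 > 0" using H t7_less vx_bounds by simp
    ultimately show "left_form b + r * left_form a = 0" "right_form b + r * right_form a > 0"
      using geo_pointD(5)[OF P q(1)] geo_pointD(2)[OF P q(2)] by simp_all
  qed
  have G6: "Some w \<in> heptagon_D" if "geo_point b a t (Some w)" "Im w > 0" "t > s" "L b + t * L a > 0" "R b + t * R a \<ge> 0" for t w
    using that geo_pointD(3)[OF that(1) qs(1)] f6t[OF that(3)] geo_pointD(2)[OF that(1) qs(2)]
      geo_pointD(1)[OF that(1) qs(3)]
    by (intro heptagon_D_contains[of 6]) (simp_all add: f6_def L_def R_def G_def del: ev.simps)
  show ?thesis
  proof (cases "r = s")
    case True
    \<comment> \<open>The exit point is \<open>tau3\<close> itself. Just beyond it the outer sides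
      of both tiles are still respected, and the sign of \<open>left_form\<close> decides which tile
      contains the point.\<close>
    obtain t where t: "t > s" "L b + t * L a > 0" "right_form b + t * right_form a > 0"
      using positive_beyond[OF Ls Rr[unfolded True]] by blast
    show ?thesis
    proof (rule that[OF t(1)])
      fix w assume w: "geo_point b a t (Some w)" "Im w > 0"
      show "Some w \<in> heptagon_D"
      proof (cases "R b + t * R a \<ge> 0")
        case True thus ?thesis using G6 w t by blast
      next
        case False
        hence "left_form b + t * left_form a \<ge> 0" unfolding R by simp
        hence "Some w \<in> tile_F"
          using w(2) geo_pointD(1)[OF w(1) q(1)] geo_pointD(1)[OF w(1) q(2)]
            geo_pointD(3)[OF w(1) is_qform_edge_form] t et[OF t(1)]
          by (intro tile_F_contains) auto
        thus ?thesis using tile_F_subset by blast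
      qed
    qed
  next
    case False
    hence "r < s" using rs by simp
    \<comment> \<open>\<open>left_form\<close> is 0 at r and nonpositive at s > r, so it stays
      nonpositive and the geodesic continues in the rotated tile.\<close>
    have "left_form b + s * left_form a \<le> 0" using Rs unfolding R by simp
    hence "(s - r) * left_form a \<le> 0" using Lr by (simp add: algebra_simps)
    hence la: "left_form a \<le> 0" using \<open>r < s\<close> by (simp add: mult_le_0_iff)
    obtain t where t: "t > s" "L b + t * L a > 0" using positive_beyond[OF Ls Ls] by blast
    have "R b + t * R a \<ge> 0"
      using Lr mult_right_mono_neg[OF _ la, of r t] t rs unfolding R by simp
    thus ?thesis using that[OF t(1)] G6 t by blast
  qed
qed

section \<open>One step of the algorithm\<close>

text \<open>On the circle |u|^2 = \<eta> the terms with U cancel and a linear function of Re u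
  remains. Passing to the inverse changes the signs of b and d.\<close>

lemma ev_rotated_edge_form:
  assumes "det (quat a b 0 d) = 1" "(cmod u)^2 = \<eta>"
  shows "ev (\<lambda>v. edge_form (matrix_inv (quat a b 0 d) *v v)) (Some u) = 4 * \<eta> * \<sigma> * d * (a * Re u - \<eta> * b)"
    "ev (\<lambda>v. edge_form (quat a b 0 d *v v)) (Some u) = - 4 * \<eta> * \<sigma> * d * (a * Re u + \<eta> * b)"
proof -
  have *: "ev (\<lambda>v. edge_form (matrix_inv (quat a b 0 d) *v v)) (Some u) = 4 * \<eta> * \<sigma> * d * (a * Re u - \<eta> * b)"
    if "det (quat a b 0 d) = 1" for b d
    unfolding edge_form_quat(1)[OF that] ev_qform assms(2) by (simp add: algebra_simps)
  show "ev (\<lambda>v. edge_form (matrix_inv (quat a b 0 d) *v v)) (Some u) = 4 * \<eta> * \<sigma> * d * (a * Re u - \<eta> * b)"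
    using assms(1) by (rule *)
  have det: "det (quat a (-b) 0 (-d)) = 1" using assms(1) by (simp add: det_quat)
  show "ev (\<lambda>v. edge_form (quat a b 0 d *v v)) (Some u) = - 4 * \<eta> * \<sigma> * d * (a * Re u + \<eta> * b)"
    using *[OF det] unfolding matrix_inv_quat[OF det] by (simp add: algebra_simps)
qed

text \<open>\<open>g2\<close> is the half-turn mapping z to -\<eta>/z, around a point of the edge
  line, so it exchanges the two sides of this line.\<close>

lemma edge_form_g2: "edge_form (matrix_inv g2 *v v) = - edge_form v"
proof -
  obtain x y where v: "v = vec2 x y" by (rule vec2_cases)
  have "matrix_inv g2 = mat2 0 \<sigma> (- 1 / \<sigma>) 0"
    unfolding g2_def using sqrt_eta_pos by (subst matrix_inv_mat2) (auto simp: field_simps)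
  thus ?thesis using sqrt_eta_sq eta_gt_1
    by (simp add: v mat2_vec2 edge_form_def qform_def power_divide power_mult_distrib)
qed

text \<open>The exit point, rotated back to the edge with index 0 and moved by the half-turn, is the
  new entry point. The work lies in showing that the parameter does not decrease and that the
  geodesic really crosses the exit line.\<close>

lemma reduced_step:
  assumes ends: "\<beta> \<noteq> \<alpha>" "rep_of b \<beta>" "rep_of a \<alpha>"
    and P: "geo_point b a r (Some w)" "(cmod w)^2 = \<eta>" "Im w > 0" "- vx \<le> Re w" "Re w < vx"
    and r: "r > 0" and a: "edge_form a < 0" and n: "n \<in> {1..6}" and leaves: "leaves_from \<beta> \<alpha> n"
  defines "A \<equiv> matrix_inv (step_matrix n)"
  obtains s w' where "s \<ge> r" "s = r \<Longrightarrow> n = 6" "geo_point (A *v b) (A *v a) s (Some w')"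
    "(cmod w')^2 = \<eta>" "Im w' > 0" "- vx \<le> Re w'" "Re w' < vx" "edge_form (A *v a) < 0"
proof -
  define G where "G = mat_pow g7 n"
  have det: "det G = 1" unfolding G_def by (rule det_mat_pow[OF det_g7])
  obtain c S where cS: "G = quat c (S * qb) 0 (S * qd)" "S > 0" "\<bar>c\<bar> * vx \<le> \<eta> * S * qb"
    "\<bar>c\<bar> * vx = \<eta> * S * qb \<Longrightarrow> n = 1 \<and> c > 0 \<or> n = 6 \<and> c < 0"
    unfolding G_def using g7_power_cases[OF n] by blast
  note detq = det[unfolded cS(1)]
  obtain C where C: "C > 0" "\<And>t. \<exists>w>0. \<forall>f. is_qform f \<longrightarrow>
     ev f (geodesic \<beta> \<alpha> t) = w * (f b + C * exp (2 * t) * f a)" using ev_geodesic[OF ends] by blast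
  have geo: "geo_point b a (C * exp (2 * t)) (geodesic \<beta> \<alpha> t)" for t
  proof -
    obtain w where "w > 0" "\<forall>f. is_qform f \<longrightarrow> ev f (geodesic \<beta> \<alpha> t) = w * (f b + C * exp (2 * t) * f a)"
      using C(2) by blast
    thus ?thesis unfolding geo_point_def by (intro exI[of _ "1 / w"]) auto
  qed
  obtain t where t: "geodesic \<beta> \<alpha> t \<in> edge' n" "\<forall>s>t. geodesic \<beta> \<alpha> s \<notin> heptagon_D"
    using leaves unfolding leaves_from_def leaves_at_def by blast
  define s where "s = C * exp (2 * t)"
  obtain u where u: "geodesic \<beta> \<alpha> t = lft G (Some u)" "Im u > 0" "(cmod u)^2 = \<eta>" "- vx < Re u" "Re u \<le> vx"
    using edge'E[OF t(1)] unfolding G_def by metis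
  have Q: "geo_point b a s (lft G (Some u))" using geo[of t] by (simp add: s_def u(1))
  have Q': "geo_point (matrix_inv G *v b) (matrix_inv G *v a) s (Some u)"
    using Q det by (rule geo_point_lft_inv)
  define fn where "fn = (\<lambda>v. edge_form (matrix_inv G *v v))"
  have qfn: "is_qform fn" unfolding fn_def by (rule is_qform_comp) simp
  have coef: "4 * \<eta> * \<sigma> * (S * qd) > 0" using eta_gt_1 cS(2) qd_pos by simp
  have zero: "y = 0" if "x > 0" "x * y = 0" for x y :: real using that by simp
  have abs_le: "\<bar>c * x\<bar> \<le> \<bar>c\<bar> * vx" if "- vx \<le> x" "x \<le> vx" for x
    unfolding abs_mult using that by (intro mult_left_mono) auto
  have "edge_form b + r * edge_form a = 0"
    using geo_pointD(5)[OF P(1) is_qform_edge_form] P(2) by (simp add: edge_form_def ev_qform del: ev.simps)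
  \<comment> \<open>The exit point lies on the nonpositive side of the entry line, which the
    geodesic reaches only from the parameter r on.\<close>
  moreover have es: "edge_form b + s * edge_form a \<le> 0" and es0: "edge_form b + s * edge_form a = 0 \<Longrightarrow> n = 6"
  proof -
    obtain k where k: "k > 0" "\<And>f. is_qform f \<Longrightarrow> ev (\<lambda>v. f (G *v v)) (Some u) = k * ev f (lft G (Some u))"
      using ev_lft[of G "Some u"] det by auto
    have e: "k * ev edge_form (lft G (Some u)) = - (4 * \<eta> * \<sigma> * (S * qd)) * (c * Re u + \<eta> * (S * qb))"
      using k(2)[OF is_qform_edge_form] ev_rotated_edge_form(2)[OF detq u(3)] by (simp add: cS(1))
    have nn: "c * Re u + \<eta> * (S * qb) \<ge> 0" using abs_le[of "Re u"] u cS(3) by simp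
    hence "k * ev edge_form (lft G (Some u)) \<le> 0" unfolding e using coef by (simp add: mult_le_0_iff)
    thus "edge_form b + s * edge_form a \<le> 0"
      using k(1) geo_pointD(3)[OF Q is_qform_edge_form] by (simp add: mult_le_0_iff)
    assume "edge_form b + s * edge_form a = 0"
    hence "ev edge_form (lft G (Some u)) = 0" using geo_pointD(5)[OF Q is_qform_edge_form] by simp
    hence "(4 * \<eta> * \<sigma> * (S * qd)) * (c * Re u + \<eta> * (S * qb)) = 0"
      using e by (metis mult_minus_left mult_zero_right neg_equal_0_iff_equal)
    hence "c * Re u + \<eta> * (S * qb) = 0" by (rule zero[OF coef])
    hence z: "c * Re u = - (\<eta> * S * qb)" by simp
    hence eq: "\<bar>c\<bar> * vx = \<eta> * S * qb" using abs_le[of "Re u"] u cS(3) by linarith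
    \<comment> \<open>Equality for the neighbour n = 1 would force Re u = - \<open>vx\<close>, the
      end that is missing from \<open>edge'\<close>.\<close>
    have "\<not> c > 0"
    proof
      assume "c > 0"
      hence "c * Re u > c * (- vx)" using u(4) by (intro mult_strict_left_mono)
      thus False using eq z \<open>c > 0\<close> by simp
    qed
    thus "n = 6" using cS(4)[OF eq] by blast
  qed
  ultimately have "(s - r) * edge_form a \<le> 0" by (simp add: algebra_simps)
  hence rs: "r \<le> s" using a by (simp add: mult_le_0_iff)
  have n6: "n = 6" if "s = r" using es0 \<open>edge_form b + r * edge_form a = 0\<close> that by simp

  have fs: "fn b + s * fn a = 0"
    using geo_pointD(5)[OF Q' is_qform_edge_form] u(3)
    by (simp add: fn_def edge_form_def ev_qform del: ev.simps)
  have evP: "ev fn (Some w) = 4 * \<eta> * \<sigma> * (S * qd) * (c * Re w - \<eta> * (S * qb))"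
    unfolding fn_def cS(1) by (rule ev_rotated_edge_form(1)[OF detq P(2)])
  have "c * Re w - \<eta> * (S * qb) \<le> 0" using abs_le[of "Re w"] P cS(3) by simp
  hence "ev fn (Some w) \<le> 0" unfolding evP using coef by (simp add: mult_le_0_iff)
  hence fr: "fn b + r * fn a \<le> 0" using geo_pointD(3)[OF P(1) qfn] by simp
  have fr0: "n = 6 \<and> Re w = - vx" if "fn b + r * fn a = 0"
  proof -
    have "ev fn (Some w) = 0" using that geo_pointD(5)[OF P(1) qfn] by simp
    hence "c * Re w - \<eta> * (S * qb) = 0" unfolding evP by (rule zero[OF coef])
    hence z: "c * Re w = \<eta> * S * qb" by simp
    hence eq: "\<bar>c\<bar> * vx = \<eta> * S * qb" using abs_le[of "Re w"] P cS(3) by linarith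
    \<comment> \<open>Here n = 1 would force Re w = \<open>vx\<close>, the end that is missing from
      \<open>edge\<close>.\<close>
    have "\<not> c > 0"
    proof
      assume "c > 0"
      hence "c * Re w < c * vx" using P(5) by (intro mult_strict_left_mono)
      thus False using eq z \<open>c > 0\<close> by simp
    qed
    hence c: "n = 6" "c < 0" using cS(4)[OF eq] by blast+
    hence "c * Re w = c * (- vx)" using eq z by simp
    hence "Re w = - vx" using c(2) by (simp only: mult_left_cancel)
    thus ?thesis using c by simp
  qed

  \<comment> \<open>Otherwise the values of \<open>fn\<close> do not increase from entry to exit, so
    they vanish at both. Then n = 6 and the entry point is \<open>tau3\<close>, and the geodesic
    would meet the heptagon again after its last point there.\<close>
  have fna: "fn a > 0"
  proof (rule ccontr)
    assume "\<not> ?thesis"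
    hence fna: "fn a \<le> 0" by simp
    have "fn b + r * fn a = 0"
    proof -
      have "s * fn a \<le> r * fn a" using rs fna by (intro mult_right_mono_neg) auto
      thus ?thesis using fr fs by linarith
    qed
    hence n: "n = 6" "Re w = - vx" using fr0 by auto
    hence "w = Complex (- vx) vy" using P vy_pos
      by (intro upper_half_plane_eqI) (auto simp: cmod_power2 vy_sq)
    hence "geo_point b a r tau3" using P(1) tau3_eq by simp
    from continues_in_heptagon[OF this Q[unfolded G_def n] u(3,4,5) r rs a]
    obtain t' where t': "t' > s" "\<And>w. geo_point b a t' (Some w) \<Longrightarrow> Im w > 0 \<Longrightarrow> Some w \<in> heptagon_D"
      using fna unfolding fn_def G_def n by metis
    have "s > 0" using C(1) by (simp add: s_def)
    define q where "q = ln (t' / C) / 2"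
    have e: "C * exp (2 * q) = t'" using C(1) t'(1) \<open>s > 0\<close> by (simp add: q_def)
    hence "C * exp (2 * t) < C * exp (2 * q)" using t'(1) by (simp add: s_def)
    hence "t < q" using C(1) by simp
    obtain z where "geodesic \<beta> \<alpha> q = Some z" "Im z > 0" using geodesic_cases[OF ends(1)] by metis
    hence "geodesic \<beta> \<alpha> q \<in> heptagon_D" using t'(2)[of z] geo[of q] e by simp
    thus False using t(2) \<open>t < q\<close> by blast
  qed

  have A: "A *v v = matrix_inv g2 *v (matrix_inv G *v v)" for v
    unfolding A_def step_matrix_def G_def[symmetric] by (rule matrix_inv_mult[OF det det_g2])
  \<comment> \<open>On this circle \<open>g2\<close> is the reflection in the imaginary axis. It
    turns the half-open condition at \<open>tau3\<close> into the one at
    \<open>tau3'\<close>.\<close>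
  have m: "(cmod (- cnj u))^2 = \<eta>" using u(3) by simp
  have "geo_point (A *v b) (A *v a) s (Some (- cnj u))"
    unfolding A using geo_point_lft_inv[OF _ det_g2, of _ _ s "Some (- cnj u)"] Q' lft_g2[OF m] by simp
  moreover have "edge_form (A *v a) < 0" unfolding A edge_form_g2 using fna by (simp add: fn_def)
  ultimately show ?thesis using that[of s "- cnj u"] rs n6 m u by simp
qed

section \<open>Convergence in \<open>\<P>\<^sup>1(\<complex>)\<close>\<close>

text \<open>For the end points \<alpha> and \<beta> the quotient of the two forms is the square of
  |z - \<alpha>| / |z - \<beta>|, a measure of closeness to \<alpha> that also makes sense at
  infinity.\<close>

definition det_form :: "real^2 \<Rightarrow> real^2 \<Rightarrow> real" where
  "det_form c v = (c$1 * v$2 - c$2 * v$1)^2"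

lemma ev_det_form_rep:
  "ev (det_form (rep None)) None = 0" "ev (det_form (rep None)) (Some z) = 1"
  "ev (det_form (rep (Some x))) None = 1" "ev (det_form (rep (Some x))) (Some z) = (cmod (z - of_real x))^2"
  by (simp_all add: det_form_def cmod_power2 power2_commute)

lemma limitin_P1C_Some:
  assumes "\<And>e. e > 0 \<Longrightarrow> eventually (\<lambda>n. \<exists>w. z n = Some w \<and> cmod (w - a) < e) sequentially"
  shows "limitin P1C z (Some a) sequentially"
  unfolding limitin_def
proof (intro conjI allI impI)
  show "Some a \<in> topspace P1C" by (simp add: P1C_def)
  fix U assume U: "openin P1C U \<and> Some a \<in> U"
  hence "open {x. Some x \<in> U}"
    unfolding P1C_def openin_Alexandroff_compactification
    by (auto simp: inj_image_mem_iff Compl_eq[symmetric])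
  then obtain e where e: "e > 0" "ball a e \<subseteq> {x. Some x \<in> U}"
    using U by (meson mem_Collect_eq open_contains_ball)
  show "eventually (\<lambda>n. z n \<in> U) sequentially"
    using assms[OF e(1)] by eventually_elim (use e(2) in \<open>auto simp: dist_norm norm_minus_commute subset_iff\<close>)
qed

lemma limitin_P1C_None:
  assumes "\<And>K. eventually (\<lambda>n. \<forall>w. z n = Some w \<longrightarrow> cmod w > K) sequentially"
  shows "limitin P1C z None sequentially"
  unfolding limitin_def
proof (intro conjI allI impI)
  show "None \<in> topspace P1C" by (simp add: P1C_def)
  fix U assume U: "openin P1C U \<and> None \<in> U"
  then obtain C where C: "compact C" "U = insert None (Some ` (UNIV - C))"
    unfolding P1C_def openin_Alexandroff_compactification by auto
  obtain K where K: "\<And>x. x \<in> C \<Longrightarrow> cmod x \<le> K"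
    using compact_imp_bounded[OF C(1)] unfolding bounded_iff by blast
  show "eventually (\<lambda>n. z n \<in> U) sequentially"
    using assms[of K]
  proof eventually_elim
    case (elim n)
    thus ?case using K unfolding C(2) by (cases "z n") force+
  qed
qed

lemma limitin_P1C_of_det_forms:
  assumes ne: "\<beta> \<noteq> \<alpha>"
    and small: "\<And>e. e > 0 \<Longrightarrow> eventually (\<lambda>n. ev (det_form (rep \<alpha>)) (z n) \<le> e * ev (det_form (rep \<beta>)) (z n)) sequentially"
  shows "limitin P1C z (P1R_to_P1C \<alpha>) sequentially"
proof (cases \<alpha>)
  case None
  then obtain b where b: "\<beta> = Some b" using ne by (cases \<beta>) auto
  have "eventually (\<lambda>n. \<forall>w. z n = Some w \<longrightarrow> cmod w > K) sequentially" for K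
  proof -
    \<comment> \<open>With this choice |w - b| is at least L + 1, hence |w| exceeds K.\<close>
    define L where "L = \<bar>K\<bar> + \<bar>b\<bar> + 1"
    have "L > 0" by (simp add: L_def)
    hence "1 / (L + 1)^2 > 0" by simp
    from small[OF this] show ?thesis
    proof eventually_elim
      case (elim n)
      show ?case
      proof (intro allI impI)
        fix w assume w: "z n = Some w"
        have "1 \<le> 1 / (L + 1)^2 * (cmod (w - of_real b))^2"
          using elim unfolding w b None ev_det_form_rep .
        hence "(L + 1)^2 \<le> (cmod (w - of_real b))^2" using \<open>L > 0\<close> by (simp add: field_simps)
        hence "L + 1 \<le> cmod (w - of_real b)" by (rule power2_le_imp_le) simp
        also have "\<dots> \<le> cmod w + \<bar>b\<bar>" using norm_triangle_ineq4[of w "of_real b"] by simp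
        finally show "cmod w > K" by (simp add: L_def)
      qed
    qed
  qed
  thus ?thesis using limitin_P1C_None None by simp
next
  case (Some a)
  have "eventually (\<lambda>n. \<exists>w. z n = Some w \<and> cmod (w - of_real a) < e) sequentially" if "e > 0" for e
  proof (cases \<beta>)
    case None
    define d where "d = min (e / 2) (1 / 2)"
    have d: "d > 0" "d < e" "d < 1" using that by (auto simp: d_def min_def)
    have "eventually (\<lambda>n. ev (det_form (rep \<alpha>)) (z n) \<le> d^2 * ev (det_form (rep \<beta>)) (z n)) sequentially"
      using d by (intro small) simp
    thus ?thesis
    proof eventually_elim
      case (elim n)
      show ?case
      proof (cases "z n")
        case (Some w)
        have "(cmod (w - of_real a))^2 \<le> d^2"
          using elim unfolding \<open>\<alpha> = _\<close> \<open>z n = _\<close> None ev_det_form_rep by simp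
        hence "cmod (w - of_real a) \<le> d" by (rule power2_le_imp_le) (use d in simp)
        thus ?thesis using Some d by auto
      next
        case z: None
        show ?thesis using elim unfolding \<open>\<alpha> = _\<close> z None ev_det_form_rep by simp
      qed
    qed
  next
    case b: (Some b)
    have ab: "\<bar>a - b\<bar> > 0" using ne b Some by simp
    \<comment> \<open>As d is at most 1/2, the triangle inequality lets d|w - a| be absorbed,
      leaving |w - a| at most e/2.\<close>
    define d where "d = min (1 / 2) (e / (4 * \<bar>a - b\<bar>))"
    have d: "d > 0" "d \<le> 1 / 2" "d \<le> e / (4 * \<bar>a - b\<bar>)" using that ab by (auto simp: d_def)
    have de: "d * \<bar>a - b\<bar> \<le> e / 4" using d(3) ab by (simp add: field_simps)
    have "eventually (\<lambda>n. ev (det_form (rep \<alpha>)) (z n) \<le> d^2 * ev (det_form (rep \<beta>)) (z n)) sequentially"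
      using d by (intro small) simp
    thus ?thesis
    proof eventually_elim
      case (elim n)
      show ?case
      proof (cases "z n")
        case (Some w)
        have "(cmod (w - of_real a))^2 \<le> (d * cmod (w - of_real b))^2"
          using elim unfolding \<open>\<alpha> = _\<close> \<open>z n = _\<close> b ev_det_form_rep by (simp add: power_mult_distrib)
        hence "cmod (w - of_real a) \<le> d * cmod (w - of_real b)"
          by (rule power2_le_imp_le) (use d in simp)
        also have "cmod (w - of_real b) \<le> cmod (w - of_real a) + \<bar>a - b\<bar>"
          using norm_triangle_ineq[of "w - of_real a" "of_real (a - b)"] by (simp only: norm_of_real) simp
        hence "d * cmod (w - of_real b) \<le> d * cmod (w - of_real a) + d * \<bar>a - b\<bar>"
          using d(1) by (simp flip: distrib_left)
        also have "d * cmod (w - of_real a) \<le> 1 / 2 * cmod (w - of_real a)"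
          using d(2) by (intro mult_right_mono) auto
        finally have "cmod (w - of_real a) < e" using de that by simp
        thus ?thesis using Some by auto
      next
        case z: None
        \<comment> \<open>At infinity both forms are 1, which is incompatible with a factor of at
          most 1/4.\<close>
        have "d * d \<le> 1 / 2 * (1 / 2)" using d by (intro mult_mono) auto
        moreover have "1 \<le> d * d" using elim unfolding \<open>\<alpha> = _\<close> z b ev_det_form_rep by (simp add: power2_eq_square)
        ultimately show ?thesis by simp
      qed
    qed
  qed
  thus ?thesis using limitin_P1C_Some Some by simp
qed

section \<open>The sequence of edge forms\<close>

text \<open>\<open>step_matrix 6\<close> has trace -1, hence order 3. In the coordinates (U, V, W)
  of \<open>edge_form_quat\<close> the three forms are (1, 0, 0), (-1/2, -qb, -d) and (-1/2, qb,
  d).\<close>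

lemma edge_form_rotation_sum:
  defines "N \<equiv> matrix_inv (step_matrix 6)"
  shows "edge_form v + edge_form (N *v v) + edge_form (N *v (N *v v)) = 0"
proof -
  define a where "a = - (\<eta>^2 + \<eta> - 1) / 2"
  have G: "mat_pow g7 6 = quat a qb 0 qd" using g7_powers(6) by (simp add: a_def)
  have "det (quat a qb 0 qd) = 1" using det_mat_pow[OF det_g7, of 6] by (simp add: G)
  hence 1: "a^2 - \<eta> * qb^2 + \<eta>^2 * qd^2 = 1" by (simp add: det_quat)
  have 2: "\<eta> * qd = 1 / 2" unfolding qd_def using eta_inverse eta_gt_1 by (simp add: field_simps)
  have "\<eta>^2 * qd^2 = (\<eta> * qd)^2" by (simp add: power_mult_distrib)
  hence 3: "a^2 - \<eta> * qb^2 = 3 / 4" using 1 unfolding 2 by (simp add: power2_eq_square)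
  define d where "d = 2 * a * qd"
  have "\<eta>^2 * d^2 = (2 * (\<eta> * qd) * a)^2" unfolding d_def by algebra
  hence 4: "\<eta>^2 * d^2 = a^2" unfolding 2 by simp
  have g2q: "g2 = quat 0 0 0 (2 * qd)" unfolding g2_quat qd_def by (intro quat_cong) (simp_all add: field_simps)
  have "\<eta>^2 * qd * (2 * qd) = 2 * (\<eta> * qd) * (\<eta> * qd)" "\<eta> * qb * (2 * qd) = 2 * (\<eta> * qd) * qb" by algebra+
  hence R: "step_matrix 6 = quat (- 1 / 2) 0 qb d"
    unfolding step_matrix_def G g2q quat_mult 2 by (intro quat_cong) (simp_all add: d_def)
  have "(- 1 / 2) * (- 1 / 2) + \<eta> * qb * qb - \<eta>^2 * d * d = - 1 / 2"
    using 3 4 by (simp add: power2_eq_square)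
  hence RR: "step_matrix 6 ** step_matrix 6 = quat (- 1 / 2) 0 (- qb) (- d)"
    unfolding R quat_mult by (intro quat_cong) simp_all
  have U: "(- 1 / 2)^2 + \<eta> * qb^2 - \<eta> * 0^2 - \<eta>^2 * d^2 = - 1 / 2" using 3 4 by (simp add: power2_eq_square)
  note q1 = edge_form_quat(1)[OF det_step_matrix[of 6, unfolded R], unfolded U, of v]
  have "det (step_matrix 6 ** step_matrix 6) = 1" by (simp add: det_mul det_step_matrix)
  note q2 = edge_form_quat(1)[OF this[unfolded RR], unfolded power2_minus U, of v]
  have "N *v (N *v v) = matrix_inv (quat (- 1 / 2) 0 (- qb) (- d)) *v v"
    unfolding N_def RR[symmetric] by (rule matrix_inv_mult[OF det_step_matrix det_step_matrix, symmetric])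
  thus ?thesis using q1 q2 unfolding N_def R
    by (simp add: edge_form_def qform_def algebra_simps)
qed

lemma edge_form_orbit:
  assumes "det M = 1"
  obtains A B D where "(\<lambda>v. edge_form (matrix_inv M *v v)) = qform A B D" "B^2 - A * D = \<eta>"
proof -
  obtain a b c d where M: "M = mat2 a b c d" by (rule mat2_cases)
  have det: "a * d - b * c = 1" using assms by (simp add: M det_mat2)
  have "edge_form (matrix_inv M *v v) = qform (d^2 - \<eta> * c^2) (- d * b + \<eta> * a * c) (b^2 - \<eta> * a^2) v" for v
    unfolding M matrix_inv_mat2[OF det] edge_form_def qform_comp by (simp add: qform_eq_iff algebra_simps)
  moreover have "(- d * b + \<eta> * a * c)^2 - (d^2 - \<eta> * c^2) * (b^2 - \<eta> * a^2) = \<eta>"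
    using det by algebra
  ultimately show ?thesis using that by blast
qed

lemma det_form_nonneg: "ev (det_form c) z \<ge> 0"
  by (cases z) (simp_all add: det_form_def)

text \<open>If the form takes the values \<open>-p < 0 < q\<close> at \<open>a\<close> and \<open>b\<close>, then \<open>pq\<close> is bounded in terms of the
  discriminant; so the half plane where the form is nonpositive is close to \<open>a\<close> if \<open>q\<close> is large.\<close>

lemma nonpositive_half_plane:
  assumes f: "f = qform A B D" "B^2 - A * D = \<eta>"
    and \<delta>: "\<delta> = a$1 * b$2 - a$2 * b$1" and neg: "f a < 0" and pos: "f b > 0" and z: "ev f z \<le> 0"
  shows "(f b)^2 * ev (det_form a) z \<le> 6 * \<eta> * \<delta>^2 * ev (det_form b) z"
proof -
  define p q where "p = - f a" "q = f b"
  define m where "m = A * a$1 * b$1 + B * (a$1 * b$2 + a$2 * b$1) + D * a$2 * b$2"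
  have pq: "p > 0" "q > 0" using neg pos by (auto simp: p_q_def)
  have "m^2 + p * q = (B^2 - A * D) * \<delta>^2"
    unfolding m_def p_q_def f(1) qform_def \<delta> by algebra
  hence disc: "m^2 + p * q = \<eta> * \<delta>^2" unfolding f(2) .
  hence bounds: "m^2 \<le> \<eta> * \<delta>^2" "p * q \<le> \<eta> * \<delta>^2"
    using mult_pos_pos[OF pq] zero_le_power2[of m] by linarith+
  have key: "2 * q * (f v * \<delta>^2) \<ge> q^2 * det_form a v - 6 * \<eta> * \<delta>^2 * det_form b v" for v
  proof -
    \<comment> \<open>By Cramer's rule \<delta>v = xa + yb, so f is expanded in the basis a, b with
      polar value m, and then the square is completed.\<close>
    define x y where "x = v$1 * b$2 - v$2 * b$1" "y = a$1 * v$2 - a$2 * v$1"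
    have "f v * \<delta>^2 = - p * x^2 + 2 * m * x * y + q * y^2"
      unfolding x_y_def m_def p_q_def f(1) qform_def \<delta> by algebra
    hence "2 * q * (f v * \<delta>^2) = (q * y + 2 * m * x)^2 + q^2 * y^2 - (2 * (p * q) + 4 * m^2) * x^2"
      by algebra
    also have "\<dots> \<ge> q^2 * y^2 - (2 * (\<eta> * \<delta>^2) + 4 * (\<eta> * \<delta>^2)) * x^2"
    proof -
      have "(2 * (p * q) + 4 * m^2) * x^2 \<le> (2 * (\<eta> * \<delta>^2) + 4 * (\<eta> * \<delta>^2)) * x^2"
        using bounds by (intro mult_right_mono) auto
      moreover have "(q * y + 2 * m * x)^2 \<ge> 0" by simp
      ultimately show ?thesis by linarith
    qed
    also have "q^2 * y^2 - (2 * (\<eta> * \<delta>^2) + 4 * (\<eta> * \<delta>^2)) * x^2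
        = q^2 * det_form a v - 6 * \<eta> * \<delta>^2 * det_form b v"
      unfolding det_form_def x_y_def by algebra
    finally show ?thesis .
  qed
  have "q^2 * ev (det_form a) z - 6 * \<eta> * \<delta>^2 * ev (det_form b) z \<le> 2 * q * (ev f z * \<delta>^2)"
  proof (cases z)
    case None thus ?thesis using key[of "vec2 1 0"] by simp
  next
    case (Some w)
    thus ?thesis using key[of "vec2 (Re w) 1"] key[of "vec2 (Im w) 0"] by (simp add: algebra_simps)
  qed
  also have "\<dots> \<le> 0" using z pq by (simp add: mult_le_0_iff)
  finally show ?thesis by (simp add: p_q_def)
qed

text \<open>A form is determined by its values at a and b and its polar value m, and the
  discriminant bounds m.\<close>

lemma form_bounded_by_values:
  assumes f: "f = qform A B D" "B^2 - A * D = \<eta>"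
    and \<delta>: "\<delta> = a$1 * b$2 - a$2 * b$1" and neg: "f a < 0" and pos: "f b > 0"
    and le: "- f a \<le> C" "f b \<le> C" "1 \<le> C" "\<eta> * \<delta>^2 \<le> C"
    and K: "\<bar>a$1\<bar> \<le> K" "\<bar>a$2\<bar> \<le> K" "\<bar>b$1\<bar> \<le> K" "\<bar>b$2\<bar> \<le> K"
  shows "\<bar>A\<bar> * \<delta>^2 \<le> 4 * K^2 * C" "\<bar>B\<bar> * \<delta>^2 \<le> 4 * K^2 * C" "\<bar>D\<bar> * \<delta>^2 \<le> 4 * K^2 * C"
proof -
  define m where "m = A * a$1 * b$1 + B * (a$1 * b$2 + a$2 * b$1) + D * a$2 * b$2"
  have "m^2 - f a * f b = (B^2 - A * D) * \<delta>^2"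
    unfolding m_def f(1) qform_def \<delta> by algebra
  moreover have "f a * f b < 0" using neg pos by (simp add: mult_less_0_iff)
  ultimately have "m^2 \<le> C" unfolding f(2) using le(4) by linarith
  also have "C \<le> C^2" using le(3) by (simp add: power2_eq_square)
  finally have m: "\<bar>m\<bar> \<le> C" using le(3) by (simp add: abs_le_square_iff[symmetric])
  have fa: "\<bar>f a\<bar> \<le> C" and fb: "\<bar>f b\<bar> \<le> C" using neg pos le by auto
  have prod: "\<bar>u * v * t\<bar> \<le> K^2 * C" if "\<bar>u\<bar> \<le> K" "\<bar>v\<bar> \<le> K" "\<bar>t\<bar> \<le> C" for u v t
    unfolding abs_mult power2_eq_square using that by (intro mult_mono) auto
  have abs: "\<bar>x\<bar> * \<delta>^2 = \<bar>x * \<delta>^2\<bar>" for x by (simp add: abs_mult)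
  have "A * \<delta>^2 = b$2 * b$2 * f a - 2 * (a$2 * b$2 * m) + a$2 * a$2 * f b"
    "D * \<delta>^2 = b$1 * b$1 * f a - 2 * (a$1 * b$1 * m) + a$1 * a$1 * f b"
    "B * \<delta>^2 = - (b$1 * b$2 * f a) + (a$1 * b$2 * m) + (a$2 * b$1 * m) - a$1 * a$2 * f b"
    unfolding m_def f(1) qform_def \<delta> by algebra+
  note eqs = this
  have tri: "\<bar>x - 2 * y + z\<bar> \<le> 4 * E" if "\<bar>x\<bar> \<le> E" "\<bar>y\<bar> \<le> E" "\<bar>z\<bar> \<le> E" for x y z E :: real
    using that by linarith
  have tri': "\<bar>- x + y + z - w\<bar> \<le> 4 * E"
    if "\<bar>x\<bar> \<le> E" "\<bar>y\<bar> \<le> E" "\<bar>z\<bar> \<le> E" "\<bar>w\<bar> \<le> E" for x y z w E :: real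
    using that by linarith
  show "\<bar>A\<bar> * \<delta>^2 \<le> 4 * K^2 * C"
    unfolding abs eqs(1) mult.assoc[of 4] by (intro tri prod K fa fb m)
  show "\<bar>D\<bar> * \<delta>^2 \<le> 4 * K^2 * C"
    unfolding abs eqs(2) mult.assoc[of 4] by (intro tri prod K fa fb m)
  show "\<bar>B\<bar> * \<delta>^2 \<le> 4 * K^2 * C"
    unfolding abs eqs(3) mult.assoc[of 4] by (intro tri' prod K fa fb m)
qed

section \<open>Crossing points of a geodesic continued fraction\<close>

lemma rep_of_inject: "rep_of v \<xi> \<Longrightarrow> rep_of v \<xi>' \<Longrightarrow> \<xi> = \<xi>'"
  unfolding rep_of_def by (cases \<xi>; cases \<xi>') (auto simp: vec2_scaleR vec2_eq_iff)

section \<open>The matrices of the expansion and the lifted end points\<close>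

lemma Delta237D: "B \<in> Delta237 \<Longrightarrow> det B = 1 \<and> B \<in> ord_lattice"
  unfolding Delta237_def using hurwitz_order_subset by blast

lemma det_gcf_matrix: "det B\<^sub>0 = 1 \<Longrightarrow> det (gcf_matrix B\<^sub>0 i k) = 1"
  by (induction k) (simp_all add: det_mul det_step_matrix)

lemma gcf_matrix_in_lattice: "B\<^sub>0 \<in> ord_lattice \<Longrightarrow> gcf_matrix B\<^sub>0 i k \<in> ord_lattice"
  by (induction k)
    (simp_all add: step_matrix_def ord_lattice_mult mat_pow_in_lattice g2_in_lattice)

text \<open>The lifts are never renormalised, so parameters of points on the geodesic are comparable
  for all k.\<close>

definition gcf_lift :: "real^2^2 \<Rightarrow> (nat \<Rightarrow> nat) \<Rightarrow> real option \<Rightarrow> nat \<Rightarrow> real^2" where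
  "gcf_lift B\<^sub>0 i \<xi> k = matrix_inv (gcf_matrix B\<^sub>0 i k) *v rep \<xi>"

lemma gcf_lift_Suc:
  assumes "det B\<^sub>0 = 1"
  shows "gcf_lift B\<^sub>0 i \<xi> (Suc k) = matrix_inv (step_matrix (i (Suc k))) *v gcf_lift B\<^sub>0 i \<xi> k"
  unfolding gcf_lift_def gcf_matrix.simps
  by (rule matrix_inv_mult[OF det_gcf_matrix[OF assms] det_step_matrix])

lemma rep_of_gcf_lift:
  assumes "det B\<^sub>0 = 1" shows "rep_of (gcf_lift B\<^sub>0 i \<xi> k) (gcf_end B\<^sub>0 i \<xi> k)"
proof (induction k)
  case 0
  have "det (matrix_inv B\<^sub>0) \<noteq> 0" using det_matrix_inv[OF assms] by simp
  thus ?case unfolding gcf_lift_def by (simp add: rep_of_lft rep_of_rep)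
next
  case (Suc k)
  have "det (matrix_inv (step_matrix (i (Suc k)))) \<noteq> 0" using det_matrix_inv[OF det_step_matrix] by simp
  thus ?case unfolding gcf_lift_Suc[OF assms] gcf_end.simps using Suc by (rule rep_of_lft)
qed

lemma gcf_end_distinct:
  assumes "det B\<^sub>0 = 1" "\<beta> \<noteq> \<alpha>" shows "gcf_end B\<^sub>0 i \<beta> k \<noteq> gcf_end B\<^sub>0 i \<alpha> k"
proof
  assume eq: "gcf_end B\<^sub>0 i \<beta> k = gcf_end B\<^sub>0 i \<alpha> k"
  obtain c d where c: "c \<noteq> 0" "gcf_lift B\<^sub>0 i \<beta> k = c *\<^sub>R rep (gcf_end B\<^sub>0 i \<alpha> k)"
    and d: "d \<noteq> 0" "gcf_lift B\<^sub>0 i \<alpha> k = d *\<^sub>R rep (gcf_end B\<^sub>0 i \<alpha> k)"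
    using rep_of_gcf_lift[OF assms(1), of i \<beta> k] rep_of_gcf_lift[OF assms(1), of i \<alpha> k]
    unfolding rep_of_def eq by blast
  hence "gcf_lift B\<^sub>0 i \<beta> k = (c / d) *\<^sub>R gcf_lift B\<^sub>0 i \<alpha> k" by simp
  hence "gcf_matrix B\<^sub>0 i k *v gcf_lift B\<^sub>0 i \<beta> k = (c / d) *\<^sub>R (gcf_matrix B\<^sub>0 i k *v gcf_lift B\<^sub>0 i \<alpha> k)"
    by (simp add: matrix_vector_mult_scaleR)
  hence "rep \<beta> = (c / d) *\<^sub>R rep \<alpha>"
    unfolding gcf_lift_def matrix_inv_cancel(1)[OF det_gcf_matrix[OF assms(1)]] .
  hence "rep_of (rep \<beta>) \<alpha>" unfolding rep_of_def using c(1) d(1) by (intro exI[of _ "c / d"]) simp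
  thus False using rep_of_inject[OF rep_of_rep[of \<beta>]] assms(2) by blast
qed

text \<open>The geodesic from \<open>b\<close> to \<open>a\<close> enters \<open>S\<^sub>0\<close> through the edge \<open>e\<^sub>0\<close>, at parameter \<open>r\<close>.\<close>

definition crossing :: "real^2 \<Rightarrow> real^2 \<Rightarrow> real \<Rightarrow> bool" where
  "crossing b a r \<longleftrightarrow> r > 0 \<and> edge_form a < 0 \<and>
    (\<exists>w. geo_point b a r (Some w) \<and> (cmod w)^2 = \<eta> \<and> Im w > 0 \<and> - vx \<le> Re w \<and> Re w < vx)"

lemma crossing_edge_form:
  assumes "crossing b a r" shows "edge_form b = - r * edge_form a" "edge_form a < 0" "edge_form b > 0"
proof -
  obtain w where w: "geo_point b a r (Some w)" "(cmod w)^2 = \<eta>" and r: "r > 0" "edge_form a < 0"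
    using assms unfolding crossing_def by blast
  have "ev edge_form (Some w) = 0" unfolding edge_form_def ev_qform w(2) by simp
  hence "edge_form b + r * edge_form a = 0" using geo_pointD(5)[OF w(1) is_qform_edge_form] by simp
  thus *: "edge_form b = - r * edge_form a" by simp
  show "edge_form a < 0" by (rule r(2))
  thus "edge_form b > 0" unfolding * using r(1) by (simp add: mult_pos_neg)
qed

lemma reduced_crossing:
  assumes "reduced \<beta> \<alpha>" "\<beta> \<noteq> \<alpha>" "rep_of b \<beta>" "rep_of a \<alpha>"
  obtains r where "crossing b a r"
proof -
  obtain t where t: "geodesic \<beta> \<alpha> t \<in> edge 0"
    using assms(1) unfolding reduced_def enters_from_def enters_at_def by blast
  obtain x where x: "\<alpha> = Some x" "\<bar>x\<bar> < \<sigma>" using assms(1) unfolding reduced_def by blast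
  obtain w where w: "geodesic \<beta> \<alpha> t = Some w" "Im w > 0" "(cmod w)^2 = \<eta>" "- vx \<le> Re w" "Re w < vx"
    using edge_0E[OF t] .
  obtain C k where C: "C > 0" and k: "k > 0"
    "\<And>f. is_qform f \<Longrightarrow> ev f (Some w) = k * (f b + C * exp (2 * t) * f a)"
    using ev_geodesic[OF assms(2-4)] w(1) by metis
  have "geo_point b a (C * exp (2 * t)) (Some w)"
    unfolding geo_point_def using k by (intro exI[of _ "1 / k"]) auto
  moreover have "edge_form a < 0"
  proof -
    obtain c where c: "c \<noteq> 0" "a = c *\<^sub>R vec2 x 1" using assms(4) x(1) unfolding rep_of_def by auto
    have "\<bar>x\<bar>^2 < \<sigma>^2" using x(2) by (intro power_strict_mono) auto
    hence "edge_form (vec2 x 1) < 0" unfolding sqrt_eta_sq by (simp add: edge_form_def qform_def)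
    thus ?thesis using c by (simp add: is_qform_scaleR mult_pos_neg)
  qed
  ultimately show ?thesis using that[of "C * exp (2 * t)"] C w unfolding crossing_def by auto
qed

lemma crossing_step:
  assumes "crossing b a r" "\<beta> \<noteq> \<alpha>" "rep_of b \<beta>" "rep_of a \<alpha>" "n \<in> {1..6}" "leaves_from \<beta> \<alpha> n"
  obtains s where "crossing (matrix_inv (step_matrix n) *v b) (matrix_inv (step_matrix n) *v a) s"
    "r \<le> s" "s = r \<Longrightarrow> n = 6"
proof -
  obtain w where w: "geo_point b a r (Some w)" "(cmod w)^2 = \<eta>" "Im w > 0" "- vx \<le> Re w" "Re w < vx"
    and r: "r > 0" "edge_form a < 0"
    using assms(1) unfolding crossing_def by blast
  obtain s w' where s: "r \<le> s" "s = r \<Longrightarrow> n = 6"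
      "geo_point (matrix_inv (step_matrix n) *v b) (matrix_inv (step_matrix n) *v a) s (Some w')"
      "(cmod w')^2 = \<eta>" "0 < Im w'" "- vx \<le> Re w'" "Re w' < vx"
      "edge_form (matrix_inv (step_matrix n) *v a) < 0"
    using reduced_step[OF assms(2-4) w r assms(5,6)] by blast
  have "crossing (matrix_inv (step_matrix n) *v b) (matrix_inv (step_matrix n) *v a) s"
    unfolding crossing_def using s r(1) by auto
  thus ?thesis using that s(1,2) by blast
qed

lemma gcf_crossings:
  assumes "\<beta> \<noteq> \<alpha>" "gcf_expansion B\<^sub>0 \<beta> \<alpha> i"
  obtains r where "\<And>k. crossing (gcf_lift B\<^sub>0 i \<beta> k) (gcf_lift B\<^sub>0 i \<alpha> k) (r k)"
    "\<And>k. r k \<le> r (Suc k)" "\<And>k. r k < r (Suc (Suc k))"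
proof -
  have B: "det B\<^sub>0 = 1" using assms(2) Delta237D unfolding gcf_expansion_def by blast
  define b a where "b = gcf_lift B\<^sub>0 i \<beta>" "a = gcf_lift B\<^sub>0 i \<alpha>"
  have Suc: "b (Suc k) = matrix_inv (step_matrix (i (Suc k))) *v b k"
    "a (Suc k) = matrix_inv (step_matrix (i (Suc k))) *v a k" for k
    unfolding b_a_def gcf_lift_Suc[OF B] by (rule refl)+
  note rep = rep_of_gcf_lift[OF B, of i \<beta>, folded b_a_def] rep_of_gcf_lift[OF B, of i \<alpha>, folded b_a_def]
  have step: "\<exists>s. crossing (b (Suc k)) (a (Suc k)) s \<and> r \<le> s \<and> (s = r \<longrightarrow> i (Suc k) = 6)"
    if "crossing (b k) (a k) r" for k r
  proof -
    have "i (Suc k) \<in> {1..6}" "leaves_from (gcf_end B\<^sub>0 i \<beta> k) (gcf_end B\<^sub>0 i \<alpha> k) (i (Suc k))"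
      using assms(2) unfolding gcf_expansion_def by blast+
    from crossing_step[OF that gcf_end_distinct[OF B assms(1)] rep this] show ?thesis
      unfolding Suc by metis
  qed
  have "reduced (gcf_end B\<^sub>0 i \<beta> 0) (gcf_end B\<^sub>0 i \<alpha> 0)" using assms(2) unfolding gcf_expansion_def by blast
  from reduced_crossing[OF this gcf_end_distinct[OF B assms(1)] rep] obtain r0 where r0: "crossing (b 0) (a 0) r0" .
  have "\<exists>r. \<forall>k. crossing (b k) (a k) (r k) \<and> r k \<le> r (Suc k) \<and> (r (Suc k) = r k \<longrightarrow> i (Suc k) = 6)"
  proof -
    have "\<exists>r. \<forall>k. crossing (b k) (a k) (r k) \<and> (r k \<le> r (Suc k) \<and> (r (Suc k) = r k \<longrightarrow> i (Suc k) = 6))"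
      by (rule dependent_nat_choice) (use r0 step in blast)+
    thus ?thesis .
  qed
  then obtain r where r: "\<And>k. crossing (b k) (a k) (r k)" "\<And>k. r k \<le> r (Suc k)"
    "\<And>k. r (Suc k) = r k \<Longrightarrow> i (Suc k) = 6" by blast
  have "r k < r (Suc (Suc k))" for k
  proof (rule ccontr)
    assume "\<not> ?thesis"
    hence "r (Suc k) = r k" "r (Suc (Suc k)) = r (Suc k)" using r(2)[of k] r(2)[of "Suc k"] by linarith+
    hence 6: "i (Suc k) = 6" "i (Suc (Suc k)) = 6" using r(3) by blast+
    \<comment> \<open>Two consecutive indices 6 would make three negative numbers add up to
      0.\<close>
    have "edge_form (a k) + edge_form (a (Suc k)) + edge_form (a (Suc (Suc k))) = 0"
      unfolding Suc 6 by (rule edge_form_rotation_sum)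
    moreover have "edge_form (a k) < 0" for k using crossing_edge_form(2)[OF r(1)] .
    ultimately show False by (smt (verit))
  qed
  thus ?thesis using that r(1,2) unfolding b_a_def by blast
qed

text \<open>A pigeonhole argument: bounded values at both end points leave finitely many forms, and
  each form occurs for finitely many k.\<close>

lemma gcf_forms_diverge:
  assumes "\<beta> \<noteq> \<alpha>" "gcf_expansion B\<^sub>0 \<beta> \<alpha> i"
  shows "finite {k. edge_form (gcf_lift B\<^sub>0 i \<beta> k) \<le> C}"
proof -
  have B: "det B\<^sub>0 = 1" "B\<^sub>0 \<in> ord_lattice" using assms(2) Delta237D unfolding gcf_expansion_def by blast+
  note detk = det_gcf_matrix[OF B(1), of i]
  obtain r where r: "\<And>k. crossing (gcf_lift B\<^sub>0 i \<beta> k) (gcf_lift B\<^sub>0 i \<alpha> k) (r k)"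
    "\<And>k. r k \<le> r (Suc k)" "\<And>k. r k < r (Suc (Suc k))"
    using gcf_crossings[OF assms] by blast
  define f where "f = (\<lambda>k v. edge_form (matrix_inv (gcf_matrix B\<^sub>0 i k) *v v))"
  have fr: "f k (rep \<xi>) = edge_form (gcf_lift B\<^sub>0 i \<xi> k)" for k \<xi> by (simp add: f_def gcf_lift_def)
  have neg: "f k (rep \<alpha>) < 0" and pos: "f k (rep \<beta>) > 0" and ratio: "f k (rep \<beta>) = - r k * f k (rep \<alpha>)" for k
    unfolding fr using crossing_edge_form[OF r(1)] by auto
  have mono: "r k \<le> r l" if "k \<le> l" for k l using lift_Suc_mono_le[of r, OF r(2) that] .
  have rpos: "r 0 > 0" using r(1)[of 0] unfolding crossing_def by blast
  \<comment> \<open>A form determines the ratio \<open>r k\<close>, which has strictly grown two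
    steps later.\<close>
  have fib: "finite {k. f k = g}" for g
  proof (cases "\<exists>k0. f k0 = g")
    case True
    then obtain k0 where k0: "f k0 = g" by blast
    have eq: "r k = r k0" if "f k = g" for k
    proof -
      have "- r k * g (rep \<alpha>) = - r k0 * g (rep \<alpha>)" using ratio[of k] ratio[of k0] that k0 by simp
      thus ?thesis using neg[of k0] k0 by simp
    qed
    have "k \<le> Suc k0" if "f k = g" for k
    proof (rule ccontr)
      assume "\<not> ?thesis"
      hence "r (Suc (Suc k0)) \<le> r k" by (intro mono) simp
      thus False using eq[OF that] r(3)[of k0] by simp
    qed
    hence "{k. f k = g} \<subseteq> {..Suc k0}" by blast
    thus ?thesis by (rule finite_subset) simp
  qed simp
  define a b where "a = rep \<alpha>" "b = rep \<beta>"
  define \<delta> where "\<delta> = a$1 * b$2 - a$2 * b$1"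
  have "\<delta> \<noteq> 0" using assms(1) unfolding \<delta>_def a_b_def by (cases \<alpha>; cases \<beta>) auto
  define K where "K = \<bar>a$1\<bar> + \<bar>a$2\<bar> + \<bar>b$1\<bar> + \<bar>b$2\<bar>"
  \<comment> \<open>X dominates every quantity to be bounded by
    \<open>form_bounded_by_values\<close>; the bound for \<open>- f k a\<close> comes from
    \<open>r 0 \<le> r k\<close>.\<close>
  define X where "X = \<bar>C\<bar> + \<bar>C\<bar> / r 0 + 1 + \<eta> * \<delta>^2"
  define F where "F = {f. (\<exists>A B D. f = qform A B D \<and> \<bar>A\<bar> \<le> 4 * K^2 * X / \<delta>^2 \<and> \<bar>B\<bar> \<le> 4 * K^2 * X / \<delta>^2
      \<and> \<bar>D\<bar> \<le> 4 * K^2 * X / \<delta>^2) \<and>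
     (\<exists>M\<in>ord_lattice. det M = 1 \<and> f = (\<lambda>v. edge_form (matrix_inv M *v v)))}"
  have "f k \<in> F" if k: "edge_form (gcf_lift B\<^sub>0 i \<beta> k) \<le> C" for k
  proof -
    obtain A B D where ABD: "f k = qform A B D" "B^2 - A * D = \<eta>"
      unfolding f_def using edge_form_orbit[OF detk] .
    have fC: "f k b \<le> C" using k fr by (simp add: a_b_def)
    have "r 0 * (- f k a) \<le> r k * (- f k a)" using neg[of k] mono[of 0 k]
      by (intro mult_right_mono) (auto simp: a_b_def)
    also have "\<dots> = f k b" using ratio[of k] by (simp add: a_b_def)
    finally have "- f k a \<le> C / r 0" using fC rpos by (simp add: field_simps)
    moreover have "C / r 0 \<le> \<bar>C\<bar> / r 0" using rpos by (intro divide_right_mono) auto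
    moreover have "\<bar>C\<bar> / r 0 \<ge> 0" "\<eta> * \<delta>^2 \<ge> 0" using rpos eta_gt_1 by simp_all
    ultimately have X: "- f k a \<le> X" "f k b \<le> X" "1 \<le> X" "\<eta> * \<delta>^2 \<le> X"
      using fC unfolding X_def by linarith+
    have Kb: "\<bar>a$1\<bar> \<le> K" "\<bar>a$2\<bar> \<le> K" "\<bar>b$1\<bar> \<le> K" "\<bar>b$2\<bar> \<le> K" by (simp_all add: K_def)
    note bd = form_bounded_by_values[OF ABD \<delta>_def _ _ X Kb]
    have "\<delta>^2 > 0" using \<open>\<delta> \<noteq> 0\<close> by simp
    hence "\<bar>A\<bar> \<le> 4 * K^2 * X / \<delta>^2" "\<bar>B\<bar> \<le> 4 * K^2 * X / \<delta>^2" "\<bar>D\<bar> \<le> 4 * K^2 * X / \<delta>^2"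
      using bd neg[of k] pos[of k] by (simp_all add: a_b_def pos_le_divide_eq)
    hence "\<exists>A B D. f k = qform A B D \<and> \<bar>A\<bar> \<le> 4 * K^2 * X / \<delta>^2 \<and> \<bar>B\<bar> \<le> 4 * K^2 * X / \<delta>^2
      \<and> \<bar>D\<bar> \<le> 4 * K^2 * X / \<delta>^2" using ABD(1) by blast
    moreover have "\<exists>M\<in>ord_lattice. det M = 1 \<and> f k = (\<lambda>v. edge_form (matrix_inv M *v v))"
      using gcf_matrix_in_lattice[OF B(2)] detk unfolding f_def by blast
    ultimately show ?thesis unfolding F_def by blast
  qed
  hence "{k. edge_form (gcf_lift B\<^sub>0 i \<beta> k) \<le> C} \<subseteq> (\<Union>g\<in>F. {k. f k = g})" by blast
  moreover have "finite F" unfolding F_def by (rule finite_bounded_edge_forms)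
  moreover from this have "finite (\<Union>g\<in>F. {k. f k = g})" using fib by (rule finite_UN_I)
  ultimately show ?thesis by (blast intro: finite_subset)
qed

theorem theorem3p10:
  fixes \<alpha> \<beta> :: "real option" and B\<^sub>0 :: "real^2^2" and i :: "nat \<Rightarrow> nat"
  assumes "\<beta> \<noteq> \<alpha>"
    and "gcf_expansion B\<^sub>0 \<beta> \<alpha> i"
  shows "(\<forall>z :: nat \<Rightarrow> complex option. (\<forall>k. z k \<in> lft (gcf_matrix B\<^sub>0 i k) ` S0) \<longrightarrow>
            limitin P1C z (P1R_to_P1C \<alpha>) sequentially) \<and>
         (\<forall>z\<in>S0. limitin P1C (\<lambda>k. lft (gcf_matrix B\<^sub>0 i k) z) (P1R_to_P1C \<alpha>) sequentially)"
proof -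
  have B: "det B\<^sub>0 = 1" using assms(2) Delta237D unfolding gcf_expansion_def by blast
  note detk = det_gcf_matrix[OF B, of i]
  obtain r where r: "\<And>k. crossing (gcf_lift B\<^sub>0 i \<beta> k) (gcf_lift B\<^sub>0 i \<alpha> k) (r k)"
    by (rule gcf_crossings[OF assms]) (rule that)
  define \<delta> where "\<delta> = rep \<alpha>$1 * rep \<beta>$2 - rep \<alpha>$2 * rep \<beta>$1"
  have *: "limitin P1C z (P1R_to_P1C \<alpha>) sequentially"
    if z: "\<And>k. z k \<in> lft (gcf_matrix B\<^sub>0 i k) ` S0" for z
  proof (rule limitin_P1C_of_det_forms[OF assms(1)])
    fix e :: real assume e: "e > 0"
    \<comment> \<open>This C is at least 1 and satisfies 6\<eta>\<delta>^2 \<le> eC. Of the factor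
      C^2 in the final estimate, one C cancels and the other is weakened to 1.\<close>
    define C where "C = 1 + 6 * \<eta> * \<delta>^2 / e"
    have "6 * \<eta> * \<delta>^2 \<ge> 0" using eta_gt_1 by simp
    hence C: "1 \<le> C" "6 * \<eta> * \<delta>^2 \<le> e * C" using e by (simp_all add: C_def field_simps)
    have "eventually (\<lambda>k. \<not> edge_form (gcf_lift B\<^sub>0 i \<beta> k) \<le> C) sequentially"
      using gcf_forms_diverge[OF assms, of C] by (simp flip: cofinite_eq_sequentially add: eventually_cofinite)
    thus "eventually (\<lambda>k. ev (det_form (rep \<alpha>)) (z k) \<le> e * ev (det_form (rep \<beta>)) (z k)) sequentially"
    proof eventually_elim
      case (elim k)
      define M where "M = gcf_matrix B\<^sub>0 i k"
      define f where "f = (\<lambda>v. edge_form (matrix_inv M *v v))"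
      have qf: "is_qform f" unfolding f_def by (rule is_qform_comp) simp
      obtain w where w: "z k = lft M (Some w)" "cmod w \<le> \<sigma>" using z[of k] unfolding S0_def M_def by auto
      obtain l where l: "l > 0" "ev (\<lambda>v. f (M *v v)) (Some w) = l * ev f (z k)"
        using ev_lft[of M "Some w"] detk[of k] qf unfolding w(1) M_def by auto
      have "(\<lambda>v. f (M *v v)) = edge_form"
        unfolding f_def M_def by (simp only: matrix_inv_cancel(2)[OF detk])
      moreover have "ev edge_form (Some w) \<le> 0"
        using power_mono[OF w(2), of 2] unfolding edge_form_def ev_qform sqrt_eta_sq by simp
      ultimately have ez: "ev f (z k) \<le> 0" using l by (simp add: mult_le_0_iff del: ev.simps)
      obtain A B D where ABD: "f = qform A B D" "B^2 - A * D = \<eta>"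
        unfolding f_def M_def using edge_form_orbit[OF detk] .
      have fr: "f (rep \<xi>) = edge_form (gcf_lift B\<^sub>0 i \<xi> k)" for \<xi> by (simp add: f_def M_def gcf_lift_def)
      have neg: "f (rep \<alpha>) < 0" and pos: "f (rep \<beta>) > 0" unfolding fr using crossing_edge_form[OF r] by auto
      have big: "f (rep \<beta>) \<ge> C" using elim unfolding fr by simp
      define x y where "x = ev (det_form (rep \<alpha>)) (z k)" "y = ev (det_form (rep \<beta>)) (z k)"
      have nn: "x \<ge> 0" "y \<ge> 0" unfolding x_y_def by (rule det_form_nonneg)+
      have "C * x \<le> C^2 * x" using C(1) nn by (intro mult_right_mono) (auto simp: power2_eq_square)
      also have "\<dots> \<le> (f (rep \<beta>))^2 * x" using big C(1) nn by (intro mult_right_mono power_mono) auto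
      also have "\<dots> \<le> 6 * \<eta> * \<delta>^2 * y"
        unfolding x_y_def by (rule nonpositive_half_plane[OF ABD \<delta>_def neg pos ez])
      also have "\<dots> \<le> e * C * y" using C(2) nn by (intro mult_right_mono)
      finally have "C * x \<le> C * (e * y)" by (simp add: mult_ac)
      thus ?case using C(1) unfolding x_y_def by simp
    qed
  qed
  show ?thesis
  proof (intro conjI allI impI ballI)
    fix z :: "nat \<Rightarrow> complex option"
    assume "\<forall>k. z k \<in> lft (gcf_matrix B\<^sub>0 i k) ` S0"
    thus "limitin P1C z (P1R_to_P1C \<alpha>) sequentially" by (intro *) simp
  next
    fix z assume "z \<in> S0"
    thus "limitin P1C (\<lambda>k. lft (gcf_matrix B\<^sub>0 i k) z) (P1R_to_P1C \<alpha>) sequentially"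
      by (intro *) simp
  qed
qed

end
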